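(* Let $\alpha,\gamma,\beta\in(0,1]$, $a\ge 0$, $\lambda>0$. The process $$N(\mathfrak{F}^{\gamma,\beta}_t)+a\,\mathfrak{F}^{\alpha,\beta}_t,\qquad t>0,$$ where $\mathfrak{F}^{\gamma,\beta}_t=\mathfrak{A}^{\gamma}_{\mathfrak{L}^{\beta}_t}$ and $\mathfrak{F}^{\alpha,\beta}_t=\mathfrak{A}^{\alpha}_{\mathfrak{L}^{\beta}_t}$, has probability law $$\frac{\Pr\{N(\mathfrak{F}^{\gamma,\beta}_t)+a\mathfrak{F}^{\alpha,\beta}_t\in dx\}}{dx}=\sum_{k=0}^\infty\frac{(-\lambda)^k}{k!}\frac{\partial^k}{\partial\lambda^k}\int_0^\infty e^{-s\lambda^\gamma}h_\alpha(x-k,a^\alpha s)\,l_\beta(s,t)\,ds=\sum_{k=0}^\infty\frac{(-\lambda)^k}{k!}\frac{\partial^k}{\partial\lambda^k}\mathbb{E}\left[\exp(-\lambda^\gamma\mathfrak{L}^\beta_t)\,h_\alpha(x-k,a^\alpha\mathfrak{L}^\beta_t)\right],$$ and this law is the solution to the equation $$\left(\mathcal{D}^\beta_t+a^\alpha\partial^\alpha_x+\lambda^\gamma(I-K)^\gamma\right)u(x,t)=0,\qquad x\ge 0,\ t>0,$$ with initial condition $u(x,0)=\delta(x)$, where $$(I-K)^\gamma=\sum_{j=0}^\infty(-1)^j\binom{\gamma}{j}K^j$$ and $K^j$ is the shift operator $K^ju(x,t)=u(x-j,t)$.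
   Context: $N$ is a homogeneous Poisson process of rate $\lambda$. For $\nu\in(0,1)$, $\mathfrak{A}^\nu$ is a $\nu$-stable subordinator with $\mathbb{E}e^{-\xi\mathfrak{A}^\nu_t}=e^{-t\xi^\nu}$ and $\mathfrak{A}^1_t=t$. $\mathfrak{L}^\beta_t=\inf\{s\ge0:\mathfrak{A}^\beta_s>t\}$ is the inverse of a $\beta$-stable subordinator ($\mathfrak{L}^1_t=t$). The processes $N$, $\mathfrak{A}^\gamma$, $\mathfrak{A}^\alpha$, $\mathfrak{L}^\beta$ are mutually independent, and the same process $\mathfrak{L}^\beta$ is used in both $\mathfrak{F}^{\gamma,\beta}$ and $\mathfrak{F}^{\alpha,\beta}$. $h_\alpha(x,t)$ is the density in $x$ of $\mathfrak{A}^\alpha_t$ (zero for $x<0$) and $l_\beta(s,t)$ is the density in $s$ of $\mathfrak{L}^\beta_t$; in the degenerate cases ($\alpha=1$, $\beta=1$ or $a=0$) these are Dirac measures and the formulas are read in the generalized (measure/distribution) sense. Functions of $x$ are extended by $0$ to $x<0$; thus the shift $K$ is $e^{-\partial_x}$ for $a>0$, and the backward shift $Bu(x)=u(x-1)$ on integers for $a=0$ (where the law is supported on $\mathbb{N}_0$). $\partial_z^\alpha u=\frac{1}{\Gamma(1-\alpha)}\frac{\partial}{\partial z}\int_0^z\frac{u(s)\,ds}{(z-s)^\alpha}$ is the Riemann–Liouville derivative and $\mathcal{D}^\beta_tu=\partial_t^\beta u-u(0^+)\frac{t^{-\beta}}{\Gamma(1-\beta)}$ the Dzhrbashyan–Caputo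 derivative; for order $1$ both are the ordinary first derivative. The equation is understood for generalized functions, via Laplace transforms in $x$ and $t$. *)

theory Defs
  imports "HOL-Probability.Probability"
begin

section \<open>Processes indexed by the half-line\<close>

text \<open>
  A process is a function of a real time and an outcome; only times \<open>t \<ge> 0\<close> are meaningful.
\<close>

definition subordinator :: "'a measure \<Rightarrow> (real \<Rightarrow> 'a \<Rightarrow> real) \<Rightarrow> bool" where
  "subordinator M Y \<longleftrightarrow>
     (\<forall>t\<ge>0. Y t \<in> borel_measurable M) \<and>
     (\<forall>\<omega>\<in>space M. Y 0 \<omega> = 0 \<and> mono_on {0..} (\<lambda>t. Y t \<omega>) \<and>
        (\<forall>t\<ge>0. continuous (at_right t) (\<lambda>s. Y s \<omega>))) \<and>
     (\<forall>n (\<tau> :: nat \<Rightarrow> real). 0 \<le> \<tau> 0 \<longrightarrow> incseq \<tau> \<longrightarrow>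
        prob_space.indep_vars M (\<lambda>_. borel) (\<lambda>i \<omega>. Y (\<tau> (Suc i)) \<omega> - Y (\<tau> i) \<omega>) {..<n}) \<and>
     (\<forall>s\<ge>0. \<forall>t\<ge>0. distr M borel (\<lambda>\<omega>. Y (s + t) \<omega> - Y s \<omega>) = distr M borel (Y t))"

definition stable_subordinator :: "'a measure \<Rightarrow> real \<Rightarrow> (real \<Rightarrow> 'a \<Rightarrow> real) \<Rightarrow> bool" where
  "stable_subordinator M \<nu> Y \<longleftrightarrow>
     (if \<nu> = 1 then \<forall>t\<ge>0. \<forall>\<omega>\<in>space M. Y t \<omega> = t
      else subordinator M Y \<and>
        (\<forall>t\<ge>0. \<forall>\<xi>\<ge>0. (LINT \<omega>|M. exp (- \<xi> * Y t \<omega>)) = exp (- t * \<xi> powr \<nu>)))"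

definition poisson_process :: "'a measure \<Rightarrow> real \<Rightarrow> (real \<Rightarrow> 'a \<Rightarrow> nat) \<Rightarrow> bool" where
  "poisson_process M lam N \<longleftrightarrow>
     subordinator M (\<lambda>t \<omega>. real (N t \<omega>)) \<and>
     (\<forall>t>0. distr M (count_space UNIV) (N t) = measure_pmf (poisson_pmf (lam * t)))"

text \<open>
  The defining identity is required almost surely: on the null event where the path of \<open>H\<close> is
  bounded the infimum is taken over the empty set, which has no meaningful value in \<open>real\<close>.
\<close>

definition inverse_stable_subordinator :: "'a measure \<Rightarrow> real \<Rightarrow> (real \<Rightarrow> 'a \<Rightarrow> real) \<Rightarrow> bool" where
  "inverse_stable_subordinator M \<nu> L \<longleftrightarrow>
     (\<forall>t\<ge>0. L t \<in> borel_measurable M \<and> (\<forall>\<omega>\<in>space M. 0 \<le> L t \<omega>)) \<and>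
     (\<exists>H. stable_subordinator M \<nu> H \<and>
        (AE \<omega> in M. \<forall>t\<ge>0. L t \<omega> = Inf {s. 0 \<le> s \<and> t < H s \<omega>}))"

definition indep_processes :: "'a measure \<Rightarrow> (real \<Rightarrow> 'a \<Rightarrow> real) list \<Rightarrow> bool" where
  "indep_processes M Ys \<longleftrightarrow>
     prob_space.indep_vars M (\<lambda>_. PiM {0..} (\<lambda>_. borel))
       (\<lambda>i \<omega>. restrict (\<lambda>t. (Ys ! i) t \<omega>) {0..}) {..<length Ys}"

definition time_change :: "(real \<Rightarrow> 'a \<Rightarrow> 'b) \<Rightarrow> (real \<Rightarrow> 'a \<Rightarrow> real) \<Rightarrow> real \<Rightarrow> 'a \<Rightarrow> 'b" where
  "time_change Y T t \<omega> = Y (T t \<omega>) \<omega>"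

definition drifted_process ::
  "real \<Rightarrow> (real \<Rightarrow> 'a \<Rightarrow> nat) \<Rightarrow> (real \<Rightarrow> 'a \<Rightarrow> real) \<Rightarrow> (real \<Rightarrow> 'a \<Rightarrow> real) \<Rightarrow> (real \<Rightarrow> 'a \<Rightarrow> real)
     \<Rightarrow> real \<Rightarrow> 'a \<Rightarrow> real" where
  "drifted_process a N Ag Aa L t \<omega> =
     real (time_change N (time_change Ag L) t \<omega>) + a * time_change Aa L t \<omega>"

text \<open>
  Densities \<open>h(x,s)\<close> in \<open>x\<close> of \<open>Y s\<close>, for \<open>s > 0\<close>.  Joint measurability is what makes
  integrals over \<open>s\<close> independent of the choice of versions, up to null sets of \<open>x\<close>.
\<close>

definition density_family :: "'a measure \<Rightarrow> (real \<Rightarrow> 'a \<Rightarrow> real) \<Rightarrow> (real \<Rightarrow> real \<Rightarrow> real) \<Rightarrow> bool" where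
  "density_family M Y h \<longleftrightarrow>
     (\<lambda>(x, s). h x s) \<in> borel_measurable (borel \<Otimes>\<^sub>M borel) \<and>
     (\<forall>x s. 0 \<le> h x s) \<and> (\<forall>x<0. \<forall>s. h x s = 0) \<and>
     (\<forall>s>0. distributed M lborel (Y s) (\<lambda>x. ennreal (h x s)))"

text \<open>
  The series \<open>\<Sum>k. (-\<lambda>)^k / k! * d^k/d\<lambda>^k f\<^sub>k(\<lambda>)\<close> converges to \<open>p\<close>.  The first conjunct ensures
  that the iterated derivatives are genuine derivatives.
\<close>

definition deriv_series_sums :: "real \<Rightarrow> (nat \<Rightarrow> real \<Rightarrow> real) \<Rightarrow> real \<Rightarrow> bool" where
  "deriv_series_sums lam f p \<longleftrightarrow>
     (\<forall>k j. \<forall>m>0. (deriv ^^ j) (f k) field_differentiable (at m)) \<and>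
     (\<lambda>k. (- lam) ^ k / fact k * (deriv ^^ k) (f k) lam) sums p"


section \<open>Generalized functions of $x$ and $t$, and the equation\<close>

text \<open>
  A family \<open>u\<close> of measures \<open>u t\<close> on \<open>[0,\<infinity>)\<close>, \<open>t > 0\<close>, is the generalized function \<open>u(dx,t) dt\<close>;
  generalized functions are given by their values on test functions \<open>\<phi> x t\<close>.  Derivatives are
  distributional, \<open>\<langle>\<partial>T, \<phi>\<rangle> = - \<langle>T, \<partial>\<phi>\<rangle>\<close>, and all objects are extended by zero to the negative
  half-lines.  The Laplace transform in \<open>x\<close> and \<open>t\<close> is the value on \<open>exp (- \<xi> x - \<eta> t)\<close>.
\<close>

definition pairing :: "(real \<Rightarrow> real measure) \<Rightarrow> (real \<Rightarrow> real \<Rightarrow> real) \<Rightarrow> real" where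
  "pairing u \<phi> = (LINT t:{0<..}|lborel. (LINT x|u t. \<phi> x t))"

text \<open>
  \<open>1/\<Gamma>(1-\<alpha>) \<integral>\<^sub>0\<^sup>x u(dy,t) (x-y)^(-\<alpha>)\<close>, as an absolutely continuous measure in \<open>x\<close>; no integration
  for \<open>\<alpha> = 1\<close>.
\<close>

definition frac_integral_x :: "real \<Rightarrow> (real \<Rightarrow> real measure) \<Rightarrow> real \<Rightarrow> real measure" where
  "frac_integral_x \<alpha> u t =
     (if \<alpha> = 1 then u t
      else density lborel (\<lambda>x. \<integral>\<^sup>+y. ennreal ((x - y) powr (- \<alpha>) / Gamma (1 - \<alpha>)) * indicator {0..<x} y \<partial>u t))"

definition riemann_liouville_x ::
  "real \<Rightarrow> (real \<Rightarrow> real measure) \<Rightarrow> (real \<Rightarrow> real \<Rightarrow> real) \<Rightarrow> real" where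
  "riemann_liouville_x \<alpha> u \<phi> = - pairing (frac_integral_x \<alpha> u) (\<lambda>x t. deriv (\<lambda>y. \<phi> y t) x)"

definition frac_integral :: "real \<Rightarrow> (real \<Rightarrow> real) \<Rightarrow> real \<Rightarrow> real" where
  "frac_integral \<beta> f t =
     (if \<beta> = 1 then f t
      else 1 / Gamma (1 - \<beta>) * (LINT s:{0<..<t}|lborel. f s / (t - s) powr \<beta>))"

definition riemann_liouville_t ::
  "real \<Rightarrow> (real \<Rightarrow> real measure) \<Rightarrow> (real \<Rightarrow> real \<Rightarrow> real) \<Rightarrow> real" where
  "riemann_liouville_t \<beta> u \<phi> =
     - (LINT t:{0<..}|lborel. frac_integral \<beta> (\<lambda>s. LINT x|u s. deriv (\<phi> x) t) t)"

text \<open>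
  \<open>u 0\<close> plays the role of \<open>u(0\<^sup>+)\<close> (solutions are weakly continuous at \<open>0\<close>).  For \<open>\<beta> = 1\<close> the
  operator is the ordinary derivative on \<open>t > 0\<close>; the subtracted term removes the mass
  \<open>u(0\<^sup>+) \<delta>(t)\<close> which the distributional derivative of the extension by zero has at \<open>t = 0\<close>.
  It is also the limit of the kernel \<open>t^(-\<beta>)/\<Gamma>(1-\<beta>)\<close> as \<open>\<beta>\<close> tends to \<open>1\<close>.
\<close>

definition dzhrbashyan_caputo_t ::
  "real \<Rightarrow> (real \<Rightarrow> real measure) \<Rightarrow> (real \<Rightarrow> real \<Rightarrow> real) \<Rightarrow> real" where
  "dzhrbashyan_caputo_t \<beta> u \<phi> =
     riemann_liouville_t \<beta> u \<phi> -
     (if \<beta> = 1 then (LINT x|u 0. \<phi> x 0)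
      else (LINT t:{0<..}|lborel. t powr (- \<beta>) / Gamma (1 - \<beta>) * (LINT x|u 0. \<phi> x t)))"

text \<open>
  \<open>K^j u(x,t) = u(x-j,t)\<close> is the image of the measure under \<open>x \<mapsto> x + j\<close>, both for densities
  and for laws on the integers.
\<close>

definition shift :: "nat \<Rightarrow> (real \<Rightarrow> real measure) \<Rightarrow> real \<Rightarrow> real measure" where
  "shift j u t = distr (u t) borel (\<lambda>x. x + real j)"

definition frac_difference ::
  "real \<Rightarrow> (real \<Rightarrow> real measure) \<Rightarrow> (real \<Rightarrow> real \<Rightarrow> real) \<Rightarrow> real" where
  "frac_difference \<gamma> u \<phi> = (\<Sum>j. (-1) ^ j * (\<gamma> gchoose j) * pairing (shift j u) \<phi>)"

definition satisfies_equation ::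
  "real \<Rightarrow> real \<Rightarrow> real \<Rightarrow> real \<Rightarrow> real \<Rightarrow> (real \<Rightarrow> real measure) \<Rightarrow> bool" where
  "satisfies_equation \<alpha> \<beta> \<gamma> a lam u \<longleftrightarrow>
     (\<forall>\<xi>>0. \<forall>\<eta>>0. let \<phi> = (\<lambda>x t. exp (- \<xi> * x - \<eta> * t)) in
        dzhrbashyan_caputo_t \<beta> u \<phi> + a powr \<alpha> * riemann_liouville_x \<alpha> u \<phi>
          + lam powr \<gamma> * frac_difference \<gamma> u \<phi> = 0)"

text \<open>
  Solutions are sought among weakly continuous families of finite measures on \<open>[0,\<infinity>)\<close> which
  have a Laplace transform in \<open>t\<close>.
\<close>

definition is_solution ::
  "real \<Rightarrow> real \<Rightarrow> real \<Rightarrow> real \<Rightarrow> real \<Rightarrow> (real \<Rightarrow> real measure) \<Rightarrow> bool" where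
  "is_solution \<alpha> \<beta> \<gamma> a lam u \<longleftrightarrow>
     (\<forall>t\<ge>0. sets (u t) = sets borel \<and> finite_measure (u t) \<and> emeasure (u t) {..<0} = 0) \<and>
     (\<forall>f :: real \<Rightarrow> real. continuous_on UNIV f \<longrightarrow> bounded (range f) \<longrightarrow>
        continuous_on {0..} (\<lambda>t. LINT x|u t. f x)) \<and>
     (\<forall>\<eta>>0. set_integrable lborel {0<..} (\<lambda>t. exp (- \<eta> * t) * measure (u t) UNIV)) \<and>
     u 0 = return borel 0 \<and>
     satisfies_equation \<alpha> \<beta> \<gamma> a lam u"

end

theory Submission
  imports Defs
begin

text \<open>
  Conditioning on the inverse subordinator \<open>L t = s\<close>, the summands \<open>N (Ag s)\<close> and \<open>a Aa s\<close> are
  independent, and \<open>a Aa s\<close> is distributed as \<open>Aa (a\<^sup>\<alpha> s)\<close>. The probabilities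
  \<open>E ((\<lambda> Ag s)\<^sup>k / k! exp (- \<lambda> Ag s))\<close> of \<open>N (Ag s) = k\<close> are \<open>(-\<lambda>)\<^sup>k / k!\<close> times the \<open>k\<close>-th
  derivative of \<open>E exp (- \<lambda> Ag s) = exp (- s \<lambda>\<^sup>\<gamma>)\<close>, and differentiation under the integral sign
  gives the series. For the equation, the Laplace transform in \<open>x\<close> of the law is
  \<open>E exp (- \<Psi> L t)\<close> with \<open>\<Psi> = a\<^sup>\<alpha> \<xi>\<^sup>\<alpha> + \<lambda>\<^sup>\<gamma> (1 - exp (-\<xi>))\<^sup>\<gamma>\<close>, so that its Laplace transform in
  \<open>t\<close> is \<open>\<eta>\<^sup>\<beta> / (\<eta> (\<eta>\<^sup>\<beta> + \<Psi>))\<close>; the equation states exactly this, and Laplace transforms determine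
  weakly continuous families of finite measures.
\<close>

section \<open>Laplace transforms of measures on the half-line\<close>

text \<open>Interchanges of sums and integrals are made for nonnegative integrands in
  \<open>ennreal\<close>; real values are recovered afterwards. The power \<lambda>^\<gamma> is
  never differentiated by hand: \<open>exp (- s * m powr \<gamma>)\<close> is the expectation of
  \<open>exp (- m * Ag s)\<close>, so every function in the series is a Laplace transform in m over
  two copies of the probability space, smooth for m > 0 even if \<open>Ag s\<close> has infinite
  mean. The factor with h does not depend on m, so the measure form and the density form are one
  statement with different weights. The probabilistic obstacle is evaluation at random times: joint
  measurability has to come from right-continuous paths, and the inverse behaves well only almost
  surely, once bounded or flat paths of the inverted subordinator are excluded. For uniqueness,
  exponential test functions turn the equation into a linear identity for the double transform with
  a strictly positive coefficient. Inverting in t gives equality at every t > 0 by continuity; time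
  0 is settled by the initial condition.\<close>

definition half_line_measure :: "real measure \<Rightarrow> bool" where
  "half_line_measure \<mu> \<longleftrightarrow> sets \<mu> = sets borel \<and> finite_measure \<mu> \<and> emeasure \<mu> {..<0} = 0"

definition laplace :: "real measure \<Rightarrow> real \<Rightarrow> real" where
  "laplace \<mu> \<xi> = (LINT x|\<mu>. exp (- \<xi> * x))"

lemma half_line_measureD:
  assumes "half_line_measure \<mu>"
  shows "sets \<mu> = sets borel" "finite_measure \<mu>" "AE x in \<mu>. 0 \<le> x"
proof -
  show s: "sets \<mu> = sets borel" "finite_measure \<mu>" using assms by (auto simp: half_line_measure_def)
  show "AE x in \<mu>. 0 \<le> x"
    by (rule AE_I[where N="{..<0}"]) (use assms s in \<open>auto simp: half_line_measure_def\<close>)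
qed

lemma half_line_measureI:
  assumes "sets \<mu> = sets borel" "finite_measure \<mu>" "AE x in \<mu>. 0 \<le> x"
  shows "half_line_measure \<mu>"
proof -
  have "emeasure \<mu> {..<0} = emeasure \<mu> {}"
    by (rule emeasure_eq_AE) (use assms in \<open>auto elim: eventually_mono\<close>)
  then show ?thesis using assms by (simp add: half_line_measure_def)
qed

lemma half_line_integrable:
  assumes "half_line_measure \<mu>" "f \<in> borel_measurable borel" "\<And>x. 0 \<le> x \<Longrightarrow> norm (f x) \<le> K"
  shows "integrable \<mu> (f :: real \<Rightarrow> real)"
proof -
  interpret finite_measure \<mu> using half_line_measureD[OF assms(1)] by simp
  show ?thesis
  proof (rule integrable_const_bound)
    show "AE x in \<mu>. norm (f x) \<le> K"
      using half_line_measureD(3)[OF assms(1)] by eventually_elim (rule assms)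
    show "f \<in> borel_measurable \<mu>"
      using assms(2) half_line_measureD(1)[OF assms(1)] by (simp cong: measurable_cong_sets)
  qed
qed

lemma half_line_integrable_exp:
  "half_line_measure \<mu> \<Longrightarrow> 0 \<le> \<xi> \<Longrightarrow> integrable \<mu> (\<lambda>x. exp (- \<xi> * x))"
  by (rule half_line_integrable[where K=1]) auto

lemma laplace_0: "finite_measure \<mu> \<Longrightarrow> laplace \<mu> 0 = measure \<mu> (space \<mu>)"
  by (simp add: laplace_def)

text \<open>Recovers the total mass from the transform at positive arguments, the only ones at which
  the equation gives information.\<close>

lemma laplace_tendsto_0:
  assumes "half_line_measure \<mu>"
  shows "(\<lambda>n. laplace \<mu> (1 / real (Suc n))) \<longlonglongrightarrow> laplace \<mu> 0"
  unfolding laplace_def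
proof (rule integral_dominated_convergence[where w="\<lambda>_. 1"])
  note s[measurable_cong] = half_line_measureD(1)[OF assms]
  interpret finite_measure \<mu> using half_line_measureD[OF assms] by simp
  show "integrable \<mu> (\<lambda>_. 1::real)" by simp
  show "AE x in \<mu>. (\<lambda>i. exp (- (1 / real (Suc i)) * x)) \<longlonglongrightarrow> exp (- 0 * x)"
    using LIMSEQ_inverse_real_of_nat
    by (intro AE_I2 tendsto_intros) (auto simp: inverse_eq_divide simp del: of_nat_Suc)
  show "AE x in \<mu>. norm (exp (- (1 / real (Suc i)) * x)) \<le> 1" for i
    using half_line_measureD(3)[OF assms] by eventually_elim auto
qed (use half_line_measureD(1)[OF assms] in \<open>simp_all cong: measurable_cong_sets\<close>)

text \<open>
  After damping by \<open>exp (- \<delta> x)\<close> a bounded continuous function is a continuous function of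
  \<open>exp (- x) \<in> [0,1]\<close>, hence uniformly close to a polynomial in \<open>exp (- x)\<close>; the damping is
  harmless because the total masses converge as well.
\<close>

lemma exp_polynomial_approx:
  fixes f :: "real \<Rightarrow> real"
  assumes f: "continuous_on UNIV f" and K: "\<And>x. \<bar>f x\<bar> \<le> K" and "0 < \<delta>" "0 < e"
  obtains c :: "nat \<Rightarrow> real" and n
  where "\<And>x. 0 \<le> x \<Longrightarrow> \<bar>f x * exp (- \<delta> * x) - (\<Sum>i\<le>n. c i * exp (- real i * x))\<bar> < e"
proof -
  \<comment> \<open>With y = \<open>exp (- x)\<close> the damped function becomes
    \<open>f (- ln y) * y powr \<delta>\<close>. The value 0 at y = 0, which corresponds to x at
    infinity, is its limit because f is bounded.\<close>
  define G where "G y = (if y = 0 then 0 else f (- ln y) * y powr \<delta>)" for y :: real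
  have "continuous_on {0..1} G"
    unfolding continuous_on_def
  proof
    fix y :: real assume y: "y \<in> {0..1}"
    show "(G \<longlongrightarrow> G y) (at y within {0..1})"
    proof (cases "y = 0")
      case True
      have "(G \<longlongrightarrow> 0) (at 0 within {0..1})"
      proof (rule Lim_null_comparison)
        show "eventually (\<lambda>y. norm (G y) \<le> K * y powr \<delta>) (at 0 within {0..1})"
          using K by (intro always_eventually) (auto simp: G_def abs_mult intro!: mult_right_mono)
        have "((\<lambda>y. K * y powr \<delta>) \<longlongrightarrow> K * 0 powr \<delta>) (at 0 within {0..1})"
          using \<open>0 < \<delta>\<close> by (intro tendsto_intros) (auto simp: eventually_at_filter)
        then show "((\<lambda>y. K * y powr \<delta>) \<longlongrightarrow> 0) (at 0 within {0..1})"
          by simp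
      qed
      then show ?thesis using True by (simp add: G_def)
    next
      case False
      then have "0 < y" using y by auto
      have "isCont (\<lambda>y. f (- ln y) * y powr \<delta>) y"
      proof (rule isCont_mult)
        have "isCont (\<lambda>y. - ln y) y" using \<open>0 < y\<close> by (intro continuous_intros) auto
        then show "isCont (\<lambda>y. f (- ln y)) y"
          by (rule isCont_o2) (use f in \<open>simp add: continuous_on_eq_continuous_at\<close>)
        show "isCont (\<lambda>y. y powr \<delta>) y" using \<open>0 < y\<close> by (intro continuous_intros) auto
      qed
      then have "((\<lambda>y. f (- ln y) * y powr \<delta>) \<longlongrightarrow> G y) (at y)"
        using False by (simp add: isCont_def G_def)
      moreover have "eventually (\<lambda>z. z \<in> {0<..}) (at y)"
        using \<open>0 < y\<close> by (intro eventually_at_in_open') auto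
      then have "eventually (\<lambda>z. f (- ln z) * z powr \<delta> = G z) (at y)"
        by eventually_elim (simp add: G_def)
      ultimately have "(G \<longlongrightarrow> G y) (at y)"
        by (rule Lim_transform_eventually)
      then show ?thesis by (rule Lim_at_imp_Lim_at_within)
    qed
  qed
  then obtain g where "real_polynomial_function g" and g: "\<And>y. y \<in> {0..1} \<Longrightarrow> \<bar>G y - g y\<bar> < e"
    using Stone_Weierstrass_real_polynomial_function[of "{0..1}" G e] \<open>0 < e\<close> by auto
  then obtain c n where c: "g = (\<lambda>x. \<Sum>i\<le>n. c i * x ^ i)"
    using real_polynomial_function_iff_sum by blast
  show ?thesis
  proof
    fix x :: real assume "0 \<le> x"
    then have "\<bar>G (exp (- x)) - g (exp (- x))\<bar> < e" by (intro g) auto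
    then show "\<bar>f x * exp (- \<delta> * x) - (\<Sum>i\<le>n. c i * exp (- real i * x))\<bar> < e"
      by (simp add: G_def c powr_def flip: exp_of_nat_mult)
  qed
qed

text \<open>The filter is arbitrary so that one proof serves uniqueness, with a constant family, and
  weak continuity of the law in time. Convergence at \<xi> = 0 is part of the hypothesis and
  prevents mass from escaping to infinity.\<close>

lemma laplace_continuity:
  fixes f :: "real \<Rightarrow> real"
  assumes \<mu>: "half_line_measure \<mu>" and \<nu>: "eventually (\<lambda>i. half_line_measure (\<nu> i)) F"
    and lim: "\<And>\<xi>. 0 \<le> \<xi> \<Longrightarrow> ((\<lambda>i. laplace (\<nu> i) \<xi>) \<longlongrightarrow> laplace \<mu> \<xi>) F"
    and f: "continuous_on UNIV f" "bounded (range f)"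
  shows "((\<lambda>i. LINT x|\<nu> i. f x) \<longlongrightarrow> (LINT x|\<mu>. f x)) F"
proof (rule tendstoI)
  fix e :: real assume "0 < e"
  obtain K where K: "\<And>x. \<bar>f x\<bar> \<le> K" "0 < K"
    using f(2) by (auto simp: bounded_pos)
  define m where "m = laplace \<mu> 0 + 1"
  interpret \<mu>: finite_measure \<mu> using half_line_measureD[OF \<mu>] by simp
  have "0 < m" by (simp add: m_def laplace_0 \<mu>.finite_measure_axioms add_nonneg_pos)
  \<comment> \<open>The final estimate adds two approximation errors of at most
    \<open>e' * m + K * e'\<close> and one error below \<open>e'\<close> from the convergence of P;
    the denominator leaves one further \<open>e'\<close> to spare.\<close>
  define e' where "e' = e / (2 * m + 2 * K + 2)"
  have "0 < e'" using \<open>0 < e\<close> \<open>0 < m\<close> \<open>0 < K\<close> by (simp add: e'_def)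
  obtain n0 where n0: "laplace \<mu> 0 - laplace \<mu> (1 / real (Suc n0)) < e'"
  proof -
    have "eventually (\<lambda>n. dist (laplace \<mu> (1 / real (Suc n))) (laplace \<mu> 0) < e') sequentially"
      using laplace_tendsto_0[OF \<mu>] \<open>0 < e'\<close> by (rule tendstoD)
    then obtain n where "dist (laplace \<mu> (1 / real (Suc n))) (laplace \<mu> 0) < e'"
      by (auto simp: eventually_sequentially)
    then show ?thesis by (intro that[of n]) (auto simp: dist_real_def)
  qed
  define \<delta> where "\<delta> = 1 / real (Suc n0)"
  have "0 < \<delta>" by (simp add: \<delta>_def)
  obtain c n where c: "\<And>x. 0 \<le> x \<Longrightarrow> \<bar>f x * exp (- \<delta> * x) - (\<Sum>i\<le>n. c i * exp (- real i * x))\<bar> < e'"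
    using exp_polynomial_approx[OF f(1) K(1) \<open>0 < \<delta>\<close> \<open>0 < e'\<close>] by blast
  define P where "P \<kappa> = (\<Sum>i\<le>n. c i * laplace \<kappa> (real i))" for \<kappa>
  have mf[measurable]: "f \<in> borel_measurable borel"
    using f(1) by (rule borel_measurable_continuous_onI)
  \<comment> \<open>The first term is the error of the exponential polynomial, the second the cost
    of the damping: at most K times the mass that the factor \<open>exp (- \<delta> * x)\<close>
    removes.\<close>
  have approx: "\<bar>(LINT x|\<kappa>. f x) - P \<kappa>\<bar> \<le> e' * laplace \<kappa> 0 + K * (laplace \<kappa> 0 - laplace \<kappa> \<delta>)"
    if \<kappa>: "half_line_measure \<kappa>" for \<kappa>
  proof -
    note i = half_line_integrable_exp[OF \<kappa>]
    note [measurable_cong] = half_line_measureD(1)[OF \<kappa>]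
    interpret \<kappa>: finite_measure \<kappa> using half_line_measureD[OF \<kappa>] by simp
    have if': "integrable \<kappa> f" by (rule half_line_integrable[OF \<kappa>, where K=K]) (use K in auto)
    have P: "P \<kappa> = (LINT x|\<kappa>. (\<Sum>i\<le>n. c i * exp (- real i * x)))"
      unfolding P_def laplace_def
      by (subst Bochner_Integration.integral_sum) (use i in \<open>auto simp del: mult_minus_left\<close>)
    have iP: "integrable \<kappa> (\<lambda>x. \<Sum>i\<le>n. c i * exp (- real i * x))"
      by (intro Bochner_Integration.integrable_sum integrable_mult_right i) auto
    have "(LINT x|\<kappa>. f x) - P \<kappa> = (LINT x|\<kappa>. f x - (\<Sum>i\<le>n. c i * exp (- real i * x)))"
      unfolding P using if' iP by (subst Bochner_Integration.integral_diff) auto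
    also have "\<bar>\<dots>\<bar> \<le> (LINT x|\<kappa>. e' * exp (- 0 * x) + K * (exp (- 0 * x) - exp (- \<delta> * x)))"
    proof (rule order.trans[OF integral_abs_bound integral_mono_AE])
      show "integrable \<kappa> (\<lambda>x. \<bar>f x - (\<Sum>i\<le>n. c i * exp (- real i * x))\<bar>)"
        using if' iP by auto
      show "integrable \<kappa> (\<lambda>x. e' * exp (- 0 * x) + K * (exp (- 0 * x) - exp (- \<delta> * x)))"
        using i[of 0] i[of \<delta>] \<open>0 < \<delta>\<close>
        by (intro Bochner_Integration.integrable_add Bochner_Integration.integrable_diff
            integrable_mult_right) auto
      show "AE x in \<kappa>. \<bar>f x - (\<Sum>i\<le>n. c i * exp (- real i * x))\<bar>
               \<le> e' * exp (- 0 * x) + K * (exp (- 0 * x) - exp (- \<delta> * x))"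
        using half_line_measureD(3)[OF \<kappa>]
      proof eventually_elim
        case (elim x)
        have "f x - f x * exp (- \<delta> * x) = f x * (1 - exp (- \<delta> * x))"
          by (simp add: algebra_simps)
        also have "\<bar>\<dots>\<bar> = \<bar>f x\<bar> * (1 - exp (- \<delta> * x))"
          using elim \<open>0 < \<delta>\<close> by (simp only: abs_mult) simp
        also have "\<dots> \<le> K * (1 - exp (- \<delta> * x))"
          using elim \<open>0 < \<delta>\<close> K by (intro mult_right_mono) auto
        finally show ?case using c[OF elim] by simp
      qed
    qed
    also have "\<dots> = e' * laplace \<kappa> 0 + K * (laplace \<kappa> 0 - laplace \<kappa> \<delta>)"
      unfolding laplace_def using i[of 0] i[of \<delta>] \<open>0 < \<delta>\<close> by simp
    finally show ?thesis .
  qed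
  have "((\<lambda>i. P (\<nu> i)) \<longlongrightarrow> P \<mu>) F"
    unfolding P_def by (intro tendsto_intros lim) auto
  then have e1: "eventually (\<lambda>i. dist (P (\<nu> i)) (P \<mu>) < e') F"
    using \<open>0 < e'\<close> by (rule tendstoD)
  have e2: "eventually (\<lambda>i. laplace (\<nu> i) 0 < m) F"
    using order_tendstoD(2)[OF lim[of 0], of m] by (simp add: m_def)
  have "((\<lambda>i. laplace (\<nu> i) 0 - laplace (\<nu> i) \<delta>) \<longlongrightarrow> laplace \<mu> 0 - laplace \<mu> \<delta>) F"
    using \<open>0 < \<delta>\<close> by (intro tendsto_intros lim) auto
  then have e3: "eventually (\<lambda>i. laplace (\<nu> i) 0 - laplace (\<nu> i) \<delta> < e') F"
    by (rule order_tendstoD) (use n0 in \<open>simp add: \<delta>_def\<close>)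
  have "e = e' * (2 * m + 2 * K + 2)"
    using \<open>0 < m\<close> \<open>0 < K\<close> by (simp add: e'_def)
  then have e4: "e = e' * m + e' * m + K * e' + K * e' + 2 * e'"
    by (simp add: algebra_simps)
  show "eventually (\<lambda>i. dist (LINT x|\<nu> i. f x) (LINT x|\<mu>. f x) < e) F"
    using e1 e2 e3 \<nu>
  proof eventually_elim
    case (elim i)
    have "\<bar>(LINT x|\<nu> i. f x) - P (\<nu> i)\<bar> \<le> e' * m + K * e'"
      using elim \<open>0 < e'\<close> \<open>0 < K\<close>
      by (intro order.trans[OF approx[OF elim(4)]] add_mono mult_left_mono) auto
    moreover have "\<bar>(LINT x|\<mu>. f x) - P \<mu>\<bar> \<le> e' * m + K * e'"
      using n0[folded \<delta>_def] \<open>0 < e'\<close> \<open>0 < K\<close>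
      by (intro order.trans[OF approx[OF \<mu>]] add_mono mult_left_mono) (auto simp: m_def)
    ultimately show ?case using elim(1) e4 \<open>0 < e'\<close> unfolding dist_real_def by linarith
  qed
qed

section \<open>Measures and densities determined by their integrals and transforms\<close>

lemma measure_eqI_continuous:
  fixes \<mu> \<nu> :: "real measure"
  assumes \<mu>: "sets \<mu> = sets borel" "finite_measure \<mu>" and \<nu>: "sets \<nu> = sets borel" "finite_measure \<nu>"
    and eq: "\<And>f :: real \<Rightarrow> real. continuous_on UNIV f \<Longrightarrow> bounded (range f) \<Longrightarrow>
      (LINT x|\<mu>. f x) = (LINT x|\<nu>. f x)"
  shows "\<mu> = \<nu>"
proof (rule cdf_unique')
  show "finite_borel_measure \<mu>" "finite_borel_measure \<nu>"
    using \<mu> \<nu> by (auto simp: finite_borel_measure_def finite_borel_measure_axioms_def)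
  show "cdf \<mu> = cdf \<nu>"
  proof
    fix a :: real
    \<comment> \<open>For n > 0 this is 1 up to a and falls linearly to 0 on [a, a + 1/n], so it
      tends pointwise to the indicator of \<open>{..a}\<close>, whose integral is the distribution
      function.\<close>
    define g where "g n x = max 0 (min 1 (1 - real n * (x - a)))" for n x
    have lim: "(\<lambda>n. LINT x|\<kappa>. g n x) \<longlonglongrightarrow> measure \<kappa> {..a}"
      if \<kappa>: "sets \<kappa> = sets borel" "finite_measure \<kappa>" for \<kappa>
    proof -
      note [measurable_cong] = \<kappa>(1)
      interpret finite_measure \<kappa> by fact
      have "(\<lambda>n. LINT x|\<kappa>. g n x) \<longlonglongrightarrow> (LINT x|\<kappa>. indicator {..a} x)"
      proof (rule integral_dominated_convergence[where w="\<lambda>_. 1"])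
        show "AE x in \<kappa>. (\<lambda>n. g n x) \<longlonglongrightarrow> indicator {..a} x"
        proof (rule AE_I2)
          fix x
          show "(\<lambda>n. g n x) \<longlonglongrightarrow> indicator {..a} x"
          proof (cases "x \<le> a")
            case True
            then have "g n x = 1" for n by (auto simp: g_def mult_nonneg_nonpos)
            then show ?thesis using True by simp
          next
            case False
            then obtain n0 where n0: "1 < real n0 * (x - a)"
              using ex_less_of_nat_mult[of "x - a" 1] by auto
            have "g n x = 0" if "n0 \<le> n" for n
            proof -
              have "real n0 * (x - a) \<le> real n * (x - a)"
                using that False by (intro mult_right_mono) auto
              then show ?thesis using n0 by (auto simp: g_def)
            qed
            then have "eventually (\<lambda>n. g n x = 0) sequentially"
              by (auto simp: eventually_sequentially)
            then show ?thesis using False by (simp add: tendsto_eventually)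
          qed
        qed
      qed (auto simp: g_def)
      then show ?thesis using \<kappa> by simp
    qed
    have "(LINT x|\<mu>. g n x) = (LINT x|\<nu>. g n x)" for n
      by (rule eq) (auto simp: g_def bounded_iff intro!: continuous_intros exI[of _ 1])
    then show "cdf \<mu> a = cdf \<nu> a"
      using lim[OF \<mu>] lim[OF \<nu>] by (auto simp: cdf_def intro: LIMSEQ_unique)
  qed
qed

text \<open>The continuity theorem for a constant family: its integrals converge both to themselves
  and to those of \<mu>.\<close>

lemma laplace_unique:
  assumes \<mu>: "half_line_measure \<mu>" and \<nu>: "half_line_measure \<nu>"
    and eq: "\<And>\<xi>. 0 < \<xi> \<Longrightarrow> laplace \<mu> \<xi> = laplace \<nu> \<xi>"
  shows "\<mu> = \<nu>"
proof (rule measure_eqI_continuous)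
  have "laplace \<mu> 0 = laplace \<nu> 0"
    using laplace_tendsto_0[OF \<mu>] laplace_tendsto_0[OF \<nu>] eq by (auto intro: LIMSEQ_unique)
  then have "laplace \<nu> \<xi> = laplace \<mu> \<xi>" if "0 \<le> \<xi>" for \<xi>
    using eq that by (cases "\<xi> = 0") auto
  then have "((\<lambda>_. LINT x|\<nu>. f x) \<longlongrightarrow> (LINT x|\<mu>. f x)) sequentially"
    if "continuous_on UNIV f" "bounded (range f)" for f :: "real \<Rightarrow> real"
    using that \<mu> \<nu> by (intro laplace_continuity) auto
  then show "(LINT x|\<mu>. f x) = (LINT x|\<nu>. f x)"
    if "continuous_on UNIV f" "bounded (range f)" for f :: "real \<Rightarrow> real"
    using that by (simp add: LIMSEQ_const_iff)
qed (use half_line_measureD[OF \<mu>] half_line_measureD[OF \<nu>] in auto)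

text \<open>Uniqueness for measures gives only almost everywhere equality of densities; continuity
  turns this into equality at each t > 0, since a difference at t would persist on an interval to
  its right, which has positive length.\<close>

lemma laplace_unique_density:
  fixes f g :: "real \<Rightarrow> real"
  assumes f: "continuous_on {0..} f" "\<And>t. 0 \<le> t \<Longrightarrow> 0 \<le> f t"
    and g: "continuous_on {0..} g" "\<And>t. 0 \<le> t \<Longrightarrow> 0 \<le> g t"
    and fi: "\<And>\<eta>. 0 < \<eta> \<Longrightarrow> set_integrable lborel {0<..} (\<lambda>t. exp (- \<eta> * t) * f t)"
    and gi: "\<And>\<eta>. 0 < \<eta> \<Longrightarrow> set_integrable lborel {0<..} (\<lambda>t. exp (- \<eta> * t) * g t)"
    and eq: "\<And>\<eta>. 0 < \<eta> \<Longrightarrow> (LINT t:{0<..}|lborel. exp (- \<eta> * t) * f t)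
                              = (LINT t:{0<..}|lborel. exp (- \<eta> * t) * g t)"
    and "0 < t"
  shows "f t = g t"
proof -
  \<comment> \<open>The factor \<open>exp (- t)\<close> makes the measure finite although h itself
    need not be integrable; it shifts the argument of the transform by 1.\<close>
  define D where "D h = density lborel (\<lambda>t. ennreal (indicator {0<..} t * (exp (- t) * h t)))"
    for h :: "real \<Rightarrow> real"
  have props: "half_line_measure (D h) \<and>
      (\<forall>\<xi>>0. laplace (D h) \<xi> = (LINT t:{0<..}|lborel. exp (- (\<xi> + 1) * t) * h t))"
    if h: "\<And>t. 0 \<le> t \<Longrightarrow> 0 \<le> h t" "set_integrable lborel {0<..} (\<lambda>t. exp (- 1 * t) * h t)"
    for h :: "real \<Rightarrow> real"
  proof (intro conjI allI impI half_line_measureI)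
    have i: "integrable lborel (\<lambda>t. indicator {0<..} t * (exp (- t) * h t))"
      using h(2) by (simp add: set_integrable_def)
    note [measurable] = borel_measurable_integrable[OF i]
    have nn: "0 \<le> indicator {0<..} t * (exp (- t) * h t)" for t
      using h(1)[of t] by (auto simp: indicator_def)
    show "sets (D h) = sets borel" by (simp add: D_def)
    show "finite_measure (D h)"
      unfolding D_def
      by (rule finite_measureI) (use i nn in \<open>simp add: emeasure_density nn_integral_eq_integral\<close>)
    show "AE x in D h. 0 \<le> x"
      unfolding D_def by (subst AE_density) (measurable, auto simp: indicator_def split: if_splits)
    fix \<xi> :: real
    have "laplace (D h) \<xi> = (LINT t|lborel. (indicator {0<..} t * (exp (- t) * h t)) *\<^sub>R exp (- \<xi> * t))"
      unfolding laplace_def D_def by (rule integral_density) (use nn in auto)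
    also have "\<dots> = (LINT t:{0<..}|lborel. exp (- (\<xi> + 1) * t) * h t)"
      unfolding set_lebesgue_integral_def
      by (intro Bochner_Integration.integral_cong) (auto simp: algebra_simps exp_add exp_diff exp_minus divide_simps)
    finally show "laplace (D h) \<xi> = (LINT t:{0<..}|lborel. exp (- (\<xi> + 1) * t) * h t)" .
  qed
  note pf = props[of f, OF f(2) fi[of 1]] and pg = props[of g, OF g(2) gi[of 1]]
  have "D f = D g"
  proof (rule laplace_unique)
    show "laplace (D f) \<xi> = laplace (D g) \<xi>" if "0 < \<xi>" for \<xi>
      using pf pg that eq[of "\<xi> + 1"] by simp
  qed (use pf pg in auto)
  have mf: "(\<lambda>t. indicator {0<..} t * (exp (- t) * f t)) \<in> borel_measurable lborel"
    using fi[of 1] by (simp add: set_integrable_def borel_measurable_integrable)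
  have mg: "(\<lambda>t. indicator {0<..} t * (exp (- t) * g t)) \<in> borel_measurable lborel"
    using gi[of 1] by (simp add: set_integrable_def borel_measurable_integrable)
  have ae: "AE t in lborel. ennreal (indicator {0<..} t * (exp (- t) * f t))
             = ennreal (indicator {0<..} t * (exp (- t) * g t))"
    using \<open>D f = D g\<close> mf mg unfolding D_def
    by (subst (asm) sigma_finite_measure.density_unique_iff[OF sigma_finite_lborel]) auto
  show ?thesis
  proof (rule ccontr)
    assume ne: "f t \<noteq> g t"
    have cont: "isCont (\<lambda>t. f t - g t) t"
    proof -
      have "continuous_on {0<..} (\<lambda>t. f t - g t)"
        by (intro continuous_intros continuous_on_subset[OF f(1)] continuous_on_subset[OF g(1)]) auto
      then show ?thesis using \<open>0 < t\<close> by (simp add: continuous_on_eq_continuous_at)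
    qed
    then have "eventually (\<lambda>s. f s - g s \<noteq> 0) (at t)"
      using ne by (intro tendsto_imp_eventually_ne[of _ "f t - g t"]) (auto simp: isCont_def)
    then obtain d where d: "0 < d" "\<And>s. s \<noteq> t \<Longrightarrow> dist s t < d \<Longrightarrow> f s - g s \<noteq> 0"
      unfolding eventually_at by auto
    define d' where "d' = min d t"
    have "AE s in lborel. s \<notin> {t<..<t + d'}"
      using ae
    proof eventually_elim
      case (elim s)
      show ?case
      proof
        assume "s \<in> {t<..<t + d'}"
        moreover then have "0 < s" "dist s t < d" using \<open>0 < t\<close> by (auto simp: d'_def dist_real_def)
        ultimately show False using elim d(2)[of s] f(2)[of s] g(2)[of s] by simp
      qed
    qed
    then have "emeasure lborel {t<..<t + d'} = 0"
      by (subst (asm) AE_iff_measurable[where N="{t<..<t + d'}"]) auto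
    then show False using d(1) \<open>0 < t\<close> by (simp add: d'_def)
  qed
qed

section \<open>Differentiation of Laplace transforms under the integral sign\<close>

lemma pow_times_exp_le:
  fixes y c :: real
  assumes "0 \<le> y" "0 < c"
  shows "y ^ n * exp (- c * y) \<le> fact n / c ^ n"
proof -
  have "(c * y) ^ n / fact n \<le> exp (c * y)"
    using sum_le_suminf[OF summable_exp[of "c * y"], of "{n}"] assms
    by (simp add: exp_def divide_inverse mult.commute)
  then show ?thesis
    using assms by (simp add: exp_minus field_simps power_mult_distrib)
qed

text \<open>No moment of Y is assumed: at arguments bounded away from 0 the exponential absorbs
  every power of Y. By the mean value inequality the difference quotients are then dominated by a
  constant multiple of \<open>\<bar>G \<omega>\<bar>\<close>.\<close>

lemma has_field_derivative_laplace:
  fixes Y G :: "'a \<Rightarrow> real"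
  assumes Y[measurable]: "Y \<in> borel_measurable Q" "\<And>\<omega>. \<omega> \<in> space Q \<Longrightarrow> 0 \<le> Y \<omega>"
    and G: "integrable Q G" and "0 < m"
  shows "((\<lambda>m. LINT \<omega>|Q. (- Y \<omega>) ^ j * exp (- m * Y \<omega>) * G \<omega>) has_field_derivative
           (LINT \<omega>|Q. (- Y \<omega>) ^ Suc j * exp (- m * Y \<omega>) * G \<omega>)) (at m)"
proof -
  note [measurable] = borel_measurable_integrable[OF G]
  \<comment> \<open>Difference quotients are taken only at arguments beyond m / 2, where
    \<open>Y ^ Suc j * exp (- c * Y)\<close> has a common bound.\<close>
  define c where "c = m / 2"
  have c: "0 < c" "c < m" using \<open>0 < m\<close> by (auto simp: c_def)
  have int: "integrable Q (\<lambda>\<omega>. (- Y \<omega>) ^ j * exp (- x * Y \<omega>) * G \<omega>)" if "0 < x" for x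
  proof (rule Bochner_Integration.integrable_bound[where f="\<lambda>\<omega>. (fact j / x ^ j) * G \<omega>"])
    show "AE \<omega> in Q. norm ((- Y \<omega>) ^ j * exp (- x * Y \<omega>) * G \<omega>) \<le> norm ((fact j / x ^ j) * G \<omega>)"
    proof (rule AE_I2)
      fix \<omega> assume "\<omega> \<in> space Q"
      from mult_right_mono[OF pow_times_exp_le[OF Y(2)[OF this] that, of j], of "\<bar>G \<omega>\<bar>"]
      show "norm ((- Y \<omega>) ^ j * exp (- x * Y \<omega>) * G \<omega>) \<le> norm ((fact j / x ^ j) * G \<omega>)"
        using that Y(2)[OF \<open>\<omega> \<in> space Q\<close>] by (simp add: abs_mult power_abs)
    qed
  qed (use G in auto)
  have "((\<lambda>y. ((LINT \<omega>|Q. (- Y \<omega>) ^ j * exp (- y * Y \<omega>) * G \<omega>) -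
               (LINT \<omega>|Q. (- Y \<omega>) ^ j * exp (- m * Y \<omega>) * G \<omega>)) / (y - m))
           \<longlongrightarrow> (LINT \<omega>|Q. (- Y \<omega>) ^ Suc j * exp (- m * Y \<omega>) * G \<omega>)) (at m within {c<..})"
    unfolding tendsto_at_iff_sequentially
  proof safe
    fix X :: "nat \<Rightarrow> real" assume X: "\<forall>i. X i \<in> {c<..} - {m}" "X \<longlonglongrightarrow> m"
    then have Xc: "c < X i" "X i \<noteq> m" for i by auto
    have "(\<lambda>i. LINT \<omega>|Q. ((- Y \<omega>) ^ j * G \<omega>) * ((exp (- X i * Y \<omega>) - exp (- m * Y \<omega>)) / (X i - m)))
          \<longlonglongrightarrow> (LINT \<omega>|Q. (- Y \<omega>) ^ Suc j * exp (- m * Y \<omega>) * G \<omega>)"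
    proof (rule integral_dominated_convergence[where w="\<lambda>\<omega>. (fact (Suc j) / c ^ Suc j) * \<bar>G \<omega>\<bar>"])
      show "AE \<omega> in Q. (\<lambda>i. ((- Y \<omega>) ^ j * G \<omega>) * ((exp (- X i * Y \<omega>) - exp (- m * Y \<omega>)) / (X i - m)))
              \<longlonglongrightarrow> (- Y \<omega>) ^ Suc j * exp (- m * Y \<omega>) * G \<omega>"
      proof (rule AE_I2)
        fix \<omega>
        have "((\<lambda>y. exp (- y * Y \<omega>)) has_field_derivative (- Y \<omega> * exp (- m * Y \<omega>))) (at m)"
          by (auto intro!: derivative_eq_intros)
        then have "(\<lambda>i. (exp (- X i * Y \<omega>) - exp (- m * Y \<omega>)) / (X i - m)) \<longlonglongrightarrow> - Y \<omega> * exp (- m * Y \<omega>)"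
          unfolding has_field_derivative_iff tendsto_at_iff_sequentially using X
          by (auto simp: comp_def)
        then have "(\<lambda>i. ((- Y \<omega>) ^ j * G \<omega>) * ((exp (- X i * Y \<omega>) - exp (- m * Y \<omega>)) / (X i - m)))
          \<longlonglongrightarrow> ((- Y \<omega>) ^ j * G \<omega>) * (- Y \<omega> * exp (- m * Y \<omega>))"
          by (rule tendsto_mult_left)
        then show "(\<lambda>i. ((- Y \<omega>) ^ j * G \<omega>) * ((exp (- X i * Y \<omega>) - exp (- m * Y \<omega>)) / (X i - m)))
              \<longlonglongrightarrow> (- Y \<omega>) ^ Suc j * exp (- m * Y \<omega>) * G \<omega>"
          by (simp add: mult_ac)
      qed
      show "AE \<omega> in Q. norm (((- Y \<omega>) ^ j * G \<omega>) * ((exp (- X i * Y \<omega>) - exp (- m * Y \<omega>)) / (X i - m)))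
              \<le> (fact (Suc j) / c ^ Suc j) * \<bar>G \<omega>\<bar>" for i
      proof (rule AE_I2)
        fix \<omega> assume \<omega>: "\<omega> \<in> space Q"
        have "norm (exp (- X i * Y \<omega>) - exp (- m * Y \<omega>)) \<le> (Y \<omega> * exp (- c * Y \<omega>)) * norm (X i - m)"
        proof (rule field_differentiable_bound[where S="{c..}" and f'="\<lambda>y. - Y \<omega> * exp (- y * Y \<omega>)"])
          show "((\<lambda>y. exp (- y * Y \<omega>)) has_field_derivative - Y \<omega> * exp (- z * Y \<omega>)) (at z within {c..})" for z
            by (auto intro!: derivative_eq_intros)
          show "norm (- Y \<omega> * exp (- z * Y \<omega>)) \<le> Y \<omega> * exp (- c * Y \<omega>)" if "z \<in> {c..}" for z
            using that Y(2)[OF \<omega>] by (auto simp: abs_mult intro!: mult_left_mono mult_right_mono)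
        qed (use c Xc[of i] in auto)
        then have "norm ((exp (- X i * Y \<omega>) - exp (- m * Y \<omega>)) / (X i - m)) \<le> Y \<omega> * exp (- c * Y \<omega>)"
          using Xc(2)[of i] by (simp add: field_simps)
        then have "norm (((- Y \<omega>) ^ j * G \<omega>) * ((exp (- X i * Y \<omega>) - exp (- m * Y \<omega>)) / (X i - m)))
              \<le> (Y \<omega> ^ j * \<bar>G \<omega>\<bar>) * (Y \<omega> * exp (- c * Y \<omega>))"
          unfolding norm_mult using Y(2)[OF \<omega>]
          by (intro mult_mono) (auto simp: power_abs abs_mult)
        also have "\<dots> = (Y \<omega> ^ Suc j * exp (- c * Y \<omega>)) * \<bar>G \<omega>\<bar>" by simp
        also have "\<dots> \<le> (fact (Suc j) / c ^ Suc j) * \<bar>G \<omega>\<bar>"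
          by (intro mult_right_mono pow_times_exp_le Y(2)[OF \<omega>] c) auto
        finally show "norm (((- Y \<omega>) ^ j * G \<omega>) * ((exp (- X i * Y \<omega>) - exp (- m * Y \<omega>)) / (X i - m)))
              \<le> (fact (Suc j) / c ^ Suc j) * \<bar>G \<omega>\<bar>" .
      qed
    qed (use G in auto)
    moreover have "(LINT \<omega>|Q. ((- Y \<omega>) ^ j * G \<omega>) * ((exp (- X i * Y \<omega>) - exp (- m * Y \<omega>)) / (X i - m)))
       = ((LINT \<omega>|Q. (- Y \<omega>) ^ j * exp (- X i * Y \<omega>) * G \<omega>) -
               (LINT \<omega>|Q. (- Y \<omega>) ^ j * exp (- m * Y \<omega>) * G \<omega>)) / (X i - m)" for i
    proof -
      have "0 < X i" using Xc[of i] c by simp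
      have "(LINT \<omega>|Q. (- Y \<omega>) ^ j * exp (- X i * Y \<omega>) * G \<omega>) -
               (LINT \<omega>|Q. (- Y \<omega>) ^ j * exp (- m * Y \<omega>) * G \<omega>)
          = (LINT \<omega>|Q. (- Y \<omega>) ^ j * exp (- X i * Y \<omega>) * G \<omega> - (- Y \<omega>) ^ j * exp (- m * Y \<omega>) * G \<omega>)"
        using int[OF \<open>0 < X i\<close>] int[OF \<open>0 < m\<close>]
        by (rule Bochner_Integration.integral_diff[symmetric])
      then show ?thesis
        unfolding Bochner_Integration.integral_divide_zero[symmetric]
        by (simp only: flip: Bochner_Integration.integral_divide_zero)
          (intro Bochner_Integration.integral_cong refl, simp add: algebra_simps diff_divide_distrib)
    qed
    ultimately have "(\<lambda>i. ((LINT \<omega>|Q. (- Y \<omega>) ^ j * exp (- X i * Y \<omega>) * G \<omega>) -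
               (LINT \<omega>|Q. (- Y \<omega>) ^ j * exp (- m * Y \<omega>) * G \<omega>)) / (X i - m))
           \<longlonglongrightarrow> (LINT \<omega>|Q. (- Y \<omega>) ^ Suc j * exp (- m * Y \<omega>) * G \<omega>)"
      by (simp only:)
    then show "((\<lambda>y. ((LINT \<omega>|Q. (- Y \<omega>) ^ j * exp (- y * Y \<omega>) * G \<omega>) -
               (LINT \<omega>|Q. (- Y \<omega>) ^ j * exp (- m * Y \<omega>) * G \<omega>)) / (y - m)) \<circ> X)
           \<longlonglongrightarrow> (LINT \<omega>|Q. (- Y \<omega>) ^ Suc j * exp (- m * Y \<omega>) * G \<omega>)"
      by (simp only: comp_def)
  qed
  then show ?thesis
    unfolding has_field_derivative_iff using c by (subst (asm) at_within_open) auto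
qed

text \<open>The integral formula is available only on the open half-line m > 0. This suffices for
  iteration, since \<open>deriv\<close> at a point depends only on values nearby.\<close>

lemma higher_deriv_laplace:
  fixes Y G :: "'a \<Rightarrow> real"
  assumes Y: "Y \<in> borel_measurable Q" "\<And>\<omega>. \<omega> \<in> space Q \<Longrightarrow> 0 \<le> Y \<omega>"
    and G: "integrable Q G"
    and f: "\<And>m. 0 < m \<Longrightarrow> f m = (LINT \<omega>|Q. exp (- m * Y \<omega>) * G \<omega>)"
    and "0 < m"
  shows "(deriv ^^ j) f m = (LINT \<omega>|Q. (- Y \<omega>) ^ j * exp (- m * Y \<omega>) * G \<omega>)"
    and "(deriv ^^ j) f field_differentiable (at m)"
proof -
  have ev: "eventually (\<lambda>x. x \<in> {0<..}) (nhds m)" if "0 < m" for m :: real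
    using that by (intro eventually_nhds_in_open) auto
  have *: "\<forall>m>0. (deriv ^^ j) f m = (LINT \<omega>|Q. (- Y \<omega>) ^ j * exp (- m * Y \<omega>) * G \<omega>)" for j
  proof (induction j)
    case 0
    then show ?case by (simp add: f)
  next
    case (Suc j)
    show ?case
    proof safe
      fix m :: real assume m: "0 < m"
      have "deriv ((deriv ^^ j) f) m = deriv (\<lambda>m. LINT \<omega>|Q. (- Y \<omega>) ^ j * exp (- m * Y \<omega>) * G \<omega>) m"
        by (rule deriv_cong_ev) (use ev[OF m] Suc in \<open>auto elim: eventually_mono\<close>)
      also have "\<dots> = (LINT \<omega>|Q. (- Y \<omega>) ^ Suc j * exp (- m * Y \<omega>) * G \<omega>)"
        using has_field_derivative_laplace[OF Y G m] by (rule DERIV_imp_deriv)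
      finally show "(deriv ^^ Suc j) f m = (LINT \<omega>|Q. (- Y \<omega>) ^ Suc j * exp (- m * Y \<omega>) * G \<omega>)"
        by simp
    qed
  qed
  then show "(deriv ^^ j) f m = (LINT \<omega>|Q. (- Y \<omega>) ^ j * exp (- m * Y \<omega>) * G \<omega>)"
    using \<open>0 < m\<close> by blast
  have "((deriv ^^ j) f has_field_derivative
         (LINT \<omega>|Q. (- Y \<omega>) ^ Suc j * exp (- m * Y \<omega>) * G \<omega>)) (at m)"
  proof (subst DERIV_cong_ev[OF refl _ refl])
    show "eventually (\<lambda>m. (deriv ^^ j) f m = (LINT \<omega>|Q. (- Y \<omega>) ^ j * exp (- m * Y \<omega>) * G \<omega>)) (nhds m)"
      using ev[OF \<open>0 < m\<close>] by eventually_elim (use * in auto)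
  qed (rule has_field_derivative_laplace[OF Y G \<open>0 < m\<close>])
  then show "(deriv ^^ j) f field_differentiable (at m)"
    using field_differentiable_def by blast
qed

section \<open>Subordinators and their inverses\<close>

text \<open>The path regularity shared by N and both stable processes, including the deterministic
  process of index 1.\<close>

definition increasing_process :: "'a measure \<Rightarrow> (real \<Rightarrow> 'a \<Rightarrow> real) \<Rightarrow> bool" where
  "increasing_process M Y \<longleftrightarrow> (\<forall>t\<ge>0. Y t \<in> borel_measurable M) \<and>
     (\<forall>\<omega>\<in>space M. Y 0 \<omega> = 0 \<and> mono_on {0..} (\<lambda>t. Y t \<omega>) \<and>
        (\<forall>t\<ge>0. continuous (at_right t) (\<lambda>s. Y s \<omega>)))"

lemma increasing_process_nonneg:
  assumes "increasing_process M Y" "\<omega> \<in> space M" "0 \<le> t"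
  shows "0 \<le> Y t \<omega>"
proof -
  have "Y 0 \<omega> = 0" "mono_on {0..} (\<lambda>t. Y t \<omega>)"
    using assms by (auto simp: increasing_process_def)
  then show ?thesis using monotone_onD[of "{0..}" "(\<le>)" "(\<le>)" "\<lambda>t. Y t \<omega>" 0 t] assms(3) by simp
qed

text \<open>
  The time \<open>(\<lfloor>(n+1)s\<rfloor> + 1)/(n+1)\<close> takes countably many values and decreases strictly to \<open>s\<close>, so
  that right-continuity turns countable joint measurability into joint measurability.
\<close>

lemma measurable_right_continuous_process:
  fixes Y :: "real \<Rightarrow> 'b \<Rightarrow> real"
  assumes Y: "\<And>t. 0 \<le> t \<Longrightarrow> Y t \<in> borel_measurable A"
    and rc: "\<And>t \<omega>. 0 \<le> t \<Longrightarrow> \<omega> \<in> space A \<Longrightarrow> continuous (at_right t) (\<lambda>s. Y s \<omega>)"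
  shows "(\<lambda>(s :: real, \<omega>). Y (max 0 s) \<omega>) \<in> borel_measurable (borel \<Otimes>\<^sub>M A)"
proof -
  define k where "k n s = nat \<lfloor>real (Suc n) * max 0 s\<rfloor>" for n and s :: real
  define D where "D n s = (real (k n s) + 1) / real (Suc n)" for n s
  have D: "max 0 s < D n s" "D n s \<le> max 0 s + 1 / real (Suc n)" for n s
  proof -
    have "real (k n s) = of_int \<lfloor>real (Suc n) * max 0 s\<rfloor>"
      unfolding k_def by (intro of_nat_nat) auto
    then have "real (k n s) \<le> real (Suc n) * max 0 s" "real (Suc n) * max 0 s < real (k n s) + 1"
      by (simp_all only:) linarith+
    then show "max 0 s < D n s" "D n s \<le> max 0 s + 1 / real (Suc n)"
      unfolding D_def
      by (simp_all only: pos_less_divide_eq pos_divide_le_eq of_nat_0_less_iff zero_less_Suc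
          ring_distribs mult.commute[of "real (Suc n)"]) auto
  qed
  show ?thesis
  proof (rule borel_measurable_LIMSEQ_real)
    fix n
    have "(\<lambda>p. Y ((real (k n (fst p)) + 1) / real (Suc n)) (snd p)) \<in> borel_measurable (borel \<Otimes>\<^sub>M A)"
    proof (rule measurable_compose_countable[where f="\<lambda>i p. Y ((real i + 1) / real (Suc n)) (snd p)"])
      show "(\<lambda>p. Y ((real i + 1) / real (Suc n)) (snd p)) \<in> borel_measurable (borel \<Otimes>\<^sub>M A)" for i :: nat
        by (rule measurable_compose[OF measurable_snd Y]) auto
      show "(\<lambda>p. k n (fst p)) \<in> borel \<Otimes>\<^sub>M A \<rightarrow>\<^sub>M count_space UNIV"
        unfolding k_def by measurable
    qed
    then show "(\<lambda>p. Y (D n (fst p)) (snd p)) \<in> borel_measurable (borel \<Otimes>\<^sub>M A)"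
      by (simp add: D_def)
  next
    fix p :: "real \<times> 'b" assume "p \<in> space (borel \<Otimes>\<^sub>M A)"
    then obtain s \<omega> where p: "p = (s, \<omega>)" "\<omega> \<in> space A" by (auto simp: space_pair_measure)
    have "(\<lambda>n. max 0 s + 1 / real (Suc n)) \<longlonglongrightarrow> max 0 s + 0"
      using LIMSEQ_inverse_real_of_nat
      by (intro tendsto_intros) (auto simp: inverse_eq_divide simp del: of_nat_Suc)
    then have "(\<lambda>n. D n s) \<longlonglongrightarrow> max 0 s"
      by (intro tendsto_sandwich[of "\<lambda>_. max 0 s" "\<lambda>n. D n s" sequentially
            "\<lambda>n. max 0 s + 1 / real (Suc n)" "max 0 s"])
         (use D in \<open>auto intro!: always_eventually less_imp_le simp del: of_nat_Suc\<close>)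
    then have "filterlim (\<lambda>n. D n s) (at_right (max 0 s)) sequentially"
      unfolding filterlim_at using D(1)[of s]
      by (auto intro!: always_eventually simp del: max_less_iff_conj) (metis less_irrefl)
    moreover have "((\<lambda>s. Y s \<omega>) \<longlongrightarrow> Y (max 0 s) \<omega>) (at_right (max 0 s))"
      using rc[of "max 0 s" \<omega>] p by (simp add: continuous_within)
    ultimately have "(\<lambda>n. Y (D n s) \<omega>) \<longlonglongrightarrow> Y (max 0 s) \<omega>"
      by (rule filterlim_compose[rotated])
    then show "(\<lambda>n. Y (D n (fst p)) (snd p)) \<longlonglongrightarrow> (case p of (s, \<omega>) \<Rightarrow> Y (max 0 s) \<omega>)"
      by (simp add: p)
  qed
qed

lemma measurable_increasing_process:
  assumes "increasing_process M Y"
  shows "(\<lambda>(s, \<omega>). Y (max 0 s) \<omega>) \<in> borel_measurable (borel \<Otimes>\<^sub>M M)"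
  by (rule measurable_right_continuous_process) (use assms in \<open>auto simp: increasing_process_def\<close>)

text \<open>Removes the case distinction at \<nu> = 1: the deterministic process
  \<open>Y t = t\<close> has transform \<open>exp (- t * \<xi>)\<close> and stationary increments,
  so the formulas for \<nu> < 1 persist.\<close>

lemma stable_subordinatorD:
  assumes st: "stable_subordinator M \<nu> Y" and "prob_space M" and \<nu>: "0 < \<nu>" "\<nu> \<le> 1"
  shows "increasing_process M Y"
    and "\<And>t \<xi>. 0 \<le> t \<Longrightarrow> 0 \<le> \<xi> \<Longrightarrow> (LINT \<omega>|M. exp (- \<xi> * Y t \<omega>)) = exp (- t * \<xi> powr \<nu>)"
    and "\<And>s t. 0 \<le> s \<Longrightarrow> 0 \<le> t \<Longrightarrow>
      distr M borel (\<lambda>\<omega>. Y (s + t) \<omega> - Y s \<omega>) = distr M borel (Y t)"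
proof -
  interpret prob_space M by fact
  have "increasing_process M Y \<and> (\<forall>t\<ge>0. \<forall>\<xi>\<ge>0. (LINT \<omega>|M. exp (- \<xi> * Y t \<omega>)) = exp (- t * \<xi> powr \<nu>)) \<and>
    (\<forall>s\<ge>0. \<forall>t\<ge>0. distr M borel (\<lambda>\<omega>. Y (s + t) \<omega> - Y s \<omega>) = distr M borel (Y t))"
  proof (cases "\<nu> = 1")
    case False
    then show ?thesis
      using st by (auto simp: stable_subordinator_def subordinator_def increasing_process_def)
  next
    case True
    then have Y: "\<And>t \<omega>. 0 \<le> t \<Longrightarrow> \<omega> \<in> space M \<Longrightarrow> Y t \<omega> = t"
      using st by (auto simp: stable_subordinator_def)
    show ?thesis
    proof (intro conjI allI impI)
      show "increasing_process M Y"
        unfolding increasing_process_def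
      proof (intro conjI allI impI ballI)
        fix t :: real assume t: "0 \<le> t"
        show "Y t \<in> borel_measurable M"
          by (subst measurable_cong[where g="\<lambda>_. t"]) (use Y t in auto)
        fix \<omega> assume \<omega>: "\<omega> \<in> space M"
        have "((\<lambda>s. Y s \<omega>) \<longlongrightarrow> t) (at_right t)"
        proof (rule Lim_transform_eventually)
          show "((\<lambda>s. s) \<longlongrightarrow> t) (at_right t)" by (rule tendsto_ident_at)
          show "eventually (\<lambda>s. s = Y s \<omega>) (at_right t)"
            using eventually_at_right_less[of t] by eventually_elim (use Y \<omega> t in auto)
        qed
        then show "continuous (at_right t) (\<lambda>s. Y s \<omega>)"
          using Y[OF t \<omega>] by (simp add: continuous_within)
      qed (use Y in \<open>auto simp: mono_on_def\<close>)
      fix s t :: real assume "0 \<le> s" "0 \<le> t"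
      then have *: "Y (s + t) \<omega> - Y s \<omega> = Y t \<omega>" if "\<omega> \<in> space M" for \<omega>
        using Y that by simp
      show "distr M borel (\<lambda>\<omega>. Y (s + t) \<omega> - Y s \<omega>) = distr M borel (Y t)"
        by (rule distr_cong) (use * in auto)
    next
      fix t \<xi> :: real assume t: "0 \<le> t" "0 \<le> \<xi>"
      have "(LINT \<omega>|M. exp (- \<xi> * Y t \<omega>)) = (LINT \<omega>|M. exp (- \<xi> * t))"
        by (rule Bochner_Integration.integral_cong) (use Y t in auto)
      then show "(LINT \<omega>|M. exp (- \<xi> * Y t \<omega>)) = exp (- t * \<xi> powr \<nu>)"
        using t True by (simp add: prob_space mult.commute)
    qed
  qed
  then show "increasing_process M Y"
    and "\<And>t \<xi>. 0 \<le> t \<Longrightarrow> 0 \<le> \<xi> \<Longrightarrow> (LINT \<omega>|M. exp (- \<xi> * Y t \<omega>)) = exp (- t * \<xi> powr \<nu>)"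
    and "\<And>s t. 0 \<le> s \<Longrightarrow> 0 \<le> t \<Longrightarrow>
      distr M borel (\<lambda>\<omega>. Y (s + t) \<omega> - Y s \<omega>) = distr M borel (Y t)"
    by blast+
qed

text \<open>Each clause secures a property of the inverse: unboundedness makes the infimum one over
  a nonempty set, strict increase makes the inverse continuous and 0 at time 0, and right-continuity
  at 0 makes it positive at positive times.\<close>

definition regular_path :: "(real \<Rightarrow> real) \<Rightarrow> bool" where
  "regular_path h \<longleftrightarrow> h 0 = 0 \<and> continuous (at_right 0) h \<and>
     (\<forall>r s. 0 \<le> r \<longrightarrow> r < s \<longrightarrow> h r < h s) \<and> (\<forall>c. \<exists>s\<ge>0. c < h s)"

definition path_inverse :: "(real \<Rightarrow> real) \<Rightarrow> real \<Rightarrow> real" where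
  "path_inverse h t = Inf {s. 0 \<le> s \<and> t < h s}"

section \<open>Inverses of strictly increasing unbounded paths\<close>

context
  fixes h assumes h: "regular_path h"
begin

lemma path_inverse_le: "0 \<le> s \<Longrightarrow> t < h s \<Longrightarrow> path_inverse h t \<le> s"
  unfolding path_inverse_def by (rule cInf_lower) (auto intro!: bdd_belowI[of _ 0])

lemma path_inverse_ge: "(\<And>s. 0 \<le> s \<Longrightarrow> t < h s \<Longrightarrow> r \<le> s) \<Longrightarrow> r \<le> path_inverse h t"
  unfolding path_inverse_def using h
  by (intro cInf_greatest) (auto simp: regular_path_def)

lemma path_inverse_nonneg: "0 \<le> path_inverse h t"
  by (rule path_inverse_ge)

lemma less_path_inverse: "0 \<le> s \<Longrightarrow> s < path_inverse h t \<Longrightarrow> h s \<le> t"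
  using path_inverse_le[of s t] by force

lemma path_inverse_less:
  assumes "path_inverse h t < s" shows "t < h s"
proof -
  obtain r where "0 \<le> r" "t < h r" "r < s"
    using path_inverse_ge[of t s] assms by force
  then show ?thesis using h by (force simp: regular_path_def)
qed

lemma path_inverse_0: "path_inverse h 0 = 0"
proof (rule antisym[OF field_le_epsilon path_inverse_nonneg])
  fix e :: real assume "0 < e"
  then have "0 < h e" using h by (force simp: regular_path_def)
  then show "path_inverse h 0 \<le> 0 + e" using \<open>0 < e\<close> by (auto intro: path_inverse_le)
qed

lemma path_inverse_pos:
  assumes "0 < t" shows "0 < path_inverse h t"
proof -
  have "(h \<longlongrightarrow> 0) (at_right 0)" using h by (auto simp: regular_path_def continuous_within)
  then have "eventually (\<lambda>s. h s < t) (at_right 0)" using assms by (rule order_tendstoD)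
  then obtain b where b: "0 < b" "\<And>s. 0 < s \<Longrightarrow> s < b \<Longrightarrow> h s < t"
    unfolding eventually_at_right_field by auto
  have "b / 2 \<le> path_inverse h t"
  proof (rule ccontr)
    assume "\<not> b / 2 \<le> path_inverse h t"
    then have "t < h (b / 2)" by (intro path_inverse_less) auto
    then show False using b using less_trans[OF _ b(2)[of "b / 2"], of t] b(1) by simp
  qed
  then show ?thesis using b by simp
qed

text \<open>A jump of the inverse would be a flat piece of h, which strict increase excludes. Jumps
  of h do no harm: they only produce flat pieces of the inverse.\<close>

lemma continuous_path_inverse: "continuous_on A (path_inverse h)"
  unfolding continuous_on_iff
proof (intro ballI allI impI)
  fix t e :: real assume "0 < e"
  define s where "s = path_inverse h t"
  have "0 \<le> s" by (simp add: s_def path_inverse_nonneg)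
  have up: "t < h (s + e / 2)" using \<open>0 < e\<close> by (intro path_inverse_less) (simp add: s_def)
  \<comment> \<open>If s < e, the required lower bound is negative and nonnegativity of the inverse
    suffices. Otherwise strict increase of h between \<open>s - e / 2\<close> and
    \<open>s - e / 4\<close> puts \<open>h (s - e / 2)\<close> strictly below t.\<close>
  obtain d where d: "0 < d" "\<And>t'. t - d < t' \<Longrightarrow> s - e < path_inverse h t'"
  proof (cases "s < e")
    case True
    then show ?thesis using path_inverse_nonneg by (intro that[of 1]) (auto intro: less_le_trans[of _ 0])
  next
    case False
    have "h (s - e / 2) < h (s - e / 4)"
      using h False \<open>0 < e\<close> by (auto simp: regular_path_def)
    also have "\<dots> \<le> t" using False \<open>0 < e\<close> by (intro less_path_inverse) (auto simp: s_def)
    finally have lo: "h (s - e / 2) < t" .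
    show ?thesis
    proof (rule that[of "t - h (s - e / 2)"])
      fix t' assume "t - (t - h (s - e / 2)) < t'"
      then have "\<not> path_inverse h t' < s - e / 2" using path_inverse_less[of t' "s - e / 2"] by auto
      then show "s - e < path_inverse h t'" using \<open>0 < e\<close> by simp
    qed (use lo in simp)
  qed
  define d' where "d' = min d (h (s + e / 2) - t)"
  show "\<exists>d>0. \<forall>t'\<in>A. dist t' t < d \<longrightarrow> dist (path_inverse h t') (path_inverse h t) < e"
  proof (intro exI conjI ballI impI)
    show "0 < d'" using d up by (simp add: d'_def)
    fix t' assume "dist t' t < d'"
    then have t': "t - d < t'" "t' < h (s + e / 2)" by (auto simp: d'_def dist_real_def)
    have "path_inverse h t' \<le> s + e / 2"
      by (rule path_inverse_le) (use t' \<open>0 \<le> s\<close> \<open>0 < e\<close> in auto)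
    then show "dist (path_inverse h t') (path_inverse h t) < e"
      using d(2)[OF t'(1)] \<open>0 < e\<close> by (auto simp: dist_real_def s_def)
  qed
qed

end

section \<open>Almost sure regularity of the paths of stable subordinators\<close>

context prob_space
begin

text \<open>Chernoff bound. The parameter \<xi> stays free because two regimes are used: c = 0 with
  \<xi> large yields positive increments, and \<xi> = 1 with d large yields unbounded paths.\<close>

lemma stable_subordinator_tail:
  assumes st: "stable_subordinator M \<nu> H" and \<nu>: "0 < \<nu>" "\<nu> \<le> 1" and d: "0 \<le> d" "0 \<le> \<xi>"
  shows "prob {\<omega>\<in>space M. H d \<omega> \<le> c} \<le> exp (\<xi> * c - d * \<xi> powr \<nu>)"
proof -
  note H = stable_subordinatorD[OF st prob_space_axioms \<nu>]
  have [measurable]: "H d \<in> borel_measurable M" using H(1) d by (simp add: increasing_process_def)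
  have int: "integrable M (\<lambda>\<omega>. exp (\<xi> * c) * exp (- \<xi> * H d \<omega>))"
    by (intro integrable_mult_right integrable_const_bound[where B=1])
       (use d increasing_process_nonneg[OF H(1)] in auto)
  have "prob {\<omega>\<in>space M. H d \<omega> \<le> c} = (LINT \<omega>|M. indicator {\<omega>\<in>space M. H d \<omega> \<le> c} \<omega>)"
    by simp
  also have "\<dots> \<le> (LINT \<omega>|M. exp (\<xi> * c) * exp (- \<xi> * H d \<omega>))"
  proof (rule integral_mono[OF _ int])
    show "integrable M (indicator {\<omega>\<in>space M. H d \<omega> \<le> c} :: _ \<Rightarrow> real)"
      by (rule integrable_const_bound[where B=1]) auto
    show "indicator {\<omega>\<in>space M. H d \<omega> \<le> c} \<omega> \<le> exp (\<xi> * c) * exp (- \<xi> * H d \<omega>)" for \<omega>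
      using d mult_left_mono[of "H d \<omega>" c \<xi>] by (auto simp: indicator_def simp flip: exp_add)
  qed
  also have "\<dots> = exp (\<xi> * c) * exp (- d * \<xi> powr \<nu>)"
    using H(2)[OF d] by simp
  finally show ?thesis by (simp add: exp_diff exp_minus field_simps)
qed

lemma AE_stable_subordinator_increment:
  assumes st: "stable_subordinator M \<nu> H" and \<nu>: "0 < \<nu>" "\<nu> \<le> 1" and r: "0 \<le> r" "r < s"
  shows "AE \<omega> in M. H r \<omega> < H s \<omega>"
proof -
  note H = stable_subordinatorD[OF st prob_space_axioms \<nu>]
  define d where "d = s - r"
  have d: "0 < d" "s = r + d" using r by (auto simp: d_def)
  have [measurable]: "H d \<in> borel_measurable M" "H r \<in> borel_measurable M" "H s \<in> borel_measurable M"
    using H(1) r d by (auto simp: increasing_process_def)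
  have "prob {\<omega>\<in>space M. H d \<omega> \<le> 0} \<le> e" if "0 < e" for e
  proof -
    \<comment> \<open>Solves \<open>d * \<xi> powr \<nu> = \<bar>ln e\<bar>\<close>, so that the
      tail bound at c = 0 is at most e.\<close>
    define \<xi> where "\<xi> = (\<bar>ln e\<bar> / d) powr (1 / \<nu>)"
    have "\<xi> powr \<nu> = \<bar>ln e\<bar> / d" using \<nu> d by (simp add: \<xi>_def powr_powr)
    then have "exp (\<xi> * 0 - d * \<xi> powr \<nu>) \<le> exp (ln e)" using d by simp
    then show ?thesis
      using stable_subordinator_tail[OF st \<nu>, of d \<xi> 0] d \<open>0 < e\<close> by (simp add: \<xi>_def)
  qed
  then have "prob {\<omega>\<in>space M. H d \<omega> \<le> 0} \<le> 0"
    by (rule field_le_epsilon[of _ 0, simplified])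
  then have "prob {\<omega>\<in>space M. H d \<omega> \<le> 0} = 0"
    using measure_nonneg[of M] by (auto intro: antisym)
  then have "AE \<omega> in M. \<not> H d \<omega> \<le> 0"
    by (subst AE_iff_measurable[OF _ refl]) (auto simp: emeasure_eq_measure)
  then have "AE x in distr M borel (H d). 0 < x"
    by (subst AE_distr_iff) (auto simp: not_le)
  then have "AE x in distr M borel (\<lambda>\<omega>. H (r + d) \<omega> - H r \<omega>). 0 < x"
    by (subst H(3)) (use r d in \<open>auto simp: less_imp_le\<close>)
  then show ?thesis
    unfolding d(2)[symmetric] by (subst (asm) AE_distr_iff) auto
qed

text \<open>An increment at fixed times is positive outside a null set depending on these times.
  Rational times leave countably many null sets, and monotonicity carries strictness to real r < s
  by squeezing two rationals between them.\<close>

lemma AE_stable_subordinator_regular_path: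
  assumes st: "stable_subordinator M \<nu> H" and \<nu>: "0 < \<nu>" "\<nu> \<le> 1"
  shows "AE \<omega> in M. regular_path (\<lambda>s. H s \<omega>)"
proof -
  note H = stable_subordinatorD[OF st prob_space_axioms \<nu>]
  have "AE \<omega> in M. \<forall>r s :: rat. 0 \<le> r \<longrightarrow> r < s \<longrightarrow> H (of_rat r) \<omega> < H (of_rat s) \<omega>"
    unfolding AE_all_countable
    using AE_stable_subordinator_increment[OF st \<nu>] by (auto simp: of_rat_less)
  moreover have "AE \<omega> in M. \<forall>n. \<exists>s\<ge>0. real n < H s \<omega>"
    unfolding AE_all_countable
  proof
    fix n :: nat
    have [measurable]: "H (real k) \<in> borel_measurable M" for k
      using H(1) by (auto simp: increasing_process_def)
    \<comment> \<open>A path bounded by n satisfies \<open>H (real k) \<omega> \<le> real n\<close>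
      for each single k, and these events have geometrically decreasing probability bounds.\<close>
    have "prob {\<omega>\<in>space M. \<forall>k. H (real k) \<omega> \<le> real n} \<le> exp (real n) * exp (- 1) ^ k" for k
    proof -
      have "prob {\<omega>\<in>space M. \<forall>k. H (real k) \<omega> \<le> real n} \<le> prob {\<omega>\<in>space M. H (real k) \<omega> \<le> real n}"
        by (rule finite_measure_mono) auto
      also have "\<dots> \<le> exp (real n) * exp (- 1) ^ k"
        using stable_subordinator_tail[OF st \<nu>, of "real k" 1 "real n"]
        by (simp add: exp_diff exp_minus field_simps power_inverse flip: exp_of_nat_mult)
      finally show ?thesis .
    qed
    moreover have "(\<lambda>k. exp (real n) * exp (- 1) ^ k) \<longlonglongrightarrow> exp (real n) * 0"
      by (intro tendsto_intros LIMSEQ_realpow_zero) auto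
    ultimately have "prob {\<omega>\<in>space M. \<forall>k. H (real k) \<omega> \<le> real n} \<le> 0"
      by (intro LIMSEQ_le_const[where X="\<lambda>k. exp (real n) * exp (- 1) ^ k"]) auto
    then have "prob {\<omega>\<in>space M. \<forall>k. H (real k) \<omega> \<le> real n} = 0"
      using measure_nonneg[of M] by (auto intro: antisym)
    then have "AE \<omega> in M. \<not> (\<forall>k. H (real k) \<omega> \<le> real n)"
      by (subst AE_iff_measurable[OF _ refl]) (auto simp: emeasure_eq_measure)
    then show "AE \<omega> in M. \<exists>s\<ge>0. real n < H s \<omega>"
      by eventually_elim (metis not_le of_nat_0_le_iff)
  qed
  ultimately show ?thesis
    using AE_space
  proof eventually_elim
    case (elim \<omega>)
    have mono: "H r \<omega> \<le> H s \<omega>" if "0 \<le> r" "r \<le> s" for r s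
      using H(1) elim(3) that by (auto simp: increasing_process_def mono_on_def)
    show ?case
      unfolding regular_path_def
    proof (intro conjI allI impI)
      fix r s :: real assume rs: "0 \<le> r" "r < s"
      obtain p where p: "r < of_rat p" "of_rat p < s" using of_rat_dense rs by blast
      obtain q where q: "of_rat p < (of_rat q :: real)" "of_rat q < s" using of_rat_dense p by blast
      have "(0::real) \<le> of_rat p" using rs p by linarith
      then have "0 \<le> p" by (simp only: zero_le_of_rat_iff)
      have "H r \<omega> \<le> H (of_rat p) \<omega>" using mono rs p by simp
      also have "\<dots> < H (of_rat q) \<omega>" using elim(1) \<open>0 \<le> p\<close> q by (simp add: of_rat_less)
      also have "\<dots> \<le> H s \<omega>" using rs p q by (intro mono) linarith+
      finally show "H r \<omega> < H s \<omega>" .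
    next
      fix c :: real
      obtain n where "c \<le> real n" using real_arch_simple by blast
      then show "\<exists>s\<ge>0. c < H s \<omega>" using elim(2) by (meson le_less_trans)
    qed (use H(1) elim(3) in \<open>auto simp: increasing_process_def\<close>)
  qed
qed

end

lemma AE_inverse_stable_subordinator:
  assumes "prob_space M" "inverse_stable_subordinator M \<nu> L" "0 < \<nu>" "\<nu> \<le> 1"
  obtains H where "stable_subordinator M \<nu> H"
    "AE \<omega> in M. regular_path (\<lambda>s. H s \<omega>) \<and> (\<forall>t\<ge>0. L t \<omega> = path_inverse (\<lambda>s. H s \<omega>) t)"
proof -
  interpret prob_space M by fact
  obtain H where H: "stable_subordinator M \<nu> H"
    "AE \<omega> in M. \<forall>t\<ge>0. L t \<omega> = Inf {s. 0 \<le> s \<and> t < H s \<omega>}"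
    using assms(2) by (auto simp: inverse_stable_subordinator_def)
  show ?thesis
    by (rule that[OF H(1)])
      (use AE_stable_subordinator_regular_path[OF H(1) assms(3,4)] H(2) in
        \<open>auto elim!: eventually_elim2 simp: path_inverse_def\<close>)
qed

section \<open>Laplace transforms of the inverse subordinator\<close>

lemma nn_integral_exp_Ici:
  fixes c x :: real assumes "0 < c"
  shows "(\<integral>\<^sup>+t. ennreal (exp (- (c * t))) * indicator {x..} t \<partial>lborel) = ennreal (exp (- (c * x)) / c)"
proof -
  have "(\<integral>\<^sup>+t. ennreal (exp (- (c * t))) * indicator {x..} t \<partial>lborel) = ennreal (0 - (- exp (- (c * x)) / c))"
  proof (rule nn_integral_FTC_atLeast[where F="\<lambda>t. - exp (- (c * t)) / c"])
    show "((\<lambda>t. - exp (- (c * t)) / c) \<longlongrightarrow> 0) at_top" using assms by real_asymp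
  qed (use assms in \<open>auto intro!: derivative_eq_intros\<close>)
  then show ?thesis by simp
qed

lemma nn_integral_exp_Icc:
  fixes c x :: real assumes "0 < c" "0 \<le> x"
  shows "(\<integral>\<^sup>+t. ennreal (c * exp (- (c * t))) * indicator {0..x} t \<partial>lborel) = ennreal (1 - exp (- (c * x)))"
proof -
  have "(\<integral>\<^sup>+t. ennreal (c * exp (- (c * t))) * indicator {0..x} t \<partial>lborel)
      = ennreal (- exp (- (c * x)) - (- exp (- (c * 0))))"
    by (rule nn_integral_FTC_Icc[where F="\<lambda>t. - exp (- (c * t))"])
       (use assms in \<open>auto intro!: derivative_eq_intros\<close>)
  then show ?thesis by simp
qed

context
  fixes M :: "'a measure" and \<beta> :: real and L :: "real \<Rightarrow> 'a \<Rightarrow> real"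
  assumes M: "prob_space M" and L: "inverse_stable_subordinator M \<beta> L" and \<beta>: "0 < \<beta>" "\<beta> \<le> 1"
begin

interpretation prob_space M by (rule M)

lemma inverse_subordinator_measurable: "0 \<le> t \<Longrightarrow> L t \<in> borel_measurable M"
  and inverse_subordinator_nonneg: "0 \<le> t \<Longrightarrow> \<omega> \<in> space M \<Longrightarrow> 0 \<le> L t \<omega>"
  using L by (auto simp: inverse_stable_subordinator_def)

lemma AE_inverse_subordinator_0: "AE \<omega> in M. L 0 \<omega> = 0"
  by (rule AE_inverse_stable_subordinator[OF M L \<beta>])
     (erule eventually_mono, simp add: path_inverse_0)

text \<open>Required later because \<open>density_family\<close> describes the law of the
  subordinator only at strictly positive times.\<close>

lemma AE_inverse_subordinator_pos: "0 < t \<Longrightarrow> AE \<omega> in M. 0 < L t \<omega>"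
  by (rule AE_inverse_stable_subordinator[OF M L \<beta>])
     (erule eventually_mono, simp add: path_inverse_pos)

lemma integrable_exp_inverse_subordinator:
  "0 \<le> c \<Longrightarrow> 0 \<le> t \<Longrightarrow> integrable M (\<lambda>\<omega>. exp (- c * L t \<omega>))"
  by (rule integrable_const_bound[where B=1])
     (use inverse_subordinator_measurable[of t] inverse_subordinator_nonneg[of t] in auto)

text \<open>Almost every path of L is continuous, being the inverse of a regular path, and the
  integrand is bounded by 1.\<close>

lemma continuous_laplace_inverse_subordinator:
  assumes "0 \<le> c"
  shows "continuous_on {0..} (\<lambda>t. LINT \<omega>|M. exp (- c * L t \<omega>))"
  unfolding continuous_on_sequentially
proof safe
  fix x :: "nat \<Rightarrow> real" and t :: real
  assume x: "\<forall>n. x n \<in> {0..}" "x \<longlonglongrightarrow> t" and t: "0 \<le> t"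
  show "((\<lambda>t. LINT \<omega>|M. exp (- c * L t \<omega>)) \<circ> x) \<longlonglongrightarrow> (LINT \<omega>|M. exp (- c * L t \<omega>))"
    unfolding comp_def
  proof (rule integral_dominated_convergence[where w="\<lambda>_. 1"])
    obtain H where "AE \<omega> in M. regular_path (\<lambda>s. H s \<omega>) \<and> (\<forall>t\<ge>0. L t \<omega> = path_inverse (\<lambda>s. H s \<omega>) t)"
      by (rule AE_inverse_stable_subordinator[OF M L \<beta>])
    then show "AE \<omega> in M. (\<lambda>i. exp (- c * L (x i) \<omega>)) \<longlonglongrightarrow> exp (- c * L t \<omega>)"
    proof eventually_elim
      case (elim \<omega>)
      have "(\<lambda>i. path_inverse (\<lambda>s. H s \<omega>) (x i)) \<longlonglongrightarrow> path_inverse (\<lambda>s. H s \<omega>) t"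
        using continuous_path_inverse[of "\<lambda>s. H s \<omega>" UNIV] elim x
        by (auto simp: continuous_on_eq_continuous_at intro: isCont_tendsto_compose)
      then show ?case using elim x t by (auto intro!: tendsto_intros)
    qed
    show "AE \<omega> in M. norm (exp (- c * L (x i) \<omega>)) \<le> 1" for i
      using x inverse_subordinator_nonneg[of "x i"] \<open>0 \<le> c\<close> by auto
  qed (use x t inverse_subordinator_measurable in auto)
qed

text \<open>
  With \<open>H\<close> the subordinator inverted by \<open>L\<close>, the events \<open>s < L t\<close> and \<open>H s \<le> t\<close> agree up to
  \<open>s = L t\<close>, whence \<open>E (1 - exp (- c L t)) = \<integral>\<^sub>0\<^sup>\<infinity> c exp (- c s) P (H s \<le> t) ds\<close>.
\<close>

lemma laplace_inverse_subordinator_complement: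
  assumes H: "stable_subordinator M \<beta> H"
    and ae: "AE \<omega> in M. regular_path (\<lambda>s. H s \<omega>) \<and> (\<forall>t\<ge>0. L t \<omega> = path_inverse (\<lambda>s. H s \<omega>) t)"
    and "0 < c" "0 \<le> t"
  shows "ennreal (1 - (LINT \<omega>|M. exp (- c * L t \<omega>))) =
    (\<integral>\<^sup>+s. \<integral>\<^sup>+\<omega>. ennreal (c * exp (- c * s)) * indicator {0..} s * indicator {0..} (t - H (max 0 s) \<omega>) \<partial>M \<partial>lborel)"
proof -
  note Hi = stable_subordinatorD(1)[OF H M \<beta>]
  note [measurable] = measurable_increasing_process[OF Hi]
  note int = integrable_exp_inverse_subordinator[of c t]
  have "ennreal (1 - (LINT \<omega>|M. exp (- c * L t \<omega>))) = ennreal (LINT \<omega>|M. 1 - exp (- c * L t \<omega>))"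
    using int assms by (simp add: prob_space)
  also have "\<dots> = (\<integral>\<^sup>+\<omega>. ennreal (1 - exp (- c * L t \<omega>)) \<partial>M)"
    by (rule nn_integral_eq_integral[symmetric])
       (use int assms inverse_subordinator_nonneg[of t] in auto)
  also have "\<dots> = (\<integral>\<^sup>+\<omega>. \<integral>\<^sup>+s. ennreal (c * exp (- c * s)) * indicator {0..} s * indicator {0..} (t - H (max 0 s) \<omega>) \<partial>lborel \<partial>M)"
  proof (rule nn_integral_cong_AE)
    show "AE \<omega> in M. ennreal (1 - exp (- c * L t \<omega>)) =
      (\<integral>\<^sup>+s. ennreal (c * exp (- c * s)) * indicator {0..} s * indicator {0..} (t - H (max 0 s) \<omega>) \<partial>lborel)"
      using ae
    proof eventually_elim
      case (elim \<omega>)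
      define h where "h = (\<lambda>s. H s \<omega>)"
      have h: "regular_path h" "L t \<omega> = path_inverse h t"
        using elim \<open>0 \<le> t\<close> by (auto simp: h_def)
      have "ennreal (1 - exp (- c * L t \<omega>)) = (\<integral>\<^sup>+s. ennreal (c * exp (- c * s)) * indicator {0..L t \<omega>} s \<partial>lborel)"
        using \<open>0 < c\<close> h by (simp add: nn_integral_exp_Icc path_inverse_nonneg)
      also have "\<dots> = (\<integral>\<^sup>+s. ennreal (c * exp (- c * s)) * indicator {0..} s * indicator {0..} (t - h (max 0 s)) \<partial>lborel)"
      proof (rule nn_integral_cong_AE)
        show "AE s in lborel. ennreal (c * exp (- c * s)) * indicator {0..L t \<omega>} s
            = ennreal (c * exp (- c * s)) * indicator {0..} s * indicator {0..} (t - h (max 0 s))"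
          using AE_lborel_singleton[of "L t \<omega>"]
        proof eventually_elim
          case (elim s)
          then show ?case
            using less_path_inverse[OF h(1), of s t] path_inverse_less[OF h(1), of t s] h(2)
            by (auto simp: indicator_def max_def)
        qed
      qed
      finally show ?case by (simp add: h_def)
    qed
  qed
  also have "\<dots> = (\<integral>\<^sup>+s. \<integral>\<^sup>+\<omega>. ennreal (c * exp (- c * s)) * indicator {0..} s * indicator {0..} (t - H (max 0 s) \<omega>) \<partial>M \<partial>lborel)"
    by (rule pair_sigma_finite.Fubini'[symmetric])
       (use sigma_finite_measure_axioms sigma_finite_lborel in \<open>auto simp: pair_sigma_finite_def\<close>)
  finally show ?thesis .
qed

text \<open>By Tonelli the time integral runs from \<open>H s\<close> to infinity and gives
  \<open>exp (- \<eta> * H s) / \<eta>\<close>, with expectation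
  \<open>exp (- s * \<eta> powr \<beta>) / \<eta>\<close>. The integral over s then gives
  \<open>c / (\<eta> * (c + \<eta> powr \<beta>))\<close>. This is the transform of the complement
  \<open>1 - \<phi>\<close>, so it is subtracted from \<open>1 / \<eta>\<close>.\<close>

lemma laplace_laplace_inverse_subordinator:
  assumes "0 < c" "0 < \<eta>"
  shows "set_integrable lborel {0<..} (\<lambda>t. exp (- \<eta> * t) * (LINT \<omega>|M. exp (- c * L t \<omega>)))"
    and "(LINT t:{0<..}|lborel. exp (- \<eta> * t) * (LINT \<omega>|M. exp (- c * L t \<omega>)))
           = \<eta> powr (\<beta> - 1) / (\<eta> powr \<beta> + c)"
proof -
  define \<phi> where "\<phi> t = (LINT \<omega>|M. exp (- c * L t \<omega>))" for t
  obtain H where H: "stable_subordinator M \<beta> H"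
    and ae: "AE \<omega> in M. regular_path (\<lambda>s. H s \<omega>) \<and> (\<forall>t\<ge>0. L t \<omega> = path_inverse (\<lambda>s. H s \<omega>) t)"
    by (rule AE_inverse_stable_subordinator[OF M L \<beta>])
  note Hi = stable_subordinatorD[OF H M \<beta>]
  note [measurable] = measurable_increasing_process[OF Hi(1)]
  interpret P: pair_sigma_finite lborel M
    using sigma_finite_measure_axioms sigma_finite_lborel by (auto simp: pair_sigma_finite_def)
  let ?F = "\<lambda>t s \<omega>. ennreal (exp (- \<eta> * t)) * indicator {0<..} t *
     (ennreal (c * exp (- c * s)) * indicator {0..} s * indicator {0..} (t - H (max 0 s) \<omega>))"
  define d where "d = c + \<eta> powr \<beta>"
  have "0 < d" using assms by (simp add: d_def add_pos_nonneg)
  have m\<phi>[measurable]: "(\<lambda>t. indicator {0<..} t * \<phi> t) \<in> borel_measurable borel"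
  proof -
    have "\<phi> \<in> borel_measurable (restrict_space borel {0<..})"
      using continuous_laplace_inverse_subordinator[of c] \<open>0 < c\<close>
      by (intro borel_measurable_continuous_on_restrict)
         (auto simp: \<phi>_def intro: continuous_on_subset)
    then show ?thesis by (simp add: borel_measurable_restrict_space_iff)
  qed
  have \<phi>01: "0 \<le> \<phi> t" "\<phi> t \<le> 1" if "0 \<le> t" for t
  proof -
    show "0 \<le> \<phi> t" by (simp add: \<phi>_def)
    have "\<phi> t \<le> (LINT \<omega>|M. 1)"
      unfolding \<phi>_def using integrable_exp_inverse_subordinator[of c t] \<open>0 < c\<close> that
        inverse_subordinator_nonneg[of t]
      by (intro integral_mono) auto
    then show "\<phi> t \<le> 1" by (simp add: prob_space)
  qed
  have "(\<integral>\<^sup>+t. ennreal (indicator {0<..} t * (exp (- \<eta> * t) * (1 - \<phi> t))) \<partial>lborel)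
     = (\<integral>\<^sup>+t. \<integral>\<^sup>+s. \<integral>\<^sup>+\<omega>. ?F t s \<omega> \<partial>M \<partial>lborel \<partial>lborel)"
  proof (rule nn_integral_cong)
    fix t :: real
    show "ennreal (indicator {0<..} t * (exp (- \<eta> * t) * (1 - \<phi> t))) = (\<integral>\<^sup>+s. \<integral>\<^sup>+\<omega>. ?F t s \<omega> \<partial>M \<partial>lborel)"
    proof (cases "0 < t")
      case True
      have "ennreal (indicator {0<..} t * (exp (- \<eta> * t) * (1 - \<phi> t)))
          = ennreal (exp (- \<eta> * t)) * ennreal (1 - \<phi> t)"
        using True \<phi>01[of t] by (simp add: ennreal_mult)
      also have "\<dots> = (\<integral>\<^sup>+s. \<integral>\<^sup>+\<omega>. ?F t s \<omega> \<partial>M \<partial>lborel)"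
        unfolding \<phi>_def
        using laplace_inverse_subordinator_complement[OF H ae \<open>0 < c\<close>, of t] True
        by (simp add: nn_integral_cmult)
      finally show ?thesis .
    qed simp
  qed
  also have "\<dots> = (\<integral>\<^sup>+s. \<integral>\<^sup>+t. \<integral>\<^sup>+\<omega>. ?F t s \<omega> \<partial>M \<partial>lborel \<partial>lborel)"
    by (rule lborel_pair.Fubini') measurable
  also have "\<dots> = (\<integral>\<^sup>+s. \<integral>\<^sup>+\<omega>. \<integral>\<^sup>+t. ?F t s \<omega> \<partial>lborel \<partial>M \<partial>lborel)"
    by (intro nn_integral_cong P.Fubini'[symmetric]) measurable
  also have "\<dots> = (\<integral>\<^sup>+s. ennreal (c / \<eta>) * (ennreal (exp (- d * s)) * indicator {0..} s) \<partial>lborel)"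
  proof (rule nn_integral_cong)
    fix s :: real
    show "(\<integral>\<^sup>+\<omega>. \<integral>\<^sup>+t. ?F t s \<omega> \<partial>lborel \<partial>M) = ennreal (c / \<eta>) * (ennreal (exp (- d * s)) * indicator {0..} s)"
    proof (cases "0 \<le> s")
      case True
      have "(\<integral>\<^sup>+\<omega>. \<integral>\<^sup>+t. ?F t s \<omega> \<partial>lborel \<partial>M)
          = (\<integral>\<^sup>+\<omega>. ennreal (c * exp (- c * s)) * ennreal (exp (- \<eta> * H s \<omega>) / \<eta>) \<partial>M)"
      proof (rule nn_integral_cong)
        fix \<omega> assume \<omega>: "\<omega> \<in> space M"
        have "(\<integral>\<^sup>+t. ?F t s \<omega> \<partial>lborel)
          = (\<integral>\<^sup>+t. ennreal (c * exp (- c * s)) * (ennreal (exp (- \<eta> * t)) * indicator {H s \<omega>..} t) \<partial>lborel)"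
          using AE_lborel_singleton[of "0::real"]
          by (intro nn_integral_cong_AE, elim eventually_mono)
            (use True increasing_process_nonneg[OF Hi(1) \<omega> True] in
              \<open>auto simp: indicator_def max_def mult_ac\<close>)
        then show "(\<integral>\<^sup>+t. ?F t s \<omega> \<partial>lborel) = ennreal (c * exp (- c * s)) * ennreal (exp (- \<eta> * H s \<omega>) / \<eta>)"
          using \<open>0 < \<eta>\<close> by (simp add: nn_integral_cmult nn_integral_exp_Ici del: mult_minus_left)
      qed
      also have "\<dots> = (\<integral>\<^sup>+\<omega>. ennreal (c * exp (- c * s) / \<eta> * exp (- \<eta> * H s \<omega>)) \<partial>M)"
        using assms by (intro nn_integral_cong) (simp flip: ennreal_mult)
      also have "\<dots> = ennreal (LINT \<omega>|M. c * exp (- c * s) / \<eta> * exp (- \<eta> * H s \<omega>))"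
      proof (rule nn_integral_eq_integral)
        have "H s \<in> borel_measurable M" using Hi(1) True by (simp add: increasing_process_def)
        then show "integrable M (\<lambda>\<omega>. c * exp (- c * s) / \<eta> * exp (- \<eta> * H s \<omega>))"
          by (intro integrable_mult_right integrable_const_bound[where B=1])
            (use increasing_process_nonneg[OF Hi(1)] True assms in auto)
      qed (use assms in auto)
      also have "\<dots> = ennreal (c * exp (- c * s) / \<eta> * exp (- s * \<eta> powr \<beta>))"
        using Hi(2)[OF True, of \<eta>] assms by simp
      also have "c * exp (- c * s) / \<eta> * exp (- s * \<eta> powr \<beta>) = c / \<eta> * exp (- d * s)"
        by (simp add: d_def exp_diff exp_minus ring_distribs exp_add mult_ac divide_simps)
      also have "ennreal (c / \<eta> * exp (- d * s)) = ennreal (c / \<eta>) * ennreal (exp (- d * s))"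
        using assms by (intro ennreal_mult) auto
      finally show ?thesis using True by simp
    qed simp
  qed
  also have "\<dots> = ennreal (c / \<eta>) * ennreal (1 / d)"
    using nn_integral_exp_Ici[OF \<open>0 < d\<close>, of 0] by (simp add: nn_integral_cmult)
  also have "\<dots> = ennreal (c / (\<eta> * d))"
    using assms \<open>0 < d\<close> by (simp flip: ennreal_mult)
  finally have nn: "(\<integral>\<^sup>+t. ennreal (indicator {0<..} t * (exp (- \<eta> * t) * (1 - \<phi> t))) \<partial>lborel) = ennreal (c / (\<eta> * d))" .
  have m1: "(\<lambda>t. indicator {0<..} t * (exp (- \<eta> * t) * (1 - \<phi> t))) \<in> borel_measurable lborel"
  proof -
    have "(\<lambda>t. exp (- \<eta> * t) * (indicator {0<..} t - indicator {0<..} t * \<phi> t)) \<in> borel_measurable lborel"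
      by measurable
    then show ?thesis by (simp add: algebra_simps)
  qed
  have hb1: "has_bochner_integral lborel (\<lambda>t. indicator {0<..} t * (exp (- \<eta> * t) * (1 - \<phi> t))) (c / (\<eta> * d))"
    by (rule has_bochner_integral_nn_integral)
       (use m1 nn \<phi>01 assms \<open>0 < d\<close> in \<open>auto simp: indicator_def\<close>)
  have hb2: "has_bochner_integral lborel (\<lambda>t. indicator {0<..} t * exp (- \<eta> * t)) (1 / \<eta>)"
  proof (rule has_bochner_integral_nn_integral)
    have "(\<integral>\<^sup>+t. ennreal (indicator {0<..} t * exp (- \<eta> * t)) \<partial>lborel)
       = (\<integral>\<^sup>+t. ennreal (exp (- \<eta> * t)) * indicator {0..} t \<partial>lborel)"
      by (intro nn_integral_cong_AE eventually_mono[OF AE_lborel_singleton[of "0::real"]])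
         (auto simp: indicator_def)
    then show "(\<integral>\<^sup>+t. ennreal (indicator {0<..} t * exp (- \<eta> * t)) \<partial>lborel) = ennreal (1 / \<eta>)"
      using nn_integral_exp_Ici[OF \<open>0 < \<eta>\<close>, of 0] by simp
  qed (use assms in auto)
  have eq: "1 / \<eta> - c / (\<eta> * d) = \<eta> powr (\<beta> - 1) / (\<eta> powr \<beta> + c)"
  proof -
    have "1 / \<eta> - c / (\<eta> * d) = (d - c) / (\<eta> * d)"
      using \<open>0 < d\<close> by (simp add: diff_divide_distrib)
    also have "\<dots> = \<eta> powr \<beta> / \<eta> / (\<eta> powr \<beta> + c)"
      by (simp add: d_def add.commute)
    finally show ?thesis using assms by (simp add: powr_diff)
  qed
  have "has_bochner_integral lborel (\<lambda>t. indicator {0<..} t * (exp (- \<eta> * t) * \<phi> t)) (\<eta> powr (\<beta> - 1) / (\<eta> powr \<beta> + c))"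
    using has_bochner_integral_diff[OF hb2 hb1] unfolding eq by (simp add: algebra_simps)
  then show "set_integrable lborel {0<..} (\<lambda>t. exp (- \<eta> * t) * (LINT \<omega>|M. exp (- c * L t \<omega>)))"
    and "(LINT t:{0<..}|lborel. exp (- \<eta> * t) * (LINT \<omega>|M. exp (- c * L t \<omega>)))
           = \<eta> powr (\<beta> - 1) / (\<eta> powr \<beta> + c)"
    by (auto simp: has_bochner_integral_iff set_integrable_def set_lebesgue_integral_def \<phi>_def)
qed

end

section \<open>Independence of paths\<close>

text \<open>The \<sigma>-algebra generated by the process is kept on the outcome space: there the
  paths are known to be right-continuous, whereas the product space of all functions contains
  arbitrary paths.\<close>

definition path_algebra :: "'a measure \<Rightarrow> (real \<Rightarrow> 'a \<Rightarrow> real) \<Rightarrow> 'a measure" where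
  "path_algebra M Y =
     vimage_algebra (space M) (\<lambda>\<omega>. restrict (\<lambda>t. Y t \<omega>) {0..}) (PiM {0..} (\<lambda>_. borel))"

lemma space_path_algebra[simp]: "space (path_algebra M Y) = space M"
  by (simp add: path_algebra_def)

lemma path_measurable_PiM:
  assumes "\<And>t. 0 \<le> t \<Longrightarrow> Y t \<in> borel_measurable A"
  shows "(\<lambda>\<omega>. restrict (\<lambda>t. Y t \<omega>) {0..}) \<in> A \<rightarrow>\<^sub>M PiM {0..} (\<lambda>_. borel :: real measure)"
  using assms by (intro measurable_restrict) auto

lemma measurable_path_algebra:
  assumes "0 \<le> t"
  shows "Y t \<in> borel_measurable (path_algebra M Y)"
proof -
  have "(\<lambda>\<omega>. restrict (\<lambda>t. Y t \<omega>) {0..}) \<in> path_algebra M Y \<rightarrow>\<^sub>M PiM {0..} (\<lambda>_. borel :: real measure)"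
    unfolding path_algebra_def by (rule measurable_vimage_algebra1) (auto simp: space_PiM)
  from measurable_compose[OF this measurable_component_singleton[of t]] assms
  show ?thesis by simp
qed

lemma measurable_id_path_algebra:
  assumes "\<And>t. 0 \<le> t \<Longrightarrow> Y t \<in> borel_measurable M"
  shows "(\<lambda>\<omega>. \<omega>) \<in> M \<rightarrow>\<^sub>M path_algebra M Y"
  unfolding path_algebra_def
  by (rule measurable_vimage_algebra2) (use path_measurable_PiM[OF assms] in auto)

text \<open>
  Independence of the processes is independence of the identity maps into the \<open>\<sigma>\<close>-algebras which
  the paths generate. This form applies to functionals, such as evaluation at a random time, which
  are not measurable on the product space of all functions.
\<close>

lemma indep_processes_nn_integral:
  fixes Y :: "nat \<Rightarrow> real \<Rightarrow> 'a \<Rightarrow> real"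
  assumes "prob_space M" and ind: "indep_processes M [Y 0, Y 1, Y 2, Y 3]"
    and Y: "\<And>i t. 0 \<le> t \<Longrightarrow> Y i t \<in> borel_measurable M"
    and \<Phi>: "(\<lambda>(w0, w1, w2, w3). \<Phi> w0 w1 w2 w3) \<in> borel_measurable
      (path_algebra M (Y 0) \<Otimes>\<^sub>M path_algebra M (Y 1) \<Otimes>\<^sub>M path_algebra M (Y 2) \<Otimes>\<^sub>M path_algebra M (Y 3))"
  shows "(\<integral>\<^sup>+\<omega>. \<Phi> \<omega> \<omega> \<omega> \<omega> \<partial>M) =
    (\<integral>\<^sup>+w3. \<integral>\<^sup>+w2. \<integral>\<^sup>+w1. \<integral>\<^sup>+w0. \<Phi> w0 w1 w2 w3 \<partial>M \<partial>M \<partial>M \<partial>M)"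
proof -
  interpret prob_space M by fact
  define A where "A i = path_algebra M (Y i)" for i
  \<comment> \<open>The restriction of M to the \<sigma>-algebra of the i-th process, written as an
    image under the identity.\<close>
  define B where "B i = distr M (A i) (\<lambda>\<omega>. \<omega>)" for i
  let ?I = "{..<4::nat}"
  have idm[measurable]: "(\<lambda>\<omega>. \<omega>) \<in> M \<rightarrow>\<^sub>M A i" for i
    unfolding A_def by (rule measurable_id_path_algebra) (rule Y)
  have PS: "prob_space (B i)" for i unfolding B_def by (rule prob_space_distr) (rule idm)
  interpret B: product_prob_space B UNIV
    by (rule product_prob_spaceI) (rule PS)
  have nth: "[Y 0, Y 1, Y 2, Y 3] ! i = Y i" if "i \<in> ?I" for i
    using that by (auto simp: less_Suc_eq eval_nat_numeral)
  have "indep_vars (\<lambda>_. PiM {0..} (\<lambda>_. borel)) (\<lambda>i \<omega>. restrict (\<lambda>t. Y i t \<omega>) {0..}) ?I"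
    using ind unfolding indep_processes_def
    by (subst (asm) indep_vars_cong[where J="?I" and Y="\<lambda>i \<omega>. restrict (\<lambda>t. Y i t \<omega>) {0..}" and
          N'="\<lambda>_. PiM {0..} (\<lambda>_. borel)"]) (use nth in auto)
  then have "indep_sets (\<lambda>i. sets (A i)) ?I"
    by (simp add: indep_vars_def A_def path_algebra_def sets_vimage_algebra)
  moreover have "sigma_sets (space M) {(\<lambda>\<omega>. \<omega>) -` S \<inter> space M |S. S \<in> sets (A i)} = sets (A i)" for i
  proof -
    have sp: "space (A i) = space M" by (simp add: A_def)
    have "{(\<lambda>\<omega>. \<omega>) -` S \<inter> space M |S. S \<in> sets (A i)} = sets (A i)"
      using sets.sets_into_space[of _ "A i"] unfolding sp by (auto simp: Int_absorb2)
    then show ?thesis using sets.sigma_sets_eq[of "A i"] sp by simp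
  qed
  ultimately have "indep_vars A (\<lambda>_ \<omega>. \<omega>) ?I"
    by (simp add: indep_vars_def idm)
  \<comment> \<open>The law of the diagonal map: on the four path algebras, repeating one outcome
    has the same law as drawing four independent outcomes.\<close>
  then have distr: "distr M (PiM ?I A) (\<lambda>\<omega>. \<lambda>i\<in>?I. \<omega>) = PiM ?I B"
    unfolding B_def by (subst (asm) indep_vars_iff_distr_eq_PiM') (auto intro: idm simp: lessThan_empty_iff)
  have setsB[measurable_cong]: "sets (B i) = sets (A i)" for i by (simp add: B_def)
  have \<Phi>B: "(\<lambda>(w0, w1, w2, w3). \<Phi> w0 w1 w2 w3) \<in> borel_measurable (B 0 \<Otimes>\<^sub>M B 1 \<Otimes>\<^sub>M B 2 \<Otimes>\<^sub>M B 3)"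
    using \<Phi> unfolding A_def[symmetric] by measurable
  have m\<Phi>: "(\<lambda>x. \<Phi> (f0 x) (f1 x) (f2 x) (f3 x)) \<in> borel_measurable N"
    if "f0 \<in> N \<rightarrow>\<^sub>M B 0" "f1 \<in> N \<rightarrow>\<^sub>M B 1" "f2 \<in> N \<rightarrow>\<^sub>M B 2" "f3 \<in> N \<rightarrow>\<^sub>M B 3"
    for f0 f1 f2 f3 and N :: "'x measure"
  proof -
    have "(\<lambda>x. (f0 x, f1 x, f2 x, f3 x)) \<in> N \<rightarrow>\<^sub>M B 0 \<Otimes>\<^sub>M B 1 \<Otimes>\<^sub>M B 2 \<Otimes>\<^sub>M B 3"
      by (intro measurable_Pair that)
    from measurable_compose[OF this \<Phi>B] show ?thesis by simp
  qed
  have sf: "sigma_finite_measure (B i)" for i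
    using PS[of i] by (simp add: prob_space_imp_sigma_finite)
  have lift: "(\<lambda>x. f (fst x)) \<in> N \<Otimes>\<^sub>M B j \<rightarrow>\<^sub>M B i" if "f \<in> N \<rightarrow>\<^sub>M B i" for f i j and N :: "'x measure"
    using that by (rule measurable_compose[OF measurable_fst])
  note nn = sigma_finite_measure.borel_measurable_nn_integral[OF sf, unfolded split_beta]
  \<comment> \<open>These measurability facts are stated over an arbitrary source space, so that
    each serves the next iterated integral, the finite product of the remaining factors, and a
    single factor.\<close>
  have m0: "(\<lambda>x. \<integral>\<^sup>+w0. \<Phi> w0 (f1 x) (f2 x) (f3 x) \<partial>B 0) \<in> borel_measurable N"
    if "f1 \<in> N \<rightarrow>\<^sub>M B 1" "f2 \<in> N \<rightarrow>\<^sub>M B 2" "f3 \<in> N \<rightarrow>\<^sub>M B 3"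
    for f1 f2 f3 and N :: "'x measure"
    by (intro nn m\<Phi> lift that measurable_snd)
  have m1: "(\<lambda>x. \<integral>\<^sup>+w1. \<integral>\<^sup>+w0. \<Phi> w0 w1 (f2 x) (f3 x) \<partial>B 0 \<partial>B 1) \<in> borel_measurable N"
    if "f2 \<in> N \<rightarrow>\<^sub>M B 2" "f3 \<in> N \<rightarrow>\<^sub>M B 3" for f2 f3 and N :: "'x measure"
    by (rule nn) (intro m0 lift that measurable_snd)
  have m2: "(\<lambda>x. \<integral>\<^sup>+w2. \<integral>\<^sup>+w1. \<integral>\<^sup>+w0. \<Phi> w0 w1 w2 (f3 x) \<partial>B 0 \<partial>B 1 \<partial>B 2) \<in> borel_measurable N"
    if "f3 \<in> N \<rightarrow>\<^sub>M B 3" for f3 and N :: "'x measure"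
    by (rule nn) (intro m1 lift that measurable_snd)
  have spB: "space (B i) = space M" for i by (simp add: B_def A_def)
  have I: "?I = insert 0 (insert 1 (insert 2 {3}))" by auto
  have c: "(\<lambda>x. x i) \<in> PiM J B \<rightarrow>\<^sub>M B i" if "i \<in> J" for i J
    using that by (rule measurable_component_singleton)
  have B2M: "(\<integral>\<^sup>+w. g w \<partial>B i) = (\<integral>\<^sup>+w. g w \<partial>M)" if "g \<in> borel_measurable (B i)" for g i
    using that unfolding B_def by (subst nn_integral_distr) auto
  have sPiM: "sets (PiM ?I A) = sets (PiM ?I B)" by (intro sets_PiM_cong) (auto simp: setsB)
  have "(\<lambda>w. \<Phi> (w 0) (w 1) (w 2) (w 3)) \<in> borel_measurable (PiM ?I B)"
    by (intro m\<Phi> c) auto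
  then have "(\<lambda>w. \<Phi> (w 0) (w 1) (w 2) (w 3)) \<in> borel_measurable (PiM ?I A)"
    by (simp cong: measurable_cong_sets[OF sPiM])
  moreover have "(\<lambda>\<omega>. \<lambda>i\<in>?I. \<omega>) \<in> M \<rightarrow>\<^sub>M PiM ?I A" by (intro measurable_restrict idm)
  ultimately have "(\<integral>\<^sup>+\<omega>. \<Phi> \<omega> \<omega> \<omega> \<omega> \<partial>M) = (\<integral>\<^sup>+w. \<Phi> (w 0) (w 1) (w 2) (w 3) \<partial>distr M (PiM ?I A) (\<lambda>\<omega>. \<lambda>i\<in>?I. \<omega>))"
    by (subst nn_integral_distr) auto
  also have "\<dots> = (\<integral>\<^sup>+w. \<Phi> (w 0) (w 1) (w 2) (w 3) \<partial>PiM (insert 0 (insert 1 (insert 2 {3}))) B)"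
    by (subst distr) (simp only: I)
  also have "\<dots> = (\<integral>\<^sup>+w. \<integral>\<^sup>+w0. \<Phi> w0 (w 1) (w 2) (w 3) \<partial>B 0 \<partial>PiM (insert 1 (insert 2 {3})) B)"
    by (rule trans[OF B.product_nn_integral_insert], simp, simp, intro m\<Phi> c) simp_all
  also have "\<dots> = (\<integral>\<^sup>+w. \<integral>\<^sup>+w1. \<integral>\<^sup>+w0. \<Phi> w0 w1 (w 2) (w 3) \<partial>B 0 \<partial>B 1 \<partial>PiM (insert 2 {3}) B)"
    by (rule trans[OF B.product_nn_integral_insert], simp, simp, intro m0 c) simp_all
  also have "\<dots> = (\<integral>\<^sup>+w. \<integral>\<^sup>+w2. \<integral>\<^sup>+w1. \<integral>\<^sup>+w0. \<Phi> w0 w1 w2 (w 3) \<partial>B 0 \<partial>B 1 \<partial>B 2 \<partial>PiM {3} B)"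
    by (rule trans[OF B.product_nn_integral_insert], simp, simp, intro m1 c) simp_all
  also have "\<dots> = (\<integral>\<^sup>+w3. \<integral>\<^sup>+w2. \<integral>\<^sup>+w1. \<integral>\<^sup>+w0. \<Phi> w0 w1 w2 w3 \<partial>B 0 \<partial>B 1 \<partial>B 2 \<partial>B 3)"
    by (rule B.product_nn_integral_singleton) (rule m2, simp)
  also have "\<dots> = (\<integral>\<^sup>+w3. \<integral>\<^sup>+w2. \<integral>\<^sup>+w1. \<integral>\<^sup>+w0. \<Phi> w0 w1 w2 w3 \<partial>B 0 \<partial>B 1 \<partial>B 2 \<partial>M)"
    by (rule B2M) (rule m2, simp)
  also have "\<dots> = (\<integral>\<^sup>+w3. \<integral>\<^sup>+w2. \<integral>\<^sup>+w1. \<integral>\<^sup>+w0. \<Phi> w0 w1 w2 w3 \<partial>B 0 \<partial>B 1 \<partial>M \<partial>M)"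
    by (intro nn_integral_cong, rule B2M, rule m1; simp add: spB)
  also have "\<dots> = (\<integral>\<^sup>+w3. \<integral>\<^sup>+w2. \<integral>\<^sup>+w1. \<integral>\<^sup>+w0. \<Phi> w0 w1 w2 w3 \<partial>B 0 \<partial>M \<partial>M \<partial>M)"
    by (intro nn_integral_cong, rule B2M, rule m0; simp add: spB)
  also have "\<dots> = (\<integral>\<^sup>+w3. \<integral>\<^sup>+w2. \<integral>\<^sup>+w1. \<integral>\<^sup>+w0. \<Phi> w0 w1 w2 w3 \<partial>M \<partial>M \<partial>M \<partial>M)"
    by (intro nn_integral_cong, rule B2M, rule m\<Phi>; simp add: spB)
  finally show ?thesis .
qed

section \<open>The equation for Laplace transforms\<close>

text \<open>Euler's integral for \<open>Gamma (1 - \<alpha>)\<close> after rescaling z by 1 / \<xi>.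
  It serves both the derivative in x and the one in t.\<close>

lemma nn_integral_power_kernel:
  assumes "0 < \<alpha>" "\<alpha> < 1" "0 < \<xi>"
  shows "(\<integral>\<^sup>+z. ennreal (indicator {0<..} z * (z powr (- \<alpha>) / Gamma (1 - \<alpha>) * exp (- \<xi> * z))) \<partial>lborel)
    = ennreal (\<xi> powr (\<alpha> - 1))"
proof -
  have G: "0 < Gamma (1 - \<alpha>)" using assms by (intro Gamma_real_pos) auto
  have "(\<integral>\<^sup>+z. ennreal (indicator {0<..} z * (z powr (- \<alpha>) / Gamma (1 - \<alpha>) * exp (- \<xi> * z))) \<partial>lborel)
     = ennreal \<bar>1 / \<xi>\<bar> * (\<integral>\<^sup>+z. ennreal (indicator {0<..} (0 + 1 / \<xi> * z) *
        ((0 + 1 / \<xi> * z) powr (- \<alpha>) / Gamma (1 - \<alpha>) * exp (- \<xi> * (0 + 1 / \<xi> * z)))) \<partial>lborel)"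
    by (rule nn_integral_real_affine) (use assms in auto)
  also have "\<dots> = ennreal (1 / \<xi>) * (\<integral>\<^sup>+z. ennreal (\<xi> powr \<alpha> / Gamma (1 - \<alpha>)) *
        ennreal (indicator {0..} z * z powr (1 - \<alpha> - 1) / exp z) \<partial>lborel)"
  proof (intro arg_cong2[where f="(*)"] nn_integral_cong_AE)
    show "AE z in lborel. ennreal (indicator {0<..} (0 + 1 / \<xi> * z) *
        ((0 + 1 / \<xi> * z) powr (- \<alpha>) / Gamma (1 - \<alpha>) * exp (- \<xi> * (0 + 1 / \<xi> * z)))) =
        ennreal (\<xi> powr \<alpha> / Gamma (1 - \<alpha>)) * ennreal (indicator {0..} z * z powr (1 - \<alpha> - 1) / exp z)"
      using AE_lborel_singleton[of "0::real"]
    proof eventually_elim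
      case (elim z)
      show ?case
      proof (cases "0 < z")
        case True
        have "(1 / \<xi> * z) powr (- \<alpha>) = \<xi> powr \<alpha> * z powr (- \<alpha>)"
          using True assms by (simp add: powr_divide powr_minus field_simps)
        then show ?thesis
          using True assms G by (simp add: exp_minus field_simps flip: ennreal_mult)
      next
        case False
        then have "z < 0" using elim by simp
        then show ?thesis using assms by (auto simp: indicator_def zero_less_divide_iff)
      qed
    qed
  qed (use assms in auto)
  also have "\<dots> = ennreal (1 / \<xi>) * (ennreal (\<xi> powr \<alpha> / Gamma (1 - \<alpha>)) * ennreal (Gamma (1 - \<alpha>)))"
    unfolding Gamma_conv_nn_integral_real[OF diff_gt_0_iff_gt[THEN iffD2, OF \<open>\<alpha> < 1\<close>]]
    by (subst nn_integral_cmult) auto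
  also have "\<dots> = ennreal (1 / \<xi> * (\<xi> powr \<alpha> / Gamma (1 - \<alpha>) * Gamma (1 - \<alpha>)))"
    using assms G by (simp flip: ennreal_mult)
  also have "1 / \<xi> * (\<xi> powr \<alpha> / Gamma (1 - \<alpha>) * Gamma (1 - \<alpha>)) = \<xi> powr (\<alpha> - 1)"
    using assms less_imp_neq[OF G] by (simp add: powr_diff)
  finally show ?thesis .
qed

lemma nn_integral_shifted_power_kernel:
  assumes "0 < \<alpha>" "\<alpha> < 1" "0 < \<xi>"
  shows "(\<integral>\<^sup>+x. ennreal (indicator {0<..} (x - y) * ((x - y) powr (- \<alpha>) / Gamma (1 - \<alpha>) * exp (- \<xi> * x))) \<partial>lborel)
    = ennreal (exp (- \<xi> * y)) * ennreal (\<xi> powr (\<alpha> - 1))"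
proof -
  have G: "0 < Gamma (1 - \<alpha>)" using assms by (intro Gamma_real_pos) auto
  have "(\<integral>\<^sup>+x. ennreal (indicator {0<..} (x - y) * ((x - y) powr (- \<alpha>) / Gamma (1 - \<alpha>) * exp (- \<xi> * x))) \<partial>lborel)
    = ennreal \<bar>1\<bar> * (\<integral>\<^sup>+z. ennreal (indicator {0<..} (y + 1 * z - y) * ((y + 1 * z - y) powr (- \<alpha>) / Gamma (1 - \<alpha>) * exp (- \<xi> * (y + 1 * z)))) \<partial>lborel)"
    by (rule nn_integral_real_affine) auto
  also have "\<dots> = (\<integral>\<^sup>+z. ennreal (exp (- \<xi> * y)) *
      ennreal (indicator {0<..} z * (z powr (- \<alpha>) / Gamma (1 - \<alpha>) * exp (- \<xi> * z))) \<partial>lborel)"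
    using G by (simp add: exp_diff exp_minus ring_distribs field_simps flip: ennreal_mult)
  also have "\<dots> = ennreal (exp (- \<xi> * y)) * ennreal (\<xi> powr (\<alpha> - 1))"
    unfolding nn_integral_power_kernel[OF assms, symmetric] by (rule nn_integral_cmult) measurable
  finally show ?thesis .
qed

text \<open>The fractional integral is a convolution with the power kernel, so Tonelli factors its
  transform. Order 1 fits the formula as \<xi> to the power 0.\<close>

lemma laplace_frac_integral_x:
  assumes v: "half_line_measure (v t)" and \<alpha>: "0 < \<alpha>" "\<alpha> \<le> 1" and "0 < \<xi>"
  shows "laplace (frac_integral_x \<alpha> v t) \<xi> = \<xi> powr (\<alpha> - 1) * laplace (v t) \<xi>"
proof (cases "\<alpha> = 1")
  case True
  then show ?thesis using \<open>0 < \<xi>\<close> by (simp add: frac_integral_x_def)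
next
  case False
  then have "\<alpha> < 1" using \<alpha> by simp
  have G: "0 < Gamma (1 - \<alpha>)" using \<open>\<alpha> < 1\<close> by (intro Gamma_real_pos) auto
  note [measurable_cong] = half_line_measureD(1)[OF v]
  interpret v: finite_measure "v t" using half_line_measureD[OF v] by simp
  interpret P: pair_sigma_finite "v t" lborel
    using v.sigma_finite_measure_axioms sigma_finite_lborel by (auto simp: pair_sigma_finite_def)
  define k where "k x y = ennreal ((x - y) powr (- \<alpha>) / Gamma (1 - \<alpha>)) * indicator {0..<x} y" for x y :: real
  have k: "k x y = ennreal ((x - y) powr (- \<alpha>) / Gamma (1 - \<alpha>)) * (indicator {0<..} (x - y) * indicator {0..} y)" for x y
    by (auto simp: k_def indicator_def)
  have [measurable]: "(\<lambda>(x, y). k x y) \<in> borel_measurable (borel \<Otimes>\<^sub>M borel)"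
    unfolding k by measurable
  have fi: "frac_integral_x \<alpha> v t = density lborel (\<lambda>x. \<integral>\<^sup>+y. k x y \<partial>v t)"
    using False by (simp add: frac_integral_x_def k_def)
  have "laplace (frac_integral_x \<alpha> v t) \<xi>
      = enn2real (\<integral>\<^sup>+x. ennreal (exp (- \<xi> * x)) \<partial>density lborel (\<lambda>x. \<integral>\<^sup>+y. k x y \<partial>v t))"
    unfolding laplace_def fi by (rule integral_eq_nn_integral) auto
  also have "(\<integral>\<^sup>+x. ennreal (exp (- \<xi> * x)) \<partial>density lborel (\<lambda>x. \<integral>\<^sup>+y. k x y \<partial>v t))
      = (\<integral>\<^sup>+x. (\<integral>\<^sup>+y. k x y \<partial>v t) * ennreal (exp (- \<xi> * x)) \<partial>lborel)"
    by (rule nn_integral_density) measurable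
  also have "\<dots> = (\<integral>\<^sup>+x. \<integral>\<^sup>+y. k x y * ennreal (exp (- \<xi> * x)) \<partial>v t \<partial>lborel)"
    by (intro nn_integral_cong nn_integral_multc[symmetric]) measurable
  also have "\<dots> = (\<integral>\<^sup>+y. \<integral>\<^sup>+x. k x y * ennreal (exp (- \<xi> * x)) \<partial>lborel \<partial>v t)"
    by (rule P.Fubini') measurable
  also have "\<dots> = (\<integral>\<^sup>+y. ennreal (\<xi> powr (\<alpha> - 1)) * ennreal (exp (- \<xi> * y)) \<partial>v t)"
  proof (rule nn_integral_cong_AE)
    show "AE y in v t. (\<integral>\<^sup>+x. k x y * ennreal (exp (- \<xi> * x)) \<partial>lborel)
            = ennreal (\<xi> powr (\<alpha> - 1)) * ennreal (exp (- \<xi> * y))"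
      using half_line_measureD(3)[OF v]
    proof eventually_elim
      case (elim y)
      have "(\<integral>\<^sup>+x. k x y * ennreal (exp (- \<xi> * x)) \<partial>lborel)
        = (\<integral>\<^sup>+x. ennreal (indicator {0<..} (x - y) * ((x - y) powr (- \<alpha>) / Gamma (1 - \<alpha>) * exp (- \<xi> * x))) \<partial>lborel)"
        using elim G by (intro nn_integral_cong) (auto simp: k indicator_def simp flip: ennreal_mult)
      then show ?case
        using nn_integral_shifted_power_kernel[OF \<alpha>(1) \<open>\<alpha> < 1\<close> \<open>0 < \<xi>\<close>, of y] by (simp add: mult.commute)
    qed
  qed
  also have "\<dots> = ennreal (\<xi> powr (\<alpha> - 1)) * ennreal (laplace (v t) \<xi>)"
    unfolding laplace_def using half_line_integrable_exp[OF v] \<open>0 < \<xi>\<close>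
    by (subst nn_integral_cmult) (auto simp: nn_integral_eq_integral less_imp_le simp del: mult_minus_left)
  finally show ?thesis
    by (simp add: enn2real_mult laplace_def integral_nonneg_AE)
qed

text \<open>A finite nonnegative iterated integral in one order makes F integrable on the plane, and
  this justifies the Bochner integrals in the other order.\<close>

lemma integral_iterated_nonneg:
  fixes F :: "real \<Rightarrow> real \<Rightarrow> real"
  assumes [measurable]: "case_prod F \<in> borel_measurable (borel \<Otimes>\<^sub>M borel)"
    and nn: "\<And>t s. 0 \<le> F t s"
    and C: "(\<integral>\<^sup>+s. \<integral>\<^sup>+t. ennreal (F t s) \<partial>lborel \<partial>lborel) = ennreal C" "0 \<le> C"
  shows "(LINT t|lborel. LINT s|lborel. F t s) = C"
proof -
  have eq: "(\<integral>\<^sup>+p. ennreal (case_prod F p) \<partial>(lborel \<Otimes>\<^sub>M lborel)) = ennreal C"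
    using C by (subst lborel_pair.nn_integral_snd[symmetric]) (auto simp: case_prod_beta)
  have "has_bochner_integral (lborel \<Otimes>\<^sub>M lborel) (case_prod F) C"
    by (rule has_bochner_integral_nn_integral) (use nn eq C in auto)
  then show ?thesis
    using lborel_pair.integral_fst'[of "case_prod F"] by (simp add: has_bochner_integral_iff)
qed

section \<open>Action of the operators on exponential test functions\<close>

definition laplace2 :: "(real \<Rightarrow> real measure) \<Rightarrow> real \<Rightarrow> real \<Rightarrow> real" where
  "laplace2 v \<xi> \<eta> = (LINT t:{0<..}|lborel. exp (- \<eta> * t) * laplace (v t) \<xi>)"

lemma laplace_nonneg: "0 \<le> laplace \<mu> \<xi>"
  by (simp add: laplace_def)

lemma integral_exp_split: "(LINT x|\<mu>. exp (- \<xi> * x - \<eta> * t)) = exp (- \<eta> * t) * laplace \<mu> \<xi>"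
  unfolding laplace_def by (simp add: exp_diff exp_minus field_simps flip: Bochner_Integration.integral_mult_right_zero)

lemma deriv_exp_x: "deriv (\<lambda>y. exp (- \<xi> * y - \<eta> * t)) x = - \<xi> * exp (- \<xi> * x - \<eta> * t)"
  for \<xi> \<eta> t x :: real
  by (rule DERIV_imp_deriv) (auto intro!: derivative_eq_intros)

lemma deriv_exp_t: "deriv (\<lambda>t. exp (- \<xi> * x - \<eta> * t)) t = - \<eta> * exp (- \<xi> * x - \<eta> * t)"
  for \<xi> \<eta> t x :: real
  by (rule DERIV_imp_deriv) (auto intro!: derivative_eq_intros)

text \<open>The assumptions are phrased through transforms and ask only for what the law of the
  process and an arbitrary solution both provide, so that one criterion serves existence and
  uniqueness.\<close>

context
  fixes v :: "real \<Rightarrow> real measure"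
  assumes v: "\<And>t. 0 \<le> t \<Longrightarrow> half_line_measure (v t)"
    and v0: "v 0 = return borel 0"
    and cont: "\<And>\<xi>. 0 < \<xi> \<Longrightarrow> continuous_on {0..} (\<lambda>t. laplace (v t) \<xi>)"
    and int: "\<And>\<xi> \<eta>. 0 < \<xi> \<Longrightarrow> 0 < \<eta> \<Longrightarrow> set_integrable lborel {0<..} (\<lambda>t. exp (- \<eta> * t) * laplace (v t) \<xi>)"
begin

lemma pairing_shift_exp:
  assumes "0 < \<xi>" "0 < \<eta>"
  shows "pairing (shift j v) (\<lambda>x t. exp (- \<xi> * x - \<eta> * t)) = exp (- \<xi> * real j) * laplace2 v \<xi> \<eta>"
proof -
  have "pairing (shift j v) (\<lambda>x t. exp (- \<xi> * x - \<eta> * t))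
      = (LINT t:{0<..}|lborel. exp (- \<xi> * real j) * (exp (- \<eta> * t) * laplace (v t) \<xi>))"
    unfolding pairing_def integral_exp_split
  proof (rule set_lebesgue_integral_cong, safe)
    fix t :: real assume "0 < t"
    then have [measurable_cong]: "sets (v t) = sets borel" using half_line_measureD[OF v] by simp
    have "laplace (shift j v t) \<xi> = (LINT x|v t. exp (- \<xi> * (x + real j)))"
      unfolding laplace_def shift_def by (rule integral_distr) measurable
    also have "\<dots> = exp (- \<xi> * real j) * laplace (v t) \<xi>"
      unfolding laplace_def by (simp add: ring_distribs exp_diff exp_minus field_simps
          flip: Bochner_Integration.integral_mult_right_zero)
    finally show "exp (- \<eta> * t) * laplace (shift j v t) \<xi> = exp (- \<xi> * real j) * (exp (- \<eta> * t) * laplace (v t) \<xi>)"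
      by simp
  qed simp
  then show ?thesis by (simp add: laplace2_def)
qed

text \<open>A shift by j multiplies the transform by \<open>exp (- \<xi> * real j)\<close>. The sum
  is therefore the binomial series at \<open>- exp (- \<xi>)\<close>, of modulus below 1 because
  \<xi> > 0.\<close>

lemma frac_difference_exp:
  assumes "0 < \<xi>" "0 < \<eta>"
  shows "frac_difference \<gamma> v (\<lambda>x t. exp (- \<xi> * x - \<eta> * t)) = (1 - exp (- \<xi>)) powr \<gamma> * laplace2 v \<xi> \<eta>"
proof -
  have "(\<lambda>n. (\<gamma> gchoose n) * (- exp (- \<xi>)) ^ n) sums (1 + - exp (- \<xi>)) powr \<gamma>"
    by (rule gen_binomial_real) (use assms in auto)
  then have "(\<lambda>n. (\<gamma> gchoose n) * (- exp (- \<xi>)) ^ n * laplace2 v \<xi> \<eta>) sums ((1 + - exp (- \<xi>)) powr \<gamma> * laplace2 v \<xi> \<eta>)"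
    by (rule sums_mult2)
  moreover have "(\<gamma> gchoose n) * (- exp (- \<xi>)) ^ n * laplace2 v \<xi> \<eta>
      = (- 1) ^ n * (\<gamma> gchoose n) * pairing (shift n v) (\<lambda>x t. exp (- \<xi> * x - \<eta> * t))" for n
  proof -
    have "(- exp (- \<xi>)) ^ n = (- 1) ^ n * exp (- \<xi> * real n)"
      by (subst power_minus) (simp add: exp_of_nat_mult[symmetric] mult.commute)
    then show ?thesis unfolding pairing_shift_exp[OF assms] by simp
  qed
  ultimately show ?thesis
    unfolding frac_difference_def by (simp add: sums_iff)
qed

lemma riemann_liouville_x_exp:
  assumes "0 < \<xi>" "0 < \<eta>" "0 < \<alpha>" "\<alpha> \<le> 1"
  shows "riemann_liouville_x \<alpha> v (\<lambda>x t. exp (- \<xi> * x - \<eta> * t)) = \<xi> powr \<alpha> * laplace2 v \<xi> \<eta>"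
proof -
  have "pairing (frac_integral_x \<alpha> v) (\<lambda>x t. deriv (\<lambda>y. exp (- \<xi> * y - \<eta> * t)) x)
     = (LINT t:{0<..}|lborel. (- \<xi> * \<xi> powr (\<alpha> - 1)) * (exp (- \<eta> * t) * laplace (v t) \<xi>))"
    unfolding pairing_def deriv_exp_x Bochner_Integration.integral_mult_right_zero integral_exp_split
    by (rule set_lebesgue_integral_cong) (use assms v in \<open>auto simp: laplace_frac_integral_x\<close>)
  also have "\<dots> = - \<xi> * \<xi> powr (\<alpha> - 1) * laplace2 v \<xi> \<eta>"
    unfolding laplace2_def by (rule set_integral_mult_right)
  finally show ?thesis
    using assms by (simp add: riemann_liouville_x_def powr_diff)
qed

lemma laplace_measurable:
  assumes "0 < \<xi>"
  shows "(\<lambda>t. indicator {0<..} t * laplace (v t) \<xi>) \<in> borel_measurable borel"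
proof -
  have "(\<lambda>t. laplace (v t) \<xi>) \<in> borel_measurable (restrict_space borel {0<..})"
    by (intro borel_measurable_continuous_on_restrict continuous_on_subset[OF cont]) (use assms in auto)
  then show ?thesis by (simp add: borel_measurable_restrict_space_iff)
qed

lemma frac_integral_exp:
  assumes "0 < \<xi>" "0 < \<eta>" "0 < \<beta>" "\<beta> \<le> 1"
  shows "(LINT t:{0<..}|lborel. exp (- \<eta> * t) * frac_integral \<beta> (\<lambda>s. laplace (v s) \<xi>) t)
    = \<eta> powr (\<beta> - 1) * laplace2 v \<xi> \<eta>"
proof (cases "\<beta> = 1")
  case True
  then show ?thesis using assms by (simp add: frac_integral_def laplace2_def)
next
  case False
  then have \<beta>: "0 < \<beta>" "\<beta> < 1" using assms by auto
  have G: "0 < Gamma (1 - \<beta>)" using \<beta> by (intro Gamma_real_pos) auto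
  note [measurable] = laplace_measurable[OF assms(1)]
  \<comment> \<open>Extension by zero makes W measurable on the whole line and turns the triangle 0
    < s < t into a convolution over the plane, where Tonelli applies.\<close>
  define W where "W s = indicator {0<..} s * laplace (v s) \<xi>" for s
  have [measurable]: "W \<in> borel_measurable borel" unfolding W_def by measurable
  have W: "0 \<le> W s" for s by (simp add: W_def laplace_nonneg)
  let ?F = "\<lambda>t s. W s * (indicator {0<..} (t - s) * ((t - s) powr (- \<beta>) / Gamma (1 - \<beta>) * exp (- \<eta> * t)))"
  have "(LINT t:{0<..}|lborel. exp (- \<eta> * t) * frac_integral \<beta> (\<lambda>s. laplace (v s) \<xi>) t)
    = (LINT t|lborel. LINT s|lborel. ?F t s)"
    unfolding set_lebesgue_integral_def
  proof (rule Bochner_Integration.integral_cong[OF refl])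
    fix t :: real
    show "indicator {0<..} t *\<^sub>R (exp (- \<eta> * t) * frac_integral \<beta> (\<lambda>s. laplace (v s) \<xi>) t) = (LINT s|lborel. ?F t s)"
    proof (cases "0 < t")
      case True
      have "indicator {0<..} t *\<^sub>R (exp (- \<eta> * t) * frac_integral \<beta> (\<lambda>s. laplace (v s) \<xi>) t)
        = (exp (- \<eta> * t) / Gamma (1 - \<beta>)) * (LINT s|lborel. indicator {0<..<t} s * (laplace (v s) \<xi> / (t - s) powr \<beta>))"
        using True False by (simp add: frac_integral_def set_lebesgue_integral_def)
      also have "\<dots> = (LINT s|lborel. (exp (- \<eta> * t) / Gamma (1 - \<beta>)) * (indicator {0<..<t} s * (laplace (v s) \<xi> / (t - s) powr \<beta>)))"
        by (rule Bochner_Integration.integral_mult_right_zero[symmetric])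
      also have "\<dots> = (LINT s|lborel. ?F t s)"
        by (rule Bochner_Integration.integral_cong)
           (auto simp: W_def indicator_def powr_minus field_simps)
      finally show ?thesis .
    next
      case False
      then have "?F t s = 0" for s by (auto simp: W_def indicator_def)
      then have "(LINT s|lborel. ?F t s) = 0" by (simp only: Bochner_Integration.integral_zero)
      then show ?thesis using False by (simp only:) simp
    qed
  qed
  also have "\<dots> = \<eta> powr (\<beta> - 1) * laplace2 v \<xi> \<eta>"
  proof (rule integral_iterated_nonneg)
    show "0 \<le> ?F t s" for t s using W[of s] G by (auto simp: indicator_def)
    have i: "integrable lborel (\<lambda>s. W s * exp (- \<eta> * s))"
      using int[OF assms(1,2)] by (simp add: set_integrable_def W_def mult_ac)
    have l2: "laplace2 v \<xi> \<eta> = (LINT s|lborel. W s * exp (- \<eta> * s))"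
      by (simp add: laplace2_def set_lebesgue_integral_def W_def mult_ac)
    have "(\<integral>\<^sup>+s. \<integral>\<^sup>+t. ennreal (?F t s) \<partial>lborel \<partial>lborel)
       = (\<integral>\<^sup>+s. ennreal (\<eta> powr (\<beta> - 1)) * ennreal (W s * exp (- \<eta> * s)) \<partial>lborel)"
    proof (rule nn_integral_cong)
      fix s
      have "(\<integral>\<^sup>+t. ennreal (?F t s) \<partial>lborel) = (\<integral>\<^sup>+t. ennreal (W s) *
         ennreal (indicator {0<..} (t - s) * ((t - s) powr (- \<beta>) / Gamma (1 - \<beta>) * exp (- \<eta> * t))) \<partial>lborel)"
        using W G by (intro nn_integral_cong ennreal_mult) auto
      also have "\<dots> = ennreal (W s) * (ennreal (exp (- \<eta> * s)) * ennreal (\<eta> powr (\<beta> - 1)))"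
        unfolding nn_integral_shifted_power_kernel[OF \<beta> assms(2), symmetric]
        by (rule nn_integral_cmult) measurable
      finally show "(\<integral>\<^sup>+t. ennreal (?F t s) \<partial>lborel) = ennreal (\<eta> powr (\<beta> - 1)) * ennreal (W s * exp (- \<eta> * s))"
        using W[of s] by (simp add: ennreal_mult mult_ac)
    qed
    also have "\<dots> = ennreal (\<eta> powr (\<beta> - 1)) * ennreal (laplace2 v \<xi> \<eta>)"
      unfolding l2 using i W
      by (subst nn_integral_cmult) (auto simp: nn_integral_eq_integral simp del: mult_minus_left)
    also have "\<dots> = ennreal (\<eta> powr (\<beta> - 1) * laplace2 v \<xi> \<eta>)"
      using W by (intro ennreal_mult[symmetric]) (auto simp: l2)
    finally show "(\<integral>\<^sup>+s. \<integral>\<^sup>+t. ennreal (?F t s) \<partial>lborel \<partial>lborel) = ennreal (\<eta> powr (\<beta> - 1) * laplace2 v \<xi> \<eta>)" .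
    show "0 \<le> \<eta> powr (\<beta> - 1) * laplace2 v \<xi> \<eta>" using W by (auto simp: l2)
  qed measurable
  finally show ?thesis .
qed

lemma riemann_liouville_t_exp:
  assumes "0 < \<xi>" "0 < \<eta>" "0 < \<beta>" "\<beta> \<le> 1"
  shows "riemann_liouville_t \<beta> v (\<lambda>x t. exp (- \<xi> * x - \<eta> * t)) = \<eta> powr \<beta> * laplace2 v \<xi> \<eta>"
proof -
  have "frac_integral \<beta> (\<lambda>s. LINT x|v s. deriv (\<lambda>t. exp (- \<xi> * x - \<eta> * t)) t) t
     = - \<eta> * (exp (- \<eta> * t) * frac_integral \<beta> (\<lambda>s. laplace (v s) \<xi>) t)" for t
    unfolding deriv_exp_t Bochner_Integration.integral_mult_right_zero integral_exp_split
    by (auto simp: frac_integral_def mult_ac set_lebesgue_integral_def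
        simp flip: Bochner_Integration.integral_mult_right_zero intro!: Bochner_Integration.integral_cong)
  then have "riemann_liouville_t \<beta> v (\<lambda>x t. exp (- \<xi> * x - \<eta> * t)) =
     - (LINT t:{0<..}|lborel. - \<eta> * (exp (- \<eta> * t) * frac_integral \<beta> (\<lambda>s. laplace (v s) \<xi>) t))"
    by (simp add: riemann_liouville_t_def)
  also have "\<dots> = \<eta> * (\<eta> powr (\<beta> - 1) * laplace2 v \<xi> \<eta>)"
    unfolding set_integral_mult_right frac_integral_exp[OF assms] by simp
  finally show ?thesis using assms by (simp add: powr_diff)
qed

text \<open>As the initial law is the point mass at 0, the subtracted term is the transform of the
  kernel alone. For \<beta> = 1 it is the value 1 of the test function at the origin, again
  \<open>\<eta> powr (\<beta> - 1)\<close>.\<close>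

lemma dzhrbashyan_caputo_t_exp:
  assumes "0 < \<xi>" "0 < \<eta>" "0 < \<beta>" "\<beta> \<le> 1"
  shows "dzhrbashyan_caputo_t \<beta> v (\<lambda>x t. exp (- \<xi> * x - \<eta> * t)) = \<eta> powr \<beta> * laplace2 v \<xi> \<eta> - \<eta> powr (\<beta> - 1)"
proof (cases "\<beta> = 1")
  case True
  show ?thesis
    unfolding dzhrbashyan_caputo_t_def riemann_liouville_t_exp[OF assms]
    using True assms by (simp add: v0 integral_return)
next
  case False
  then have \<beta>: "0 < \<beta>" "\<beta> < 1" using assms by auto
  have G: "0 < Gamma (1 - \<beta>)" using \<beta> by (intro Gamma_real_pos) auto
  have "(LINT t:{0<..}|lborel. t powr (- \<beta>) / Gamma (1 - \<beta>) * (LINT x|v 0. exp (- \<xi> * x - \<eta> * t)))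
    = (LINT t|lborel. indicator {0<..} t * (t powr (- \<beta>) / Gamma (1 - \<beta>) * exp (- \<eta> * t)))"
    by (simp add: v0 integral_return set_lebesgue_integral_def)
  also have "\<dots> = enn2real (\<integral>\<^sup>+t. ennreal (indicator {0<..} t * (t powr (- \<beta>) / Gamma (1 - \<beta>) * exp (- \<eta> * t))) \<partial>lborel)"
    using G by (intro integral_eq_nn_integral) (auto simp: indicator_def)
  also have "\<dots> = \<eta> powr (\<beta> - 1)"
    by (simp only: nn_integral_power_kernel[OF \<beta> assms(2)]) simp
  finally show ?thesis
    unfolding dzhrbashyan_caputo_t_def riemann_liouville_t_exp[OF assms] using False by simp
qed

text \<open>Each operator multiplies the double transform by a factor, so only the initial term
  remains on the right.\<close>

lemma satisfies_equation_iff: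
  assumes "0 < \<alpha>" "\<alpha> \<le> 1" "0 < \<beta>" "\<beta> \<le> 1"
  shows "satisfies_equation \<alpha> \<beta> \<gamma> a lam v \<longleftrightarrow> (\<forall>\<xi>>0. \<forall>\<eta>>0.
    (\<eta> powr \<beta> + (a powr \<alpha> * \<xi> powr \<alpha> + lam powr \<gamma> * (1 - exp (- \<xi>)) powr \<gamma>)) *
      (LINT t:{0<..}|lborel. exp (- \<eta> * t) * laplace (v t) \<xi>) = \<eta> powr (\<beta> - 1))"
proof -
  have "dzhrbashyan_caputo_t \<beta> v (\<lambda>x t. exp (- \<xi> * x - \<eta> * t))
      + a powr \<alpha> * riemann_liouville_x \<alpha> v (\<lambda>x t. exp (- \<xi> * x - \<eta> * t))
      + lam powr \<gamma> * frac_difference \<gamma> v (\<lambda>x t. exp (- \<xi> * x - \<eta> * t)) =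
    (\<eta> powr \<beta> + (a powr \<alpha> * \<xi> powr \<alpha> + lam powr \<gamma> * (1 - exp (- \<xi>)) powr \<gamma>)) * laplace2 v \<xi> \<eta>
      - \<eta> powr (\<beta> - 1)" if "0 < \<xi>" "0 < \<eta>" for \<xi> \<eta>
    unfolding dzhrbashyan_caputo_t_exp[OF that assms(3,4)] riemann_liouville_x_exp[OF that assms(1,2)]
      frac_difference_exp[OF that]
    by (simp add: algebra_simps)
  then show ?thesis
    unfolding satisfies_equation_def Let_def laplace2_def[symmetric] by (auto simp: algebra_simps)
qed

end

section \<open>The law of the drifted process\<close>

locale drifted_fractional_process = prob_space M for M :: "'a measure" +
  fixes \<alpha> \<beta> \<gamma> a lam :: real
    and N :: "real \<Rightarrow> 'a \<Rightarrow> nat"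
    and Ag Aa L :: "real \<Rightarrow> 'a \<Rightarrow> real"
  assumes \<alpha>: "0 < \<alpha>" "\<alpha> \<le> 1" and \<beta>: "0 < \<beta>" "\<beta> \<le> 1" and \<gamma>: "0 < \<gamma>" "\<gamma> \<le> 1"
    and a: "0 \<le> a" and lam: "0 < lam"
    and N: "poisson_process M lam N"
    and Ag: "stable_subordinator M \<gamma> Ag"
    and Aa: "stable_subordinator M \<alpha> Aa"
    and L: "inverse_stable_subordinator M \<beta> L"
    and indep: "indep_processes M [\<lambda>t \<omega>. real (N t \<omega>), Ag, Aa, L]"
begin

lemma increasing_N: "increasing_process M (\<lambda>t \<omega>. real (N t \<omega>))"
  using N by (auto simp: poisson_process_def subordinator_def increasing_process_def)

lemmas Ag_props = stable_subordinatorD[OF Ag prob_space_axioms \<gamma>]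
lemmas Aa_props = stable_subordinatorD[OF Aa prob_space_axioms \<alpha>]
lemmas L_measurable = inverse_subordinator_measurable[OF prob_space_axioms L \<beta>]
lemmas L_nonneg = inverse_subordinator_nonneg[OF prob_space_axioms L \<beta>]

text \<open>Frozen at negative times, the processes are jointly measurable on the whole real line.
  They agree with the originals at nonnegative times, the only ones that occur in the
  process.\<close>

definition N' where "N' s \<omega> = N (max 0 s) \<omega>"
definition Ag' where "Ag' s \<omega> = Ag (max 0 s) \<omega>"
definition Aa' where "Aa' s \<omega> = Aa (max 0 s) \<omega>"

lemma measurable_Ag'[measurable]: "(\<lambda>(s, \<omega>). Ag' s \<omega>) \<in> borel_measurable (borel \<Otimes>\<^sub>M M)"
  unfolding Ag'_def by (rule measurable_increasing_process[OF Ag_props(1)])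

lemma measurable_Aa'[measurable]: "(\<lambda>(s, \<omega>). Aa' s \<omega>) \<in> borel_measurable (borel \<Otimes>\<^sub>M M)"
  unfolding Aa'_def by (rule measurable_increasing_process[OF Aa_props(1)])

lemma measurable_real_imp_measurable_nat:
  assumes "(\<lambda>x. real (f x)) \<in> borel_measurable A"
  shows "f \<in> A \<rightarrow>\<^sub>M count_space UNIV"
proof -
  have "(\<lambda>x. nat \<lfloor>real (f x)\<rfloor>) \<in> A \<rightarrow>\<^sub>M count_space UNIV" using assms by measurable
  then show ?thesis by simp
qed

lemma measurable_N'[measurable]: "(\<lambda>(s, \<omega>). N' s \<omega>) \<in> borel \<Otimes>\<^sub>M M \<rightarrow>\<^sub>M count_space UNIV"
proof (rule measurable_real_imp_measurable_nat)
  show "(\<lambda>x. real (case x of (s, \<omega>) \<Rightarrow> N' s \<omega>)) \<in> borel_measurable (borel \<Otimes>\<^sub>M M)"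
    using measurable_increasing_process[OF increasing_N] by (simp add: N'_def split_beta')
qed

lemma Ag'_nonneg: "\<omega> \<in> space M \<Longrightarrow> 0 \<le> Ag' s \<omega>"
  using increasing_process_nonneg[OF Ag_props(1)] by (simp add: Ag'_def)

lemma Aa'_nonneg: "\<omega> \<in> space M \<Longrightarrow> 0 \<le> Aa' s \<omega>"
  using increasing_process_nonneg[OF Aa_props(1)] by (simp add: Aa'_def)

definition X where "X = drifted_process a N Ag Aa L"

lemma X_eq:
  assumes "0 \<le> t" "\<omega> \<in> space M"
  shows "X t \<omega> = real (N' (Ag' (L t \<omega>) \<omega>) \<omega>) + a * Aa' (L t \<omega>) \<omega>"
  using L_nonneg[OF assms] increasing_process_nonneg[OF Ag_props(1) assms(2), of "L t \<omega>"]
  by (simp add: X_def drifted_process_def time_change_def N'_def Ag'_def Aa'_def)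

lemma X_measurable[measurable]:
  assumes "0 \<le> t" shows "X t \<in> borel_measurable M"
proof -
  note [measurable] = L_measurable[OF assms]
  have "(\<lambda>\<omega>. real (N' (Ag' (L t \<omega>) \<omega>) \<omega>) + a * Aa' (L t \<omega>) \<omega>) \<in> borel_measurable M"
    by measurable
  then show ?thesis by (subst measurable_cong[OF X_eq[OF assms]])
qed

lemma X_nonneg: "0 \<le> t \<Longrightarrow> \<omega> \<in> space M \<Longrightarrow> 0 \<le> X t \<omega>"
  by (simp add: X_eq a Aa'_nonneg)

section \<open>Decoupling of the four processes\<close>

definition poisson_weight where "poisson_weight n y = (lam * y) ^ n / fact n * exp (- (lam * y))"

text \<open>For s \<ge> 0 this is the probability of \<open>N (Ag s) = n\<close> for independent N
  and \<open>Ag\<close>, kept in \<open>ennreal\<close> so that sums and integrals may be exchanged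
  freely.\<close>

definition count_prob :: "nat \<Rightarrow> real \<Rightarrow> ennreal" where
  "count_prob n s = (\<integral>\<^sup>+\<omega>. ennreal (poisson_weight n (Ag' s \<omega>)) \<partial>M)"

lemma poisson_weight_measurable[measurable]: "poisson_weight n \<in> borel_measurable borel"
  unfolding poisson_weight_def by measurable

lemma poisson_weight_nonneg: "0 \<le> y \<Longrightarrow> 0 \<le> poisson_weight n y"
  using lam by (simp add: poisson_weight_def)

lemma count_prob_measurable[measurable]: "count_prob n \<in> borel_measurable borel"
  unfolding count_prob_def by measurable

lemma nn_integral_poisson:
  assumes "0 \<le> y"
  shows "(\<integral>\<^sup>+\<omega>. g (N y \<omega>) \<partial>M) = (\<Sum>n. ennreal (poisson_weight n y) * g n)"
\<comment> \<open>The Poisson law is postulated at positive times only. At time 0 the count is 0,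
  and \<open>0 ^ 0 = 1\<close> makes \<open>poisson_weight n 0\<close> the point mass at n =
  0.\<close>
proof (cases "y = 0")
  case True
  have "N 0 \<omega> = 0" if "\<omega> \<in> space M" for \<omega>
    using increasing_N that by (simp add: increasing_process_def)
  then have "(\<integral>\<^sup>+\<omega>. g (N y \<omega>) \<partial>M) = (\<integral>\<^sup>+\<omega>. g 0 \<partial>M)"
    using True by (intro nn_integral_cong) auto
  also have "\<dots> = g 0" by (simp add: emeasure_space_1)
  also have "\<dots> = (\<Sum>n. ennreal (poisson_weight n y) * g n)"
    using True by (subst suminf_finite[of "{0}"]) (auto simp: poisson_weight_def)
  finally show ?thesis .
next
  case False
  then have y: "0 < y" using assms by simp
  then have r: "0 < lam * y" using lam by simp
  have [measurable]: "N y \<in> M \<rightarrow>\<^sub>M count_space UNIV"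
    by (rule measurable_real_imp_measurable_nat) (use increasing_N y in \<open>auto simp: increasing_process_def\<close>)
  have "(\<integral>\<^sup>+\<omega>. g (N y \<omega>) \<partial>M) = (\<integral>\<^sup>+n. g n \<partial>distr M (count_space UNIV) (N y))"
    by (subst nn_integral_distr) auto
  also have "\<dots> = (\<integral>\<^sup>+n. g n \<partial>measure_pmf (poisson_pmf (lam * y)))"
    using N y by (simp add: poisson_process_def)
  also have "\<dots> = (\<integral>\<^sup>+n. ennreal (pmf (poisson_pmf (lam * y)) n) * g n \<partial>count_space UNIV)"
    by (rule nn_integral_measure_pmf)
  also have "\<dots> = (\<Sum>n. ennreal (pmf (poisson_pmf (lam * y)) n) * g n)"
    by (rule nn_integral_count_space_nat)
  finally show ?thesis using r by (simp add: poisson_weight_def)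
qed

text \<open>Once the outcomes are decoupled, N is integrated out first, then \<open>Ag\<close>, then
  \<open>Aa\<close>, and \<open>L t\<close> remains as their common random time. A general
  nonnegative \<psi> covers both the Laplace transform of the law and its values on Borel
  sets.\<close>

lemma nn_integral_subordination:
  assumes "0 \<le> t"
    and \<psi>: "(\<lambda>(n, y, s). \<psi> n y s) \<in> borel_measurable (count_space UNIV \<Otimes>\<^sub>M borel \<Otimes>\<^sub>M borel)"
  shows "(\<integral>\<^sup>+\<omega>. \<psi> (N' (Ag' (L t \<omega>) \<omega>) \<omega>) (Aa' (L t \<omega>) \<omega>) (L t \<omega>) \<partial>M)
    = (\<Sum>n. \<integral>\<^sup>+\<omega>. count_prob n (L t \<omega>) * (\<integral>\<^sup>+\<omega>'. \<psi> n (Aa' (L t \<omega>) \<omega>') (L t \<omega>) \<partial>M) \<partial>M)"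
proof -
  note [measurable] = L_measurable[OF assms(1)]
  \<comment> \<open>The index is capped at 3 so that every \<open>Y i\<close> is one of the four
    processes, hence measurable, as the independence lemma asks for all i.\<close>
  define Y where "Y i = [\<lambda>t \<omega>. real (N t \<omega>), Ag, Aa, L] ! (min i 3)" for i :: nat
  have Y: "Y 0 = (\<lambda>t \<omega>. real (N t \<omega>))" "Y 1 = Ag" "Y 2 = Aa" "Y 3 = L"
    by (simp_all add: Y_def eval_nat_numeral)
  then have "Y (Suc 0) = Ag" by simp
  note Y = Y this
  have Ym: "Y i t \<in> borel_measurable M" if "0 \<le> t" for i t
  proof -
    have "min i 3 = 0 \<or> min i 3 = 1 \<or> min i 3 = 2 \<or> min i 3 = 3" by (auto simp: min_def)
    then show ?thesis
      using that L_measurable increasing_N Ag_props(1) Aa_props(1)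
      unfolding Y_def increasing_process_def by (elim disjE) (auto simp: eval_nat_numeral)
  qed
  let ?P = "\<lambda>i. path_algebra M (Y i)"
  have joint: "(\<lambda>(s :: real, \<omega>). Y i (max 0 s) \<omega>) \<in> borel_measurable (borel \<Otimes>\<^sub>M ?P i)" if "i \<in> {0, 1, 2}" for i
  proof (rule measurable_right_continuous_process)
    show "Y i t \<in> borel_measurable (?P i)" if "0 \<le> t" for t
      by (rule measurable_path_algebra[OF that])
    show "continuous (at_right t) (\<lambda>s. Y i s \<omega>)" if "0 \<le> t" "\<omega> \<in> space (?P i)" for t \<omega>
      using \<open>i \<in> {0, 1, 2}\<close> that increasing_N Ag_props(1) Aa_props(1)
      by (auto simp: increasing_process_def Y)
  qed
  have mL: "(\<lambda>w. L t w) \<in> borel_measurable (?P 3)"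
    using measurable_path_algebra[OF assms(1), of "Y 3"] by (simp add: Y)
  have mG: "(\<lambda>(s, \<omega>). Ag' s \<omega>) \<in> borel_measurable (borel \<Otimes>\<^sub>M ?P 1)"
    using joint[of 1] by (simp add: Y Ag'_def)
  have mA: "(\<lambda>(s, \<omega>). Aa' s \<omega>) \<in> borel_measurable (borel \<Otimes>\<^sub>M ?P 2)"
    using joint[of 2] by (simp add: Y Aa'_def)
  have mN: "(\<lambda>(s, \<omega>). N' s \<omega>) \<in> borel \<Otimes>\<^sub>M ?P 0 \<rightarrow>\<^sub>M count_space UNIV"
    by (rule measurable_real_imp_measurable_nat) (use joint[of 0] in \<open>simp add: Y N'_def split_beta'\<close>)
  define \<Phi> where "\<Phi> w0 w1 w2 w3 = \<psi> (N' (Ag' (L t w3) w1) w0) (Aa' (L t w3) w2) (L t w3)" for w0 w1 w2 w3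
  have m\<Phi>: "(\<lambda>(w0, w1, w2, w3). \<Phi> w0 w1 w2 w3) \<in> borel_measurable (?P 0 \<Otimes>\<^sub>M ?P 1 \<Otimes>\<^sub>M ?P 2 \<Otimes>\<^sub>M ?P 3)"
  proof -
    let ?S = "?P 0 \<Otimes>\<^sub>M ?P 1 \<Otimes>\<^sub>M ?P 2 \<Otimes>\<^sub>M ?P 3"
    have p0: "fst \<in> ?S \<rightarrow>\<^sub>M ?P 0" and p1: "(\<lambda>p. fst (snd p)) \<in> ?S \<rightarrow>\<^sub>M ?P 1"
      and p2: "(\<lambda>p. fst (snd (snd p))) \<in> ?S \<rightarrow>\<^sub>M ?P 2" and p3: "(\<lambda>p. snd (snd (snd p))) \<in> ?S \<rightarrow>\<^sub>M ?P 3"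
      by measurable
    have l: "(\<lambda>p. L t (snd (snd (snd p)))) \<in> borel_measurable ?S"
      by (rule measurable_compose[OF p3 mL])
    have g: "(\<lambda>p. Ag' (L t (snd (snd (snd p)))) (fst (snd p))) \<in> borel_measurable ?S"
      using measurable_compose[OF measurable_Pair[OF l p1] mG] by simp
    have n: "(\<lambda>p. N' (Ag' (L t (snd (snd (snd p)))) (fst (snd p))) (fst p)) \<in> ?S \<rightarrow>\<^sub>M count_space UNIV"
      using measurable_compose[OF measurable_Pair[OF g p0] mN] by simp
    have y: "(\<lambda>p. Aa' (L t (snd (snd (snd p)))) (fst (snd (snd p)))) \<in> borel_measurable ?S"
      using measurable_compose[OF measurable_Pair[OF l p2] mA] by simp
    show ?thesis
      using measurable_compose[OF measurable_Pair[OF n measurable_Pair[OF y l]] \<psi>]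
      by (simp add: \<Phi>_def split_beta')
  qed
  have [measurable]: "(\<lambda>\<omega>. \<psi> n (f \<omega>) (g \<omega>)) \<in> borel_measurable A"
    if "f \<in> borel_measurable A" "g \<in> borel_measurable A" for n f g and A :: "'x measure"
  proof -
    have "(\<lambda>\<omega>. (n, f \<omega>, g \<omega>)) \<in> A \<rightarrow>\<^sub>M count_space UNIV \<Otimes>\<^sub>M (borel :: real measure) \<Otimes>\<^sub>M (borel :: real measure)"
      using that by measurable
    from measurable_compose[OF this \<psi>] show ?thesis by simp
  qed
  have ind: "indep_processes M [Y 0, Y 1, Y 2, Y 3]"
    unfolding Y by (rule indep)
  have "(\<integral>\<^sup>+\<omega>. \<psi> (N' (Ag' (L t \<omega>) \<omega>) \<omega>) (Aa' (L t \<omega>) \<omega>) (L t \<omega>) \<partial>M)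
      = (\<integral>\<^sup>+\<omega>. \<Phi> \<omega> \<omega> \<omega> \<omega> \<partial>M)"
    by (simp add: \<Phi>_def)
  also have "\<dots> = (\<integral>\<^sup>+w3. \<integral>\<^sup>+w2. \<integral>\<^sup>+w1. \<integral>\<^sup>+w0. \<Phi> w0 w1 w2 w3 \<partial>M \<partial>M \<partial>M \<partial>M)"
    by (rule indep_processes_nn_integral[OF prob_space_axioms ind Ym m\<Phi>])
  also have "\<dots> = (\<integral>\<^sup>+w3. \<integral>\<^sup>+w2. \<integral>\<^sup>+w1. (\<Sum>n. ennreal (poisson_weight n (Ag' (L t w3) w1)) * \<psi> n (Aa' (L t w3) w2) (L t w3)) \<partial>M \<partial>M \<partial>M)"
  proof (intro nn_integral_cong)
    fix w3 w2 w1 assume w: "w1 \<in> space M"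
    show "(\<integral>\<^sup>+w0. \<Phi> w0 w1 w2 w3 \<partial>M)
      = (\<Sum>n. ennreal (poisson_weight n (Ag' (L t w3) w1)) * \<psi> n (Aa' (L t w3) w2) (L t w3))"
      using nn_integral_poisson[OF Ag'_nonneg[OF w], of "\<lambda>n. \<psi> n (Aa' (L t w3) w2) (L t w3)" "L t w3"]
        Ag'_nonneg[OF w, of "L t w3"]
      by (simp add: \<Phi>_def N'_def)
  qed
  also have "\<dots> = (\<integral>\<^sup>+w3. \<integral>\<^sup>+w2. (\<Sum>n. count_prob n (L t w3) * \<psi> n (Aa' (L t w3) w2) (L t w3)) \<partial>M \<partial>M)"
    by (intro nn_integral_cong, subst nn_integral_suminf) (auto simp: count_prob_def nn_integral_multc)
  also have "\<dots> = (\<integral>\<^sup>+w3. (\<Sum>n. count_prob n (L t w3) * (\<integral>\<^sup>+w2. \<psi> n (Aa' (L t w3) w2) (L t w3) \<partial>M)) \<partial>M)"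
    by (intro nn_integral_cong, subst nn_integral_suminf) (auto simp: nn_integral_cmult)
  also have "\<dots> = (\<Sum>n. \<integral>\<^sup>+w3. count_prob n (L t w3) * (\<integral>\<^sup>+w2. \<psi> n (Aa' (L t w3) w2) (L t w3) \<partial>M) \<partial>M)"
    by (rule nn_integral_suminf) measurable
  finally show ?thesis .
qed

section \<open>Laplace transform of the law\<close>

lemma laplace_Aa:
  assumes "0 \<le> s" "0 \<le> c"
  shows "(\<integral>\<^sup>+\<omega>. ennreal (exp (- c * Aa' s \<omega>)) \<partial>M) = ennreal (exp (- s * c powr \<alpha>))"
proof -
  have "integrable M (\<lambda>\<omega>. exp (- c * Aa' s \<omega>))"
    by (rule integrable_const_bound[where B=1]) (use assms Aa'_nonneg in auto)
  then show ?thesis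
    using Aa_props(2)[OF assms] assms by (subst nn_integral_eq_integral) (auto simp: Aa'_def)
qed

lemma laplace_Ag:
  assumes "0 \<le> s" "0 \<le> c"
  shows "(\<integral>\<^sup>+\<omega>. ennreal (exp (- c * Ag' s \<omega>)) \<partial>M) = ennreal (exp (- s * c powr \<gamma>))"
proof -
  have "integrable M (\<lambda>\<omega>. exp (- c * Ag' s \<omega>))"
    by (rule integrable_const_bound[where B=1]) (use assms Ag'_nonneg in auto)
  then show ?thesis
    using Ag_props(2)[OF assms] assms by (subst nn_integral_eq_integral) (auto simp: Ag'_def)
qed

lemma half_line_distr:
  assumes "f \<in> borel_measurable M" "\<And>\<omega>. \<omega> \<in> space M \<Longrightarrow> 0 \<le> f \<omega>"
  shows "half_line_measure (distr M borel f)"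
proof (rule half_line_measureI)
  show "finite_measure (distr M borel f)"
    by (rule finite_measure_distr) (rule assms)
  show "AE x in distr M borel f. 0 \<le> x"
    using assms by (subst AE_distr_iff) auto
qed simp

lemma laplace_distr:
  assumes "f \<in> borel_measurable M"
  shows "laplace (distr M borel f) \<xi> = (LINT \<omega>|M. exp (- \<xi> * f \<omega>))"
  unfolding laplace_def using assms by (subst integral_distr) auto

text \<open>Self-similarity of the stable subordinator, read off from the transforms. For a = 0 both
  sides are the point mass at 0.\<close>

lemma distr_scaled_Aa:
  assumes "0 \<le> s"
  shows "distr M borel (\<lambda>\<omega>. a * Aa' s \<omega>) = distr M borel (Aa (a powr \<alpha> * s))"
proof (rule laplace_unique)
  have m: "Aa r \<in> borel_measurable M" if "0 \<le> r" for r
    using Aa_props(1) that by (simp add: increasing_process_def)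
  note [measurable] = m[OF assms]
  have r: "0 \<le> a powr \<alpha> * s" using assms by simp
  show "half_line_measure (distr M borel (\<lambda>\<omega>. a * Aa' s \<omega>))"
    by (rule half_line_distr) (use a Aa'_nonneg in auto)
  show "half_line_measure (distr M borel (Aa (a powr \<alpha> * s)))"
    by (rule half_line_distr) (use m[OF r] increasing_process_nonneg[OF Aa_props(1)] r in auto)
  fix \<xi> :: real assume "0 < \<xi>"
  have "laplace (distr M borel (\<lambda>\<omega>. a * Aa' s \<omega>)) \<xi> = (LINT \<omega>|M. exp (- (\<xi> * a) * Aa s \<omega>))"
    using assms by (subst laplace_distr) (auto simp: Aa'_def mult.assoc)
  also have "\<dots> = exp (- s * (\<xi> * a) powr \<alpha>)"
    by (rule Aa_props(2)) (use assms a \<open>0 < \<xi>\<close> in auto)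
  also have "\<dots> = exp (- (a powr \<alpha> * s) * \<xi> powr \<alpha>)"
    using a \<open>0 < \<xi>\<close> by (simp add: powr_mult)
  also have "\<dots> = laplace (distr M borel (Aa (a powr \<alpha> * s))) \<xi>"
    using Aa_props(2)[OF r, of \<xi>] \<open>0 < \<xi>\<close> by (subst laplace_distr[OF m[OF r]]) auto
  finally show "laplace (distr M borel (\<lambda>\<omega>. a * Aa' s \<omega>)) \<xi> = laplace (distr M borel (Aa (a powr \<alpha> * s))) \<xi>" .
qed

text \<open>The Laplace exponent in s of \<open>N (Ag s) + a * Aa s\<close>, and at the same time
  the factor by which the spatial part of the equation acts on transforms.\<close>

definition symbol where
  "symbol \<xi> = a powr \<alpha> * \<xi> powr \<alpha> + lam powr \<gamma> * (1 - exp (- \<xi>)) powr \<gamma>"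

lemma symbol_pos: "0 < \<xi> \<Longrightarrow> 0 < symbol \<xi>"
  using lam unfolding symbol_def by (intro add_nonneg_pos mult_pos_pos) auto

text \<open>For fixed y this is the Poisson generating function at \<open>exp (- \<xi>)\<close>,
  namely \<open>exp (- lam * (1 - exp (- \<xi>)) * y)\<close>. Averaging over \<open>Ag s\<close>
  evaluates the transform of the subordinator at \<open>lam * (1 - exp (- \<xi>))\<close>.\<close>

lemma count_prob_generating:
  assumes "0 \<le> s" "0 < \<xi>"
  shows "(\<Sum>n. count_prob n s * ennreal (exp (- \<xi> * real n))) = ennreal (exp (- s * (lam * (1 - exp (- \<xi>))) powr \<gamma>))"
proof -
  have pgf: "(\<Sum>n. ennreal (poisson_weight n y) * ennreal (exp (- \<xi> * real n)))
      = ennreal (exp (- (lam * (1 - exp (- \<xi>))) * y))" if "0 \<le> y" for y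
  proof -
    have "(\<lambda>n. (lam * y * exp (- \<xi>)) ^ n /\<^sub>R fact n) sums exp (lam * y * exp (- \<xi>))"
      by (rule exp_converges)
    then have "(\<lambda>n. exp (- (lam * y)) * ((lam * y * exp (- \<xi>)) ^ n /\<^sub>R fact n)) sums (exp (- (lam * y)) * exp (lam * y * exp (- \<xi>)))"
      by (rule sums_mult)
    moreover have "exp (- (lam * y)) * ((lam * y * exp (- \<xi>)) ^ n /\<^sub>R fact n) = poisson_weight n y * exp (- \<xi> * real n)" for n
    proof -
      have "exp (- \<xi>) ^ n = exp (- \<xi> * real n)" by (simp add: exp_of_nat_mult[symmetric] mult.commute)
      then show ?thesis by (simp add: poisson_weight_def power_mult_distrib divide_inverse mult_ac)
    qed
    moreover have "exp (- (lam * y)) * exp (lam * y * exp (- \<xi>)) = exp (- (lam * (1 - exp (- \<xi>))) * y)"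
      by (simp add: exp_add[symmetric] algebra_simps)
    ultimately have "(\<lambda>n. poisson_weight n y * exp (- \<xi> * real n)) sums exp (- (lam * (1 - exp (- \<xi>))) * y)"
      by (simp only:)
    then have "(\<Sum>n. ennreal (poisson_weight n y * exp (- \<xi> * real n))) = ennreal (exp (- (lam * (1 - exp (- \<xi>))) * y))"
      by (intro suminf_ennreal_eq) (use poisson_weight_nonneg[OF that] in auto)
    then show ?thesis
      using poisson_weight_nonneg[OF that] by (simp add: ennreal_mult)
  qed
  have "(\<Sum>n. count_prob n s * ennreal (exp (- \<xi> * real n)))
     = (\<integral>\<^sup>+\<omega>. (\<Sum>n. ennreal (poisson_weight n (Ag' s \<omega>)) * ennreal (exp (- \<xi> * real n))) \<partial>M)"
    by (subst nn_integral_suminf) (auto simp: count_prob_def nn_integral_multc)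
  also have "\<dots> = (\<integral>\<^sup>+\<omega>. ennreal (exp (- (lam * (1 - exp (- \<xi>))) * Ag' s \<omega>)) \<partial>M)"
    by (intro nn_integral_cong pgf Ag'_nonneg)
  also have "\<dots> = ennreal (exp (- s * (lam * (1 - exp (- \<xi>))) powr \<gamma>))"
    by (rule laplace_Ag) (use assms lam in auto)
  finally show ?thesis .
qed

lemma laplace_X:
  assumes "0 \<le> t" "0 < \<xi>"
  shows "laplace (distr M borel (X t)) \<xi> = (LINT \<omega>|M. exp (- symbol \<xi> * L t \<omega>))"
proof -
  note [measurable] = L_measurable[OF assms(1)] X_measurable[OF assms(1)]
  define \<psi> where "\<psi> n y s = ennreal (exp (- \<xi> * (real n + a * y)))" for n :: nat and y s :: real
  have \<psi>: "(\<lambda>(n, y, s). \<psi> n y s) \<in> borel_measurable (count_space UNIV \<Otimes>\<^sub>M borel \<Otimes>\<^sub>M borel)"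
    unfolding \<psi>_def by measurable
  have inner: "(\<integral>\<^sup>+\<omega>'. \<psi> n (Aa' s \<omega>') s \<partial>M) = ennreal (exp (- \<xi> * real n)) * ennreal (exp (- s * (a powr \<alpha> * \<xi> powr \<alpha>)))"
    if "0 \<le> s" for n s
  proof -
    have "(\<integral>\<^sup>+\<omega>'. \<psi> n (Aa' s \<omega>') s \<partial>M) = (\<integral>\<^sup>+\<omega>'. ennreal (exp (- \<xi> * real n)) * ennreal (exp (- (a * \<xi>) * Aa' s \<omega>')) \<partial>M)"
      unfolding \<psi>_def
      by (intro nn_integral_cong) (simp add: exp_diff exp_minus ring_distribs field_simps exp_add flip: ennreal_mult)
    also have "\<dots> = ennreal (exp (- \<xi> * real n)) * ennreal (exp (- s * (a * \<xi>) powr \<alpha>))"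
      by (subst nn_integral_cmult) (use a assms that laplace_Aa[of s "a * \<xi>"] in auto)
    finally show ?thesis using a assms by (simp add: powr_mult)
  qed
  have "(LINT \<omega>|M. exp (- \<xi> * X t \<omega>)) = enn2real (\<integral>\<^sup>+\<omega>. ennreal (exp (- \<xi> * X t \<omega>)) \<partial>M)"
    by (rule integral_eq_nn_integral) auto
  also have "(\<integral>\<^sup>+\<omega>. ennreal (exp (- \<xi> * X t \<omega>)) \<partial>M) = (\<integral>\<^sup>+\<omega>. \<psi> (N' (Ag' (L t \<omega>) \<omega>) \<omega>) (Aa' (L t \<omega>) \<omega>) (L t \<omega>) \<partial>M)"
    by (intro nn_integral_cong) (simp add: \<psi>_def X_eq[OF assms(1)])
  also have "\<dots> = (\<Sum>n. \<integral>\<^sup>+\<omega>. count_prob n (L t \<omega>) * (\<integral>\<^sup>+\<omega>'. \<psi> n (Aa' (L t \<omega>) \<omega>') (L t \<omega>) \<partial>M) \<partial>M)"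
    by (rule nn_integral_subordination[OF assms(1) \<psi>])
  also have "\<dots> = (\<Sum>n. \<integral>\<^sup>+\<omega>. count_prob n (L t \<omega>) * ennreal (exp (- \<xi> * real n)) * ennreal (exp (- L t \<omega> * (a powr \<alpha> * \<xi> powr \<alpha>))) \<partial>M)"
    by (intro suminf_cong nn_integral_cong) (simp add: inner L_nonneg[OF assms(1)] mult.assoc del: mult_minus_left)
  also have "\<dots> = (\<integral>\<^sup>+\<omega>. (\<Sum>n. count_prob n (L t \<omega>) * ennreal (exp (- \<xi> * real n)) * ennreal (exp (- L t \<omega> * (a powr \<alpha> * \<xi> powr \<alpha>)))) \<partial>M)"
    by (rule nn_integral_suminf[symmetric]) measurable
  also have "\<dots> = (\<integral>\<^sup>+\<omega>. ennreal (exp (- symbol \<xi> * L t \<omega>)) \<partial>M)"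
  proof (rule nn_integral_cong)
    fix \<omega> assume w: "\<omega> \<in> space M"
    have e: "0 \<le> 1 - exp (- \<xi>)" using assms by simp
    have "(\<Sum>n. count_prob n (L t \<omega>) * ennreal (exp (- \<xi> * real n)) * ennreal (exp (- L t \<omega> * (a powr \<alpha> * \<xi> powr \<alpha>))))
      = ennreal (exp (- L t \<omega> * (lam * (1 - exp (- \<xi>))) powr \<gamma>)) * ennreal (exp (- L t \<omega> * (a powr \<alpha> * \<xi> powr \<alpha>)))"
      unfolding ennreal_suminf_multc count_prob_generating[OF L_nonneg[OF assms(1) w] assms(2)] ..
    also have "\<dots> = ennreal (exp (- symbol \<xi> * L t \<omega>))"
    proof -
      have pm: "(lam * (1 - exp (- \<xi>))) powr \<gamma> = lam powr \<gamma> * (1 - exp (- \<xi>)) powr \<gamma>"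
        by (rule powr_mult)
      have "- L t \<omega> * (lam * (1 - exp (- \<xi>))) powr \<gamma> + - L t \<omega> * (a powr \<alpha> * \<xi> powr \<alpha>) = - symbol \<xi> * L t \<omega>"
        unfolding pm symbol_def by (simp add: algebra_simps)
      then show ?thesis by (simp only: exp_add[symmetric] ennreal_mult[symmetric] exp_ge_zero)
    qed
    finally show "(\<Sum>n. count_prob n (L t \<omega>) * ennreal (exp (- \<xi> * real n)) * ennreal (exp (- L t \<omega> * (a powr \<alpha> * \<xi> powr \<alpha>))))
      = ennreal (exp (- symbol \<xi> * L t \<omega>))" .
  qed
  also have "enn2real \<dots> = (LINT \<omega>|M. exp (- symbol \<xi> * L t \<omega>))"
    by (rule integral_eq_nn_integral[symmetric]) auto
  finally show ?thesis by (simp add: laplace_distr)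
qed

section \<open>Derivative series for probabilities and densities\<close>

lemma poisson_weight_le_1:
  assumes "0 \<le> y" shows "poisson_weight n y \<le> 1"
  using pow_times_exp_le[of "lam * y" 1 n] assms lam by (simp add: poisson_weight_def field_simps)

text \<open>Replacing \<open>exp (- (m powr \<gamma>) * s)\<close> by the expectation of
  \<open>exp (- m * Ag s)\<close> makes f a Laplace transform in m. Its k-th derivative brings down
  the k-th power of \<open>- Ag s\<close>, and the factor \<open>(- lam) ^ k / fact k\<close>
  completes this to the Poisson weight at \<open>lam\<close>.\<close>

lemma laplace_composition:
  fixes g :: "real \<Rightarrow> real"
  assumes t: "0 \<le> t" and g[measurable]: "g \<in> borel_measurable borel" "\<And>s. 0 \<le> g s"
    and gi: "integrable M (\<lambda>\<omega>. g (L t \<omega>))"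
    and f: "\<And>m. 0 < m \<Longrightarrow> f m = (LINT \<omega>|M. exp (- (m powr \<gamma>) * L t \<omega>) * g (L t \<omega>))"
  shows "\<And>m j. 0 < m \<Longrightarrow> (deriv ^^ j) f field_differentiable (at m)"
    and "0 \<le> (- lam) ^ k / fact k * (deriv ^^ k) f lam"
    and "ennreal ((- lam) ^ k / fact k * (deriv ^^ k) f lam)
      = (\<integral>\<^sup>+\<omega>. count_prob k (L t \<omega>) * ennreal (g (L t \<omega>)) \<partial>M)"
proof -
  note [measurable] = L_measurable[OF t]
  interpret P: pair_sigma_finite M M
    by (simp add: pair_sigma_finite_def sigma_finite_measure_axioms)
  \<comment> \<open>The first coordinate supplies the random time \<open>L t\<close>, the second the
    path of \<open>Ag\<close>; on the product of two copies of M they are independent by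
    construction.\<close>
  define Y where "Y p = Ag' (L t (fst p)) (snd p)" for p
  define G where "G p = g (L t (fst p))" for p :: "'a \<times> 'a"
  have Y[measurable]: "Y \<in> borel_measurable (M \<Otimes>\<^sub>M M)" and [measurable]: "G \<in> borel_measurable (M \<Otimes>\<^sub>M M)"
    unfolding Y_def G_def by measurable
  have Y0: "0 \<le> Y p" if "p \<in> space (M \<Otimes>\<^sub>M M)" for p
    using that by (auto simp: Y_def space_pair_measure intro: Ag'_nonneg)
  have G0: "0 \<le> G p" for p by (simp add: G_def g)
  have G: "integrable (M \<Otimes>\<^sub>M M) G"
  proof (rule integrableI_bounded)
    have "(\<integral>\<^sup>+p. ennreal (norm (G p)) \<partial>(M \<Otimes>\<^sub>M M)) = (\<integral>\<^sup>+\<omega>. \<integral>\<^sup>+\<omega>'. ennreal (norm (G (\<omega>, \<omega>'))) \<partial>M \<partial>M)"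
      by (rule nn_integral_fst[symmetric]) measurable
    also have "\<dots> = (\<integral>\<^sup>+\<omega>. ennreal (norm (g (L t \<omega>))) \<partial>M)"
      by (simp add: G_def emeasure_space_1)
    also have "\<dots> < \<infinity>" using gi by (simp add: integrable_iff_bounded)
    finally show "(\<integral>\<^sup>+p. ennreal (norm (G p)) \<partial>(M \<Otimes>\<^sub>M M)) < \<infinity>" .
  qed measurable
  have eq: "f m = (LINT p|(M \<Otimes>\<^sub>M M). exp (- m * Y p) * G p)" if m: "0 < m" for m
  proof -
    have int: "integrable (M \<Otimes>\<^sub>M M) (\<lambda>p. exp (- m * Y p) * G p)"
      by (rule Bochner_Integration.integrable_bound[OF G])
         (use m Y0 in \<open>auto simp: abs_mult intro!: mult_left_le_one_le\<close>)
    have "(LINT p|(M \<Otimes>\<^sub>M M). exp (- m * Y p) * G p) = (LINT \<omega>|M. (LINT \<omega>'|M. exp (- m * Y (\<omega>, \<omega>')) * G (\<omega>, \<omega>')))"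
      by (rule P.integral_fst'[OF int, symmetric])
    also have "\<dots> = (LINT \<omega>|M. exp (- (m powr \<gamma>) * L t \<omega>) * g (L t \<omega>))"
    proof (rule Bochner_Integration.integral_cong[OF refl])
      fix \<omega> assume w: "\<omega> \<in> space M"
      show "(LINT \<omega>'|M. exp (- m * Y (\<omega>, \<omega>')) * G (\<omega>, \<omega>')) = exp (- (m powr \<gamma>) * L t \<omega>) * g (L t \<omega>)"
        using Ag_props(2)[of "L t \<omega>" m] L_nonneg[OF t w] m by (simp add: Y_def G_def Ag'_def mult.commute)
    qed
    finally show ?thesis using f[OF m] by simp
  qed
  note hd = higher_deriv_laplace[OF Y Y0 G eq]
  show "(deriv ^^ j) f field_differentiable (at m)" if "0 < m" for m j
    using hd(2)[OF _ _ that] by simp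
  have pw: "(- lam) ^ k / fact k * ((- Y p) ^ k * exp (- lam * Y p) * G p) = poisson_weight k (Y p) * G p" for p
  proof -
    have "(- lam) ^ k * (- Y p) ^ k = (lam * Y p) ^ k" by (simp add: power_mult_distrib[symmetric])
    then show ?thesis by (simp add: poisson_weight_def)
  qed
  have val: "(- lam) ^ k / fact k * (deriv ^^ k) f lam = (LINT p|(M \<Otimes>\<^sub>M M). poisson_weight k (Y p) * G p)"
  proof -
    have "(deriv ^^ k) f lam = (LINT p|(M \<Otimes>\<^sub>M M). (- Y p) ^ k * exp (- lam * Y p) * G p)"
      using hd(1)[OF _ _ lam] by simp
    then show ?thesis unfolding pw[symmetric] by simp
  qed
  have nn: "0 \<le> poisson_weight k (Y p) * G p" if "p \<in> space (M \<Otimes>\<^sub>M M)" for p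
    using poisson_weight_nonneg[OF Y0[OF that]] G0 by simp
  then show "0 \<le> (- lam) ^ k / fact k * (deriv ^^ k) f lam"
    unfolding val by (intro integral_nonneg_AE AE_I2)
  have "integrable (M \<Otimes>\<^sub>M M) (\<lambda>p. poisson_weight k (Y p) * G p)"
    by (rule Bochner_Integration.integrable_bound[OF G])
       (use Y0 poisson_weight_le_1 poisson_weight_nonneg in \<open>auto simp: abs_mult intro!: mult_left_le_one_le\<close>)
  then have "ennreal (LINT p|(M \<Otimes>\<^sub>M M). poisson_weight k (Y p) * G p)
      = (\<integral>\<^sup>+p. ennreal (poisson_weight k (Y p) * G p) \<partial>(M \<Otimes>\<^sub>M M))"
    by (rule nn_integral_eq_integral[symmetric]) (use nn in auto)
  also have "\<dots> = (\<integral>\<^sup>+\<omega>. \<integral>\<^sup>+\<omega>'. ennreal (poisson_weight k (Y (\<omega>, \<omega>')) * G (\<omega>, \<omega>')) \<partial>M \<partial>M)"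
    by (rule nn_integral_fst[symmetric]) measurable
  also have "\<dots> = (\<integral>\<^sup>+\<omega>. \<integral>\<^sup>+\<omega>'. ennreal (poisson_weight k (Ag' (L t \<omega>) \<omega>')) * ennreal (g (L t \<omega>)) \<partial>M \<partial>M)"
    by (intro nn_integral_cong) (simp add: Y_def G_def ennreal_mult poisson_weight_nonneg Ag'_nonneg g)
  also have "\<dots> = (\<integral>\<^sup>+\<omega>. count_prob k (L t \<omega>) * ennreal (g (L t \<omega>)) \<partial>M)"
    by (intro nn_integral_cong) (simp add: nn_integral_multc count_prob_def)
  finally show "ennreal ((- lam) ^ k / fact k * (deriv ^^ k) f lam)
      = (\<integral>\<^sup>+\<omega>. count_prob k (L t \<omega>) * ennreal (g (L t \<omega>)) \<partial>M)"
    unfolding val .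
qed

text \<open>The terms are nonnegative, so convergence may be decided in \<open>ennreal\<close>. The
  weight g k is the probability of a set shifted by k in the measure form, and the density at x - k
  in the density form.\<close>

lemma deriv_series_sumsI:
  fixes g :: "nat \<Rightarrow> real \<Rightarrow> real"
  assumes t: "0 \<le> t" and g: "\<And>k. g k \<in> borel_measurable borel" "\<And>k s. 0 \<le> g k s"
    and gi: "\<And>k. integrable M (\<lambda>\<omega>. g k (L t \<omega>))"
    and f: "\<And>k m. 0 < m \<Longrightarrow> f k m = (LINT \<omega>|M. exp (- (m powr \<gamma>) * L t \<omega>) * g k (L t \<omega>))"
    and p: "(\<Sum>k. \<integral>\<^sup>+\<omega>. count_prob k (L t \<omega>) * ennreal (g k (L t \<omega>)) \<partial>M) = ennreal p" "0 \<le> p"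
  shows "deriv_series_sums lam f p"
proof -
  note lc = laplace_composition[OF t g gi f]
  have "(\<Sum>k. ennreal ((- lam) ^ k / fact k * (deriv ^^ k) (f k) lam)) = ennreal p"
    unfolding p(1)[symmetric]
    by (intro suminf_cong laplace_composition(3)[OF t g(1) g(2) gi f])
  then have "(\<lambda>k. ennreal ((- lam) ^ k / fact k * (deriv ^^ k) (f k) lam)) sums ennreal p"
    by (metis summableI summable_sums)
  then have "(\<lambda>k. (- lam) ^ k / fact k * (deriv ^^ k) (f k) lam) sums p"
    by (subst (asm) sums_ennreal) (use lc(2) p in auto)
  then show ?thesis using lc(1) by (simp add: deriv_series_sums_def)
qed

text \<open>The probability of \<open>real k + Aa (a powr \<alpha> * s)\<close> lying in B, written
  with the extended process so that it is measurable in s on the whole line.\<close>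

definition scaled_prob :: "real set \<Rightarrow> nat \<Rightarrow> real \<Rightarrow> real" where
  "scaled_prob B k s = measure (distr M borel (Aa' (a powr \<alpha> * s))) ((\<lambda>x. x + real k) -` B)"

lemma scaled_prob_nonneg: "0 \<le> scaled_prob B k s"
  by (simp add: scaled_prob_def)

lemma shift_vimage_borel: "B \<in> sets borel \<Longrightarrow> (\<lambda>x. x + c) -` B \<in> sets borel" for c :: real
  using measurable_sets_borel[of "\<lambda>x. x + c" borel B] by simp

lemma Aa'_measurable: "Aa' s \<in> borel_measurable M"
  using Aa_props(1) by (simp add: Aa'_def[abs_def] increasing_process_def)

lemma scaled_prob_ennreal:
  assumes "B \<in> sets borel"
  shows "ennreal (scaled_prob B k s) = (\<integral>\<^sup>+\<omega>. indicator B (real k + Aa' (a powr \<alpha> * s) \<omega>) \<partial>M)"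
proof -
  note [measurable] = shift_vimage_borel[OF assms] Aa'_measurable assms
  interpret D: prob_space "distr M borel (Aa' (a powr \<alpha> * s))"
    by (rule prob_space_distr) measurable
  have "ennreal (scaled_prob B k s) = emeasure (distr M borel (Aa' (a powr \<alpha> * s))) ((\<lambda>x. x + real k) -` B)"
    by (simp add: scaled_prob_def D.emeasure_eq_measure)
  also have "\<dots> = (\<integral>\<^sup>+x. indicator ((\<lambda>x. x + real k) -` B) x \<partial>distr M borel (Aa' (a powr \<alpha> * s)))"
    by simp
  also have "\<dots> = (\<integral>\<^sup>+\<omega>. indicator B (real k + Aa' (a powr \<alpha> * s) \<omega>) \<partial>M)"
    by (subst nn_integral_distr) (auto simp: indicator_def add.commute)
  finally show ?thesis .
qed

lemma scaled_prob_measurable: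
  assumes [measurable]: "B \<in> sets borel"
  shows "scaled_prob B k \<in> borel_measurable borel"
proof -
  have "(\<lambda>s. \<integral>\<^sup>+\<omega>. indicator B (real k + Aa' (a powr \<alpha> * s) \<omega>) \<partial>M) \<in> borel_measurable borel"
    by measurable
  then have "(\<lambda>s. enn2real (ennreal (scaled_prob B k s))) \<in> borel_measurable borel"
    unfolding scaled_prob_ennreal[OF assms] by measurable
  moreover have "enn2real (ennreal (scaled_prob B k s)) = scaled_prob B k s" for s
    by (simp add: scaled_prob_def)
  ultimately show ?thesis by simp
qed

lemma emeasure_X:
  assumes t: "0 \<le> t" and B[measurable]: "B \<in> sets borel"
  shows "emeasure (distr M borel (X t)) B = (\<Sum>k. \<integral>\<^sup>+\<omega>. count_prob k (L t \<omega>) * ennreal (scaled_prob B k (L t \<omega>)) \<partial>M)"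
proof -
  note [measurable] = L_measurable[OF t] X_measurable[OF t]
  define \<psi> where "\<psi> n y s = (indicator B (real n + a * y) :: ennreal)" for n :: nat and y s :: real
  have \<psi>: "(\<lambda>(n, y, s). \<psi> n y s) \<in> borel_measurable (count_space UNIV \<Otimes>\<^sub>M borel \<Otimes>\<^sub>M borel)"
    unfolding \<psi>_def by measurable
  have inner: "(\<integral>\<^sup>+\<omega>'. \<psi> n (Aa' s \<omega>') s \<partial>M) = ennreal (scaled_prob B n s)" if "0 \<le> s" for n s
  proof -
    have r: "0 \<le> a powr \<alpha> * s" using that by simp
    note [measurable] = Aa'_measurable
    have Ar: "Aa' (a powr \<alpha> * s) = Aa (a powr \<alpha> * s)" using r by (simp add: Aa'_def[abs_def])
    have "(\<integral>\<^sup>+\<omega>'. \<psi> n (Aa' s \<omega>') s \<partial>M) = (\<integral>\<^sup>+x. indicator B (real n + x) \<partial>distr M borel (\<lambda>\<omega>. a * Aa' s \<omega>))"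
      by (subst nn_integral_distr) (auto simp: \<psi>_def)
    also have "\<dots> = (\<integral>\<^sup>+x. indicator B (real n + x) \<partial>distr M borel (Aa' (a powr \<alpha> * s)))"
      unfolding distr_scaled_Aa[OF that] Ar ..
    also have "\<dots> = (\<integral>\<^sup>+\<omega>. indicator B (real n + Aa' (a powr \<alpha> * s) \<omega>) \<partial>M)"
      by (subst nn_integral_distr) auto
    finally show ?thesis by (simp add: scaled_prob_ennreal[OF B])
  qed
  have "emeasure (distr M borel (X t)) B = (\<integral>\<^sup>+x. indicator B x \<partial>distr M borel (X t))"
    by simp
  also have "\<dots> = (\<integral>\<^sup>+\<omega>. indicator B (X t \<omega>) \<partial>M)"
    by (subst nn_integral_distr) auto
  also have "\<dots> = (\<integral>\<^sup>+\<omega>. \<psi> (N' (Ag' (L t \<omega>) \<omega>) \<omega>) (Aa' (L t \<omega>) \<omega>) (L t \<omega>) \<partial>M)"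
    by (intro nn_integral_cong) (simp add: \<psi>_def X_eq[OF t])
  also have "\<dots> = (\<Sum>n. \<integral>\<^sup>+\<omega>. count_prob n (L t \<omega>) * (\<integral>\<^sup>+\<omega>'. \<psi> n (Aa' (L t \<omega>) \<omega>') (L t \<omega>) \<partial>M) \<partial>M)"
    by (rule nn_integral_subordination[OF t \<psi>])
  also have "\<dots> = (\<Sum>k. \<integral>\<^sup>+\<omega>. count_prob k (L t \<omega>) * ennreal (scaled_prob B k (L t \<omega>)) \<partial>M)"
    by (intro suminf_cong nn_integral_cong) (simp add: inner L_nonneg[OF t])
  finally show ?thesis .
qed

lemma law_as_measure:
  assumes t: "0 \<le> t" and B: "B \<in> sets borel"
  shows "deriv_series_sums lam
      (\<lambda>k m. LINT s:{0..}|distr M borel (L t). exp (- s * m powr \<gamma>) *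
         measure (distr M borel (Aa (a powr \<alpha> * s))) ((\<lambda>x. x + real k) -` B))
      (measure (distr M borel (X t)) B)" (is ?A)
    and "deriv_series_sums lam
      (\<lambda>k m. LINT \<omega>|M. exp (- (m powr \<gamma>) * L t \<omega>) *
         measure (distr M borel (Aa (a powr \<alpha> * L t \<omega>))) ((\<lambda>x. x + real k) -` B))
      (measure (distr M borel (X t)) B)" (is ?B)
proof -
  note [measurable] = L_measurable[OF t] scaled_prob_measurable[OF B]
  interpret D: prob_space "distr M borel (X t)"
    by (rule prob_space_distr) (rule X_measurable[OF t])
  have Ar: "Aa' (a powr \<alpha> * s) = Aa (a powr \<alpha> * s)" if "0 \<le> s" for s
    using that by (simp add: Aa'_def[abs_def])
  have sp1: "scaled_prob B k s \<le> 1" for k s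
  proof -
    have "prob_space (distr M borel (Aa' (a powr \<alpha> * s)))"
      by (rule prob_space_distr) (rule Aa'_measurable)
    then show ?thesis unfolding scaled_prob_def by (rule prob_space.prob_le_1)
  qed
  have gi: "integrable M (\<lambda>\<omega>. scaled_prob B k (L t \<omega>))" for k
    by (rule integrable_const_bound[where B=1]) (use sp1 scaled_prob_nonneg in auto)
  have p: "(\<Sum>k. \<integral>\<^sup>+\<omega>. count_prob k (L t \<omega>) * ennreal (scaled_prob B k (L t \<omega>)) \<partial>M)
      = ennreal (measure (distr M borel (X t)) B)"
    using emeasure_X[OF t B] by (simp add: D.emeasure_eq_measure)
  have f2: "(LINT \<omega>|M. exp (- (m powr \<gamma>) * L t \<omega>) *
         measure (distr M borel (Aa (a powr \<alpha> * L t \<omega>))) ((\<lambda>x. x + real k) -` B))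
      = (LINT \<omega>|M. exp (- (m powr \<gamma>) * L t \<omega>) * scaled_prob B k (L t \<omega>))" for k m
    by (rule Bochner_Integration.integral_cong) (auto simp: scaled_prob_def Ar L_nonneg[OF t])
  show ?B
    by (rule deriv_series_sumsI[OF t _ _ gi f2 p]) (simp_all add: scaled_prob_nonneg)
  have f1: "(LINT s:{0..}|distr M borel (L t). exp (- s * m powr \<gamma>) *
         measure (distr M borel (Aa (a powr \<alpha> * s))) ((\<lambda>x. x + real k) -` B))
      = (LINT \<omega>|M. exp (- (m powr \<gamma>) * L t \<omega>) * scaled_prob B k (L t \<omega>))" for k m
  proof -
    have "(LINT s:{0..}|distr M borel (L t). exp (- s * m powr \<gamma>) *
         measure (distr M borel (Aa (a powr \<alpha> * s))) ((\<lambda>x. x + real k) -` B))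
      = (LINT s|distr M borel (L t). indicator {0..} s * (exp (- s * m powr \<gamma>) * scaled_prob B k s))"
      unfolding set_lebesgue_integral_def
      by (rule Bochner_Integration.integral_cong) (auto simp: scaled_prob_def Ar indicator_def)
    also have "\<dots> = (LINT \<omega>|M. indicator {0..} (L t \<omega>) * (exp (- L t \<omega> * m powr \<gamma>) * scaled_prob B k (L t \<omega>)))"
      by (rule integral_distr) measurable
    also have "\<dots> = (LINT \<omega>|M. exp (- (m powr \<gamma>) * L t \<omega>) * scaled_prob B k (L t \<omega>))"
      by (rule Bochner_Integration.integral_cong) (auto simp: L_nonneg[OF t] mult.commute)
    finally show ?thesis .
  qed
  show ?A
    by (rule deriv_series_sumsI[OF t _ _ gi f1 p]) (simp_all add: scaled_prob_nonneg)
qed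

text \<open>Tonelli gives a density with values in \<open>ennreal\<close>. The pointwise series
  needs both a finite density and integrable weights; each holds for almost every x because the
  integral over x is 1.\<close>

lemma law_as_density:
  fixes h l :: "real \<Rightarrow> real \<Rightarrow> real"
  assumes t: "0 < t" and a0: "0 < a" and h: "density_family M Aa h"
    and l: "\<beta> < 1 \<Longrightarrow> density_family M L l"
  shows "\<exists>p. (\<forall>x. 0 \<le> p x) \<and> distributed M lborel (X t) (\<lambda>x. ennreal (p x)) \<and>
    (AE x in lborel.
      (\<beta> < 1 \<longrightarrow> deriv_series_sums lam
         (\<lambda>k m. LINT s:{0<..}|lborel. exp (- s * m powr \<gamma>) * h (x - real k) (a powr \<alpha> * s) * l s t) (p x)) \<and>
      deriv_series_sums lam
         (\<lambda>k m. LINT \<omega>|M. exp (- (m powr \<gamma>) * L t \<omega>) * h (x - real k) (a powr \<alpha> * L t \<omega>)) (p x))"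
proof -
  have t0: "0 \<le> t" using t by simp
  note [measurable] = L_measurable[OF t0] X_measurable[OF t0]
  have hm[measurable]: "(\<lambda>(x, s). h x s) \<in> borel_measurable (borel \<Otimes>\<^sub>M borel)"
    and h0: "\<And>x s. 0 \<le> h x s"
    and hd: "\<And>s. 0 < s \<Longrightarrow> distributed M lborel (Aa s) (\<lambda>x. ennreal (h x s))"
    using h by (auto simp: density_family_def)
  interpret P: pair_sigma_finite lborel M
    by (simp add: pair_sigma_finite_def sigma_finite_measure_axioms sigma_finite_lborel)
  define g where "g x k s = h (x - real k) (a powr \<alpha> * s)" for x k s
  have gm[measurable]: "(\<lambda>(x, s). g x k s) \<in> borel_measurable (borel \<Otimes>\<^sub>M borel)" for k
    unfolding g_def by measurable
  have gm': "g x k \<in> borel_measurable borel" for x k unfolding g_def by measurable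
  have g0: "0 \<le> g x k s" for x k s by (simp add: g_def h0)
  \<comment> \<open>Needs s > 0 and a > 0, since h is a density only at positive times. The random
    time \<open>L t\<close> meets this condition almost surely.\<close>
  have scaled: "ennreal (scaled_prob B k s) = (\<integral>\<^sup>+x. ennreal (g x k s) * indicator B x \<partial>lborel)"
    if [measurable]: "B \<in> sets borel" and s: "0 < s" for B k s
  proof -
    have r: "0 < a powr \<alpha> * s" using a0 s by simp
    then have Ar: "Aa' (a powr \<alpha> * s) = Aa (a powr \<alpha> * s)" by (simp add: Aa'_def[abs_def])
    have "(\<integral>\<^sup>+x. ennreal (g x k s) * indicator B x \<partial>lborel)
        = ennreal \<bar>1\<bar> * (\<integral>\<^sup>+y. ennreal (g (real k + 1 * y) k s) * indicator B (real k + 1 * y) \<partial>lborel)"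
      by (rule nn_integral_real_affine) measurable
    also have "\<dots> = (\<integral>\<^sup>+y. ennreal (h y (a powr \<alpha> * s)) * indicator B (real k + y) \<partial>lborel)"
      by (simp add: g_def)
    also have "\<dots> = (\<integral>\<^sup>+\<omega>. indicator B (real k + Aa (a powr \<alpha> * s) \<omega>) \<partial>M)"
      by (rule distributed_nn_integral[OF hd[OF r]]) measurable
    finally show ?thesis by (simp add: scaled_prob_ennreal[OF that(1)] Ar)
  qed
  have Lpos: "AE \<omega> in M. 0 < L t \<omega>"
    by (rule AE_inverse_subordinator_pos[OF prob_space_axioms L \<beta> t])
  define pe where "pe x = (\<Sum>k. \<integral>\<^sup>+\<omega>. count_prob k (L t \<omega>) * ennreal (g x k (L t \<omega>)) \<partial>M)" for x
  have pem[measurable]: "pe \<in> borel_measurable borel" unfolding pe_def by measurable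
  have dens: "distr M borel (X t) = density lborel pe"
  proof (rule measure_eqI)
    fix B assume "B \<in> sets (distr M borel (X t))"
    then have B[measurable]: "B \<in> sets borel" by simp
    have "emeasure (distr M borel (X t)) B
       = (\<Sum>k. \<integral>\<^sup>+\<omega>. count_prob k (L t \<omega>) * ennreal (scaled_prob B k (L t \<omega>)) \<partial>M)"
      by (rule emeasure_X[OF t0 B])
    also have "\<dots> = (\<Sum>k. \<integral>\<^sup>+\<omega>. \<integral>\<^sup>+x. count_prob k (L t \<omega>) * ennreal (g x k (L t \<omega>)) * indicator B x \<partial>lborel \<partial>M)"
    proof (intro suminf_cong nn_integral_cong_AE)
      fix k
      show "AE \<omega> in M. count_prob k (L t \<omega>) * ennreal (scaled_prob B k (L t \<omega>))
        = (\<integral>\<^sup>+x. count_prob k (L t \<omega>) * ennreal (g x k (L t \<omega>)) * indicator B x \<partial>lborel)"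
        using Lpos
      proof eventually_elim
        case (elim \<omega>)
        have "(\<integral>\<^sup>+x. count_prob k (L t \<omega>) * (ennreal (g x k (L t \<omega>)) * indicator B x) \<partial>lborel)
            = count_prob k (L t \<omega>) * (\<integral>\<^sup>+x. ennreal (g x k (L t \<omega>)) * indicator B x \<partial>lborel)"
          by (rule nn_integral_cmult) measurable
        then show ?case using scaled[OF B elim, of k] by (simp add: mult.assoc)
      qed
    qed
    also have "\<dots> = (\<Sum>k. \<integral>\<^sup>+x. \<integral>\<^sup>+\<omega>. count_prob k (L t \<omega>) * ennreal (g x k (L t \<omega>)) * indicator B x \<partial>M \<partial>lborel)"
      by (intro suminf_cong P.Fubini') measurable
    also have "\<dots> = (\<integral>\<^sup>+x. (\<Sum>k. \<integral>\<^sup>+\<omega>. count_prob k (L t \<omega>) * ennreal (g x k (L t \<omega>)) * indicator B x \<partial>M) \<partial>lborel)"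
      by (rule nn_integral_suminf[symmetric]) measurable
    also have "\<dots> = (\<integral>\<^sup>+x. pe x * indicator B x \<partial>lborel)"
      by (intro nn_integral_cong) (simp add: pe_def nn_integral_multc)
    finally show "emeasure (distr M borel (X t)) B = emeasure (density lborel pe) B"
      by (simp add: emeasure_density)
  qed simp
  interpret D: prob_space "distr M borel (X t)" by (rule prob_space_distr) measurable
  have "(\<integral>\<^sup>+x. pe x \<partial>lborel) = emeasure (density lborel pe) UNIV"
    by (simp add: emeasure_density)
  also have "\<dots> = 1" using D.emeasure_space_1 unfolding dens[symmetric] by simp
  finally have pefin: "AE x in lborel. pe x \<noteq> \<infinity>"
    by (intro nn_integral_PInf_AE) auto
  have gfin: "AE x in lborel. \<forall>k. integrable M (\<lambda>\<omega>. g x k (L t \<omega>))"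
    unfolding AE_all_countable
  proof
    fix k
    have "(\<integral>\<^sup>+x. \<integral>\<^sup>+\<omega>. ennreal (g x k (L t \<omega>)) \<partial>M \<partial>lborel) = (\<integral>\<^sup>+\<omega>. \<integral>\<^sup>+x. ennreal (g x k (L t \<omega>)) \<partial>lborel \<partial>M)"
      by (rule P.Fubini'[symmetric]) measurable
    also have "\<dots> = (\<integral>\<^sup>+\<omega>. ennreal (scaled_prob UNIV k (L t \<omega>)) \<partial>M)"
    proof (rule nn_integral_cong_AE)
      show "AE \<omega> in M. (\<integral>\<^sup>+x. ennreal (g x k (L t \<omega>)) \<partial>lborel) = ennreal (scaled_prob UNIV k (L t \<omega>))"
        using Lpos by eventually_elim (simp add: scaled)
    qed
    also have "\<dots> = 1"
      by (simp add: scaled_prob_ennreal emeasure_space_1)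
    finally have "AE x in lborel. (\<integral>\<^sup>+\<omega>. ennreal (g x k (L t \<omega>)) \<partial>M) \<noteq> \<infinity>"
      by (intro nn_integral_PInf_AE) auto
    then show "AE x in lborel. integrable M (\<lambda>\<omega>. g x k (L t \<omega>))"
    proof eventually_elim
      case (elim x)
      note [measurable] = gm'[of x k]
      show ?case
        by (rule integrableI_nonneg) (use elim g0 in \<open>auto simp: less_top\<close>)
    qed
  qed
  define p where "p x = enn2real (pe x)" for x
  have p0: "0 \<le> p x" for x by (simp add: p_def)
  have dist: "distributed M lborel (X t) (\<lambda>x. ennreal (p x))"
    unfolding distributed_def
  proof (intro conjI)
    have "distr M lborel (X t) = distr M borel (X t)" by (rule distr_cong) auto
    also have "\<dots> = density lborel (\<lambda>x. ennreal (p x))"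
      unfolding dens
      by (rule density_cong) (use pefin in \<open>auto simp: p_def less_top elim!: eventually_mono\<close>)
    finally show "distr M lborel (X t) = density lborel (\<lambda>x. ennreal (p x))" .
  qed (auto simp: p_def)
  have "AE x in lborel.
      (\<beta> < 1 \<longrightarrow> deriv_series_sums lam
         (\<lambda>k m. LINT s:{0<..}|lborel. exp (- s * m powr \<gamma>) * h (x - real k) (a powr \<alpha> * s) * l s t) (p x)) \<and>
      deriv_series_sums lam
         (\<lambda>k m. LINT \<omega>|M. exp (- (m powr \<gamma>) * L t \<omega>) * h (x - real k) (a powr \<alpha> * L t \<omega>)) (p x)"
    using pefin gfin
  proof eventually_elim
    case (elim x)
    have px: "(\<Sum>k. \<integral>\<^sup>+\<omega>. count_prob k (L t \<omega>) * ennreal (g x k (L t \<omega>)) \<partial>M) = ennreal (p x)"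
      using elim(1) by (simp add: p_def pe_def less_top)
    have gi: "integrable M (\<lambda>\<omega>. g x k (L t \<omega>))" for k using elim(2) by blast
    note I = deriv_series_sumsI[OF t0 gm' g0 gi _ px p0]
    show ?case
    proof (intro conjI impI)
      show "deriv_series_sums lam
         (\<lambda>k m. LINT \<omega>|M. exp (- (m powr \<gamma>) * L t \<omega>) * h (x - real k) (a powr \<alpha> * L t \<omega>)) (p x)"
        by (rule I) (simp add: g_def)
      assume "\<beta> < 1"
      then have lm: "(\<lambda>(x, s). l x s) \<in> borel_measurable (borel \<Otimes>\<^sub>M borel)"
        and l0: "\<And>s t. 0 \<le> l s t" and lneg: "\<And>s t. s < 0 \<Longrightarrow> l s t = 0"
        and ld: "distributed M lborel (L t) (\<lambda>s. ennreal (l s t))"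
        using l t by (auto simp: density_family_def)
      note [measurable] = gm'
      have [measurable]: "(\<lambda>s. l s t) \<in> borel_measurable borel"
        using measurable_compose[OF measurable_Pair[OF measurable_ident_sets[OF refl] measurable_const[of t]] lm]
        by simp
      have "(LINT s:{0<..}|lborel. exp (- s * m powr \<gamma>) * h (x - real k) (a powr \<alpha> * s) * l s t)
          = (LINT \<omega>|M. exp (- (m powr \<gamma>) * L t \<omega>) * g x k (L t \<omega>))" for k m
      proof -
        have "(LINT s:{0<..}|lborel. exp (- s * m powr \<gamma>) * h (x - real k) (a powr \<alpha> * s) * l s t)
           = (LINT s|lborel. indicator {0<..} s * (exp (- s * m powr \<gamma>) * g x k s * l s t))"
          by (simp add: set_lebesgue_integral_def g_def)
        also have "\<dots> = (LINT s|lborel. l s t * (exp (- (m powr \<gamma>) * s) * g x k s))"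
        proof (rule integral_cong_AE)
          show "AE s in lborel. indicator {0<..} s * (exp (- s * m powr \<gamma>) * g x k s * l s t)
             = l s t * (exp (- (m powr \<gamma>) * s) * g x k s)"
            using AE_lborel_singleton[of "0::real"]
            by eventually_elim (auto simp: indicator_def lneg mult_ac)
        qed measurable
        also have "\<dots> = (LINT \<omega>|M. exp (- (m powr \<gamma>) * L t \<omega>) * g x k (L t \<omega>))"
          by (rule distributed_integral[OF ld]) (auto simp: l0)
        finally show ?thesis .
      qed
      then show "deriv_series_sums lam
         (\<lambda>k m. LINT s:{0<..}|lborel. exp (- s * m powr \<gamma>) * h (x - real k) (a powr \<alpha> * s) * l s t) (p x)"
        by (rule I)
    qed
  qed
  then show ?thesis using p0 dist by blast
qed

section \<open>The law as the only solution\<close>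

lemma half_line_X: "0 \<le> t \<Longrightarrow> half_line_measure (distr M borel (X t))"
  by (rule half_line_distr) (auto intro: X_measurable X_nonneg)

lemma continuous_laplace_X:
  assumes "0 < \<xi>"
  shows "continuous_on {0..} (\<lambda>t. laplace (distr M borel (X t)) \<xi>)"
proof -
  have "continuous_on {0..} (\<lambda>t. LINT \<omega>|M. exp (- symbol \<xi> * L t \<omega>))"
    by (rule continuous_laplace_inverse_subordinator[OF prob_space_axioms L \<beta>])
       (use symbol_pos[OF assms] in simp)
  then show ?thesis
    by (rule continuous_on_eq) (use laplace_X assms in auto)
qed

text \<open>\<open>L 0 = 0\<close> holds only almost surely, so the initial law is identified by its
  transform rather than pathwise.\<close>

lemma X_0: "distr M borel (X 0) = return borel 0"
proof (rule laplace_unique)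
  show "half_line_measure (return borel (0::real))"
    by (rule half_line_measureI) (auto simp: AE_return prob_space.finite_measure prob_space_return)
  fix \<xi> :: real assume "0 < \<xi>"
  have "laplace (distr M borel (X 0)) \<xi> = (LINT \<omega>|M. exp (- symbol \<xi> * L 0 \<omega>))"
    using \<open>0 < \<xi>\<close> by (rule laplace_X[OF order.refl])
  also have "\<dots> = (LINT \<omega>|M. 1)"
    by (rule integral_cong_AE)
       (use L_measurable[of 0] AE_inverse_subordinator_0[OF prob_space_axioms L \<beta>] in auto)
  also have "\<dots> = laplace (return borel 0) \<xi>"
    by (simp add: laplace_def integral_return prob_space)
  finally show "laplace (distr M borel (X 0)) \<xi> = laplace (return borel 0) \<xi>" .
qed (rule half_line_X, simp)

lemma laplace2_X:
  assumes "0 < \<xi>" "0 < \<eta>"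
  shows "set_integrable lborel {0<..} (\<lambda>t. exp (- \<eta> * t) * laplace (distr M borel (X t)) \<xi>)"
    and "(LINT t:{0<..}|lborel. exp (- \<eta> * t) * laplace (distr M borel (X t)) \<xi>)
      = \<eta> powr (\<beta> - 1) / (\<eta> powr \<beta> + symbol \<xi>)"
proof -
  note S = laplace_laplace_inverse_subordinator[OF prob_space_axioms L \<beta> symbol_pos[OF assms(1)] assms(2)]
  have eq: "exp (- \<eta> * t) * laplace (distr M borel (X t)) \<xi> = exp (- \<eta> * t) * (LINT \<omega>|M. exp (- symbol \<xi> * L t \<omega>))"
    if "t \<in> {0<..}" for t
    using that laplace_X[OF _ assms(1), of t] by simp
  show "set_integrable lborel {0<..} (\<lambda>t. exp (- \<eta> * t) * laplace (distr M borel (X t)) \<xi>)"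
    using S(1) by (subst set_integrable_cong[OF refl refl eq])
  show "(LINT t:{0<..}|lborel. exp (- \<eta> * t) * laplace (distr M borel (X t)) \<xi>)
      = \<eta> powr (\<beta> - 1) / (\<eta> powr \<beta> + symbol \<xi>)"
    using S(2) by (subst set_lebesgue_integral_cong[of _ _ _ "\<lambda>t. exp (- \<eta> * t) * (LINT \<omega>|M. exp (- symbol \<xi> * L t \<omega>))"])
      (use eq in auto)
qed

lemma equation_iff:
  assumes v: "\<And>t. 0 \<le> t \<Longrightarrow> half_line_measure (v t)"
    and v0: "v 0 = return borel 0"
    and cont: "\<And>\<xi>. 0 < \<xi> \<Longrightarrow> continuous_on {0..} (\<lambda>t. laplace (v t) \<xi>)"
    and int: "\<And>\<xi> \<eta>. 0 < \<xi> \<Longrightarrow> 0 < \<eta> \<Longrightarrow> set_integrable lborel {0<..} (\<lambda>t. exp (- \<eta> * t) * laplace (v t) \<xi>)"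
  shows "satisfies_equation \<alpha> \<beta> \<gamma> a lam v \<longleftrightarrow> (\<forall>\<xi>>0. \<forall>\<eta>>0.
    (LINT t:{0<..}|lborel. exp (- \<eta> * t) * laplace (v t) \<xi>) = \<eta> powr (\<beta> - 1) / (\<eta> powr \<beta> + symbol \<xi>))"
proof -
  have "0 < \<eta> powr \<beta> + symbol \<xi>" if "0 < \<xi>" for \<xi> \<eta>
    using symbol_pos[OF that] by (intro add_nonneg_pos) auto
  then have iff: "(\<eta> powr \<beta> + symbol \<xi>) * V = \<eta> powr (\<beta> - 1) \<longleftrightarrow> V = \<eta> powr (\<beta> - 1) / (\<eta> powr \<beta> + symbol \<xi>)"
    if "0 < \<xi>" for \<xi> \<eta> V
    by (subst nonzero_eq_divide_eq) (use that in \<open>auto simp: mult.commute less_imp_neq[symmetric]\<close>)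
  have "satisfies_equation \<alpha> \<beta> \<gamma> a lam v \<longleftrightarrow> (\<forall>\<xi>>0. \<forall>\<eta>>0. (\<eta> powr \<beta> + symbol \<xi>) *
      (LINT t:{0<..}|lborel. exp (- \<eta> * t) * laplace (v t) \<xi>) = \<eta> powr (\<beta> - 1))"
    unfolding symbol_def by (rule satisfies_equation_iff[OF v v0 cont int \<alpha> \<beta>])
  also have "\<dots> \<longleftrightarrow> (\<forall>\<xi>>0. \<forall>\<eta>>0.
      (LINT t:{0<..}|lborel. exp (- \<eta> * t) * laplace (v t) \<xi>) = \<eta> powr (\<beta> - 1) / (\<eta> powr \<beta> + symbol \<xi>))"
    by (intro all_cong iff)
  finally show ?thesis .
qed

lemma is_solution_X: "is_solution \<alpha> \<beta> \<gamma> a lam (\<lambda>t. distr M borel (X t))"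
  unfolding is_solution_def
proof (intro conjI allI impI)
  fix t :: real assume "0 \<le> t"
  from half_line_X[OF this]
  show "sets (distr M borel (X t)) = sets borel" "finite_measure (distr M borel (X t))"
    "emeasure (distr M borel (X t)) {..<0} = 0"
    by (auto simp: half_line_measure_def)
next
  fix f :: "real \<Rightarrow> real" assume f: "continuous_on UNIV f" "bounded (range f)"
  show "continuous_on {0..} (\<lambda>t. LINT x|distr M borel (X t). f x)"
    unfolding continuous_on_def
  proof
    fix t :: real assume t: "t \<in> {0..}"
    have ev: "eventually (\<lambda>s. s \<in> {0..}) (at t within {0..})"
      by (auto simp: eventually_at_filter)
    show "((\<lambda>t. LINT x|distr M borel (X t). f x) \<longlongrightarrow> (LINT x|distr M borel (X t). f x)) (at t within {0..})"
    proof (rule laplace_continuity[OF half_line_X _ _ f])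
      show "eventually (\<lambda>s. half_line_measure (distr M borel (X s))) (at t within {0..})"
        using ev by eventually_elim (simp add: half_line_X)
      fix \<xi> :: real assume "0 \<le> \<xi>"
      show "((\<lambda>s. laplace (distr M borel (X s)) \<xi>) \<longlongrightarrow> laplace (distr M borel (X t)) \<xi>) (at t within {0..})"
      \<comment> \<open>Continuity of the transform in time is available for \<xi> > 0; at \<xi> = 0
        the transform is the total mass, constantly 1.\<close>
      proof (cases "\<xi> = 0")
        case True
        have one: "laplace (distr M borel (X s)) 0 = 1" if "0 \<le> s" for s
          by (subst laplace_distr[OF X_measurable[OF that]]) (simp add: prob_space)
        have "eventually (\<lambda>s. 1 = laplace (distr M borel (X s)) \<xi>) (at t within {0..})"
          using ev by eventually_elim (simp add: one True)
        then show ?thesis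
          using t one True by (intro Lim_transform_eventually[OF tendsto_const]) (simp_all add: one)
      next
        case False
        then show ?thesis
          using continuous_laplace_X[of \<xi>] \<open>0 \<le> \<xi>\<close> t by (simp add: continuous_on_def)
      qed
    qed (use t in simp)
  qed
next
  fix \<eta> :: real assume "0 < \<eta>"
  have "integrable lborel (\<lambda>t. indicator {0<..} t * exp (- \<eta> * t))"
  proof (rule integrableI_nonneg)
    have "(\<integral>\<^sup>+t. ennreal (indicator {0<..} t * exp (- \<eta> * t)) \<partial>lborel)
       \<le> (\<integral>\<^sup>+t. ennreal (exp (- (\<eta> * t))) * indicator {0..} t \<partial>lborel)"
      by (intro nn_integral_mono) (auto simp: indicator_def)
    also have "\<dots> < \<infinity>" using \<open>0 < \<eta>\<close> by (simp add: nn_integral_exp_Ici)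
    finally show "(\<integral>\<^sup>+t. ennreal (indicator {0<..} t * exp (- \<eta> * t)) \<partial>lborel) < \<infinity>" .
  qed auto
  then have i: "set_integrable lborel {0<..} (\<lambda>t. exp (- \<eta> * t))"
    by (simp add: set_integrable_def)
  have one: "measure (distr M borel (X t)) UNIV = 1" if "t \<in> {0<..}" for t
    using that prob_space.prob_space[OF prob_space_distr[OF X_measurable[of t]]] by simp
  show "set_integrable lborel {0<..} (\<lambda>t. exp (- \<eta> * t) * measure (distr M borel (X t)) UNIV)"
    by (subst set_integrable_cong[OF refl refl, where f'="\<lambda>t. exp (- \<eta> * t)"]) (use i one in auto)
next
  show "distr M borel (X 0) = return borel 0" by (rule X_0)
  show "satisfies_equation \<alpha> \<beta> \<gamma> a lam (\<lambda>t. distr M borel (X t))"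
    by (rule equation_iff[OF half_line_X X_0 continuous_laplace_X laplace2_X(1), THEN iffD2])
       (assumption | intro allI impI laplace2_X(2))+
qed

text \<open>The equation fixes the double transform. For each \<xi>, inversion in t recovers the
  transform in x at every t > 0, and inversion in x then recovers the measure.\<close>

lemma is_solution_unique:
  assumes sol: "is_solution \<alpha> \<beta> \<gamma> a lam v" and "0 \<le> t"
  shows "v t = distr M borel (X t)"
proof -
  have v: "half_line_measure (v t)" if "0 \<le> t" for t
    using sol that by (simp add: is_solution_def half_line_measure_def)
  have v0: "v 0 = return borel 0" using sol by (simp add: is_solution_def)
  have cont: "continuous_on {0..} (\<lambda>t. laplace (v t) \<xi>)" if "0 < \<xi>" for \<xi>
  proof -
    \<comment> \<open>Weak continuity is assumed for bounded functions only, and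
      \<open>exp (- \<xi> * x)\<close> is unbounded on the negative axis. Truncation at 0 changes
      nothing, as there is no mass there.\<close>
    have "continuous_on {0..} (\<lambda>t. LINT x|v t. exp (- \<xi> * max 0 x))"
    proof -
      have "continuous_on UNIV (\<lambda>x::real. exp (- \<xi> * max 0 x))" by (intro continuous_intros)
      moreover have "bounded (range (\<lambda>x::real. exp (- \<xi> * max 0 x)))"
        using that by (auto simp: bounded_iff intro!: exI[of _ 1])
      ultimately show ?thesis using sol by (simp add: is_solution_def)
    qed
    moreover have "(LINT x|v t. exp (- \<xi> * max 0 x)) = laplace (v t) \<xi>" if "0 \<le> t" for t
      unfolding laplace_def
    proof (rule integral_cong_AE)
      show "AE x in v t. exp (- \<xi> * max 0 x) = exp (- \<xi> * x)"
        using half_line_measureD(3)[OF v[OF that]] by eventually_elim simp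
    qed (use half_line_measureD(1)[OF v[OF that]] in \<open>simp_all cong: measurable_cong_sets\<close>)
    ultimately show ?thesis by (rule continuous_on_eq) simp
  qed
  have int: "set_integrable lborel {0<..} (\<lambda>t. exp (- \<eta> * t) * laplace (v t) \<xi>)" if "0 < \<xi>" "0 < \<eta>" for \<xi> \<eta>
    unfolding set_integrable_def
  proof (rule Bochner_Integration.integrable_bound)
    \<comment> \<open>On the half-line the transform is at most the total mass, whose Laplace
      integrability in t belongs to the notion of solution.\<close>
    show "integrable lborel (\<lambda>t. indicator {0<..} t *\<^sub>R (exp (- \<eta> * t) * measure (v t) UNIV))"
      using sol that by (simp add: is_solution_def set_integrable_def)
    have "continuous_on {0<..} (\<lambda>t. exp (- \<eta> * t) * laplace (v t) \<xi>)"
      by (intro continuous_intros continuous_on_subset[OF cont[OF that(1)]]) auto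
    then have "(\<lambda>t. exp (- \<eta> * t) * laplace (v t) \<xi>) \<in> borel_measurable (restrict_space borel {0<..})"
      by (rule borel_measurable_continuous_on_restrict)
    then show "(\<lambda>t. indicator {0<..} t *\<^sub>R (exp (- \<eta> * t) * laplace (v t) \<xi>)) \<in> borel_measurable lborel"
      by (simp add: borel_measurable_restrict_space_iff)
    show "AE t in lborel. norm (indicator {0<..} t *\<^sub>R (exp (- \<eta> * t) * laplace (v t) \<xi>))
        \<le> norm (indicator {0<..} t *\<^sub>R (exp (- \<eta> * t) * measure (v t) UNIV))"
    proof (rule AE_I2)
      fix t :: real
      show "norm (indicator {0<..} t *\<^sub>R (exp (- \<eta> * t) * laplace (v t) \<xi>))
        \<le> norm (indicator {0<..} t *\<^sub>R (exp (- \<eta> * t) * measure (v t) UNIV))"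
      proof (cases "0 < t")
        case True
        then have vt: "half_line_measure (v t)" using v by simp
        interpret finite_measure "v t" using half_line_measureD[OF vt] by simp
        have sp: "space (v t) = UNIV" using sets_eq_imp_space_eq[OF half_line_measureD(1)[OF vt]] by simp
        have "laplace (v t) \<xi> \<le> (LINT x|v t. 1)"
          unfolding laplace_def
        proof (rule integral_mono_AE)
          show "integrable (v t) (\<lambda>x. exp (- \<xi> * x))"
            using half_line_integrable_exp[OF vt, of \<xi>] that by simp
          show "AE x in v t. exp (- \<xi> * x) \<le> 1"
            using half_line_measureD(3)[OF vt] by eventually_elim (use that in simp)
        qed simp
        then have "laplace (v t) \<xi> \<le> measure (v t) UNIV" by (simp add: sp)
        then show ?thesis using True by (simp add: laplace_nonneg abs_mult)
      qed simp
    qed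
  qed
  have eq: "(LINT t:{0<..}|lborel. exp (- \<eta> * t) * laplace (v t) \<xi>) = \<eta> powr (\<beta> - 1) / (\<eta> powr \<beta> + symbol \<xi>)"
    if "0 < \<xi>" "0 < \<eta>" for \<xi> \<eta>
  proof -
    have "satisfies_equation \<alpha> \<beta> \<gamma> a lam v" using sol by (simp add: is_solution_def)
    moreover have "satisfies_equation \<alpha> \<beta> \<gamma> a lam v \<longleftrightarrow> (\<forall>\<xi>>0. \<forall>\<eta>>0.
      (LINT t:{0<..}|lborel. exp (- \<eta> * t) * laplace (v t) \<xi>) = \<eta> powr (\<beta> - 1) / (\<eta> powr \<beta> + symbol \<xi>))"
      by (rule equation_iff[OF v v0 cont int])
    ultimately show ?thesis using that by (simp only: simp_thms)
  qed
  show ?thesis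
  proof (rule laplace_unique[OF v half_line_X])
    fix \<xi> :: real assume "0 < \<xi>"
    show "laplace (v t) \<xi> = laplace (distr M borel (X t)) \<xi>"
    \<comment> \<open>Inversion in t says nothing at t = 0, where both families carry the prescribed
      initial law.\<close>
    proof (cases "t = 0")
      case True
      then show ?thesis by (simp add: v0 X_0)
    next
      case False
      then have "0 < t" using \<open>0 \<le> t\<close> by simp
      show ?thesis
      proof (rule laplace_unique_density[OF cont laplace_nonneg continuous_laplace_X laplace_nonneg
            int laplace2_X(1) _ \<open>0 < t\<close>])
        show "(LINT t:{0<..}|lborel. exp (- \<eta> * t) * laplace (v t) \<xi>)
           = (LINT t:{0<..}|lborel. exp (- \<eta> * t) * laplace (distr M borel (X t)) \<xi>)" if "0 < \<eta>" for \<eta>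
          using eq laplace2_X(2) \<open>0 < \<xi>\<close> that by simp
      qed (use \<open>0 < \<xi>\<close> in auto)
    qed
  qed (use \<open>0 \<le> t\<close> in auto)
qed

end

theorem theorem6:
  fixes M :: "'a measure"
    and \<alpha> \<beta> \<gamma> a lam :: real
    and N :: "real \<Rightarrow> 'a \<Rightarrow> nat"
    and Ag Aa L :: "real \<Rightarrow> 'a \<Rightarrow> real"
    and h l :: "real \<Rightarrow> real \<Rightarrow> real"
  assumes "prob_space M"
    and "0 < \<alpha>" "\<alpha> \<le> 1" "0 < \<beta>" "\<beta> \<le> 1" "0 < \<gamma>" "\<gamma> \<le> 1" "0 \<le> a" "0 < lam"
    and "poisson_process M lam N"
    and "stable_subordinator M \<gamma> Ag"
    and "stable_subordinator M \<alpha> Aa"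
    and "inverse_stable_subordinator M \<beta> L"
    and "indep_processes M [\<lambda>t \<omega>. real (N t \<omega>), Ag, Aa, L]"
    and "\<alpha> < 1 \<Longrightarrow> density_family M Aa h"
    and "\<beta> < 1 \<Longrightarrow> density_family M L l"
  defines "X \<equiv> drifted_process a N Ag Aa L"
  shows
    \<comment> \<open>the law as a measure (generalized density), for all parameters\<close>
    "(\<forall>t>0. X t \<in> borel_measurable M \<and>
       (\<forall>B\<in>sets borel.
         deriv_series_sums lam
           (\<lambda>k m. LINT s:{0..}|distr M borel (L t). exp (- s * m powr \<gamma>) *
              measure (distr M borel (Aa (a powr \<alpha> * s))) ((\<lambda>x. x + real k) -` B))
           (measure (distr M borel (X t)) B) \<and>
         deriv_series_sums lam
           (\<lambda>k m. LINT \<omega>|M. exp (- (m powr \<gamma>) * L t \<omega>) *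
              measure (distr M borel (Aa (a powr \<alpha> * L t \<omega>))) ((\<lambda>x. x + real k) -` B))
           (measure (distr M borel (X t)) B)))
     \<and> \<comment> \<open>the law as a density, when the densities exist\<close>
     (\<alpha> < 1 \<longrightarrow> 0 < a \<longrightarrow>
       (\<forall>t>0. \<exists>p. (\<forall>x. 0 \<le> p x) \<and> distributed M lborel (X t) (\<lambda>x. ennreal (p x)) \<and>
         (AE x in lborel.
           (\<beta> < 1 \<longrightarrow> deriv_series_sums lam
              (\<lambda>k m. LINT s:{0<..}|lborel. exp (- s * m powr \<gamma>) * h (x - real k) (a powr \<alpha> * s) * l s t)
              (p x)) \<and>
           deriv_series_sums lam
              (\<lambda>k m. LINT \<omega>|M. exp (- (m powr \<gamma>) * L t \<omega>) * h (x - real k) (a powr \<alpha> * L t \<omega>))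
              (p x))))
     \<and> \<comment> \<open>the law is the solution of the equation\<close>
     is_solution \<alpha> \<beta> \<gamma> a lam (\<lambda>t. distr M borel (X t)) \<and>
     (\<forall>v. is_solution \<alpha> \<beta> \<gamma> a lam v \<longrightarrow> (\<forall>t\<ge>0. v t = distr M borel (X t)))"
proof -
  interpret D: drifted_fractional_process M \<alpha> \<beta> \<gamma> a lam N Ag Aa L
    by (intro drifted_fractional_process.intro drifted_fractional_process_axioms.intro assms)
  have X: "D.X = X" by (simp add: D.X_def X_def)
  show ?thesis
    unfolding X[symmetric]
  proof (intro conjI allI impI ballI)
    show "is_solution \<alpha> \<beta> \<gamma> a lam (\<lambda>t. distr M borel (D.X t))" by (rule D.is_solution_X)
  next
    fix t :: real and B :: "real set" assume "0 < t" "B \<in> sets borel"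
    then show "deriv_series_sums lam
       (\<lambda>k m. LINT s:{0..}|distr M borel (L t). exp (- s * m powr \<gamma>) *
          measure (distr M borel (Aa (a powr \<alpha> * s))) ((\<lambda>x. x + real k) -` B))
       (measure (distr M borel (D.X t)) B)"
      by (intro D.law_as_measure(1)) simp_all
  next
    fix t :: real and B :: "real set" assume "0 < t" "B \<in> sets borel"
    then show "deriv_series_sums lam
       (\<lambda>k m. LINT \<omega>|M. exp (- (m powr \<gamma>) * L t \<omega>) *
          measure (distr M borel (Aa (a powr \<alpha> * L t \<omega>))) ((\<lambda>x. x + real k) -` B))
       (measure (distr M borel (D.X t)) B)"
      by (intro D.law_as_measure(2)) simp_all
  next
    fix t :: real assume "0 < t"
    then show "D.X t \<in> borel_measurable M" by (intro D.X_measurable) simp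
  next
    fix t :: real assume "\<alpha> < 1" "0 < a" "0 < t"
    show "\<exists>p. (\<forall>x. 0 \<le> p x) \<and> distributed M lborel (D.X t) (\<lambda>x. ennreal (p x)) \<and>
      (AE x in lborel.
        (\<beta> < 1 \<longrightarrow> deriv_series_sums lam
           (\<lambda>k m. LINT s:{0<..}|lborel. exp (- s * m powr \<gamma>) * h (x - real k) (a powr \<alpha> * s) * l s t) (p x)) \<and>
        deriv_series_sums lam
           (\<lambda>k m. LINT \<omega>|M. exp (- (m powr \<gamma>) * L t \<omega>) * h (x - real k) (a powr \<alpha> * L t \<omega>)) (p x))"
      by (rule D.law_as_density[OF \<open>0 < t\<close> \<open>0 < a\<close> assms(15)[OF \<open>\<alpha> < 1\<close>] assms(16)])
  next
    fix v t assume "is_solution \<alpha> \<beta> \<gamma> a lam v" "(0::real) \<le> t"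
    then show "v t = distr M borel (D.X t)" by (rule D.is_solution_unique)
  qed
qed

end
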